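(* Let $(\mathcal C,\mathbb E,\mathfrak s)$ be an extriangulated category satisfying (WIC), with a proper class $\xi$ of $\mathbb E$-triangles having enough $\xi$-projectives and enough $\xi$-injectives, and let $\mathcal X$ be a quasi-resolving subcategory of $\mathcal C$. Write $\mathcal G=\mathcal{GQP}_{\mathcal X}(\xi)$ and $\mathcal P=\mathcal P_{\mathcal X}(\xi)$. Let $M$ be an object of $\mathcal C$ with $\mathrm{res.dim}_{\mathcal G}(M)<\infty$. Then for any $n\ge0$ the following are equivalent: (1) $\mathrm{res.dim}_{\mathcal G}(M)\le n$. (2) There is an $\mathbb E$-triangle $M\to W\to G\dashrightarrow$ in $\xi$ with $G\in\mathcal G$ and $\mathrm{res.dim}_{\mathcal P}(W)\le n$. (3) There is an $\mathbb E$-triangle $K\to G'\to M\dashrightarrow$ in $\xi$ with $G'\in\mathcal G$ and $\mathrm{res.dim}_{\mathcal P}(K)\le n-1$. (4) There are two $\mathbb E$-triangles $W_M\to G_M\to M\dashrightarrow$ and $M\to W^M\to G^M\dashrightarrow$ in $\xi$ such that $G_M,G^M\in\mathcal G$, $\mathrm{res.dim}_{\mathcal P}(W_M)\le n-1$ and $\mathrm{res.dim}_{\mathcal P}(W^M)=\mathrm{res.dim}_{\mathcal G}(W^M)\le n$. (5) There is a $\xi$-exact complex $0\to P_n\to P_{n-1}\to\cdots\to P_1\to G\to M\to0$ with $G\in\mathcal G$ and all $P_i\in\mathcal P$. (6) For every $0\le m\le n$ there is a $\xi$-exact complex $$0\to P_n\to\cdots\to P_{m+1}\to G_m\to P_{m-1}\to\cdots\to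 P_1\to P_0\to M\to0$$ with $G_m\in\mathcal G$ and all $P_i\in\mathcal P$. (7) $\xi\mathrm{xt}^{n+i}_\xi(M,P)=0$ for all $P\in\mathcal P$ and $i\ge1$. (8) $\xi\mathrm{xt}^{n+i}_\xi(M,Q)=0$ for all $Q\in\widehat{\mathcal P}$ and $i\ge1$. (9) $\xi\mathrm{xt}^{n+i}_\xi(M,X)=0$ for all $X\in\mathcal X$ and $i\ge1$. (10) $\xi\mathrm{xt}^{n+i}_\xi(M,N)=0$ for all $N\in\widehat{\mathcal X}$ and $i\ge1$.
   Context: Extriangulated category (Nakaoka--Palu): an additive category $\mathcal C$, a biadditive functor $\mathbb E:\mathcal C^{\mathrm{op}}\times\mathcal C\to\mathbf{Ab}$, and $\mathfrak s$, as follows. For $\delta\in\mathbb E(C,A)$, $a:A\to A'$, $c:C'\to C$ put $a_*\delta=\mathbb E(C,a)(\delta)$ and $c^*\delta=\mathbb E(c,A)(\delta)$. Sequences $A\to B\to C$ and $A\to B'\to C$ are equivalent if some isomorphism $B\to B'$ commutes with the maps from $A$ and to $C$. $\mathfrak s$ assigns to each $\delta\in\mathbb E(C,A)$ an equivalence class of sequences $A\xrightarrow{x}B\xrightarrow{y}C$; a representative is written $A\xrightarrow{x}B\xrightarrow{y}C\overset{\delta}{\dashrightarrow}$ and called an $\mathbb E$-triangle ($x$ is an inflation, $y$ a deflation; $\delta$ is often omitted). Axioms, for $\mathbb E$-triangles $A\xrightarrow{x}B\xrightarrow{y}C\overset{\delta}{\dashrightarrow}$ and $A'\xrightarrow{x'}B'\xrightarrow{y'}C'\overset{\delta'}{\dashrightarrow}$: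 (i) if $a:A\to A'$, $c:C\to C'$ satisfy $a_*\delta=c^*\delta'$, there is $b:B\to B'$ with $bx=x'a$, $y'b=cy$; (ii) $\mathfrak s(0)=[A\to A\oplus C\to C]$ and $\mathfrak s(\delta\oplus\delta')=\mathfrak s(\delta)\oplus\mathfrak s(\delta')$; (iii) if $a:A\to A'$, $b:B\to B'$ satisfy $bx=x'a$, there is $c:C\to C'$ with $y'b=cy$ and $a_*\delta=c^*\delta'$, and dually; (iv) given $\mathbb E$-triangles $A\xrightarrow{f}B\xrightarrow{f'}D\overset{\delta}{\dashrightarrow}$ and $B\xrightarrow{g}C\xrightarrow{g'}F\overset{\delta'}{\dashrightarrow}$, there are $\mathbb E$-triangles $A\xrightarrow{gf}C\xrightarrow{h'}E\overset{\delta''}{\dashrightarrow}$ and $D\xrightarrow{d}E\xrightarrow{e}F\overset{f'_*\delta'}{\dashrightarrow}$ with $h'g=df'$, $eh'=g'$, $d^*\delta''=\delta$, $f_*\delta''=e^*\delta'$, and dually. (WIC): if $gf$ is an inflation so is $f$; if $gf$ is a deflation so is $g$. Proper class: a class $\xi$ of $\mathbb E$-triangles, closed under isomorphisms and finite coproducts, containing all split $\mathbb E$-triangles ($\delta=0$), closed under base change (replacing $\delta$ by $c^*\delta$) and cobase change (replacing $\delta$ by $a_*\delta$), and saturated: given $\mathbb E$-triangles $A_1\to B_1\to C\overset{\delta_1}{\dashrightarrow}$ and $A_2\to B_2\xrightarrow{y_2}C\overset{\delta_2}{\dashrightarrow}$, if the second one and the $\mathbb E$-triangle $A_1\to M\to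 B_2\overset{y_2^*\delta_1}{\dashrightarrow}$ lie in $\xi$, so does the first. $P$ is $\xi$-projective if $0\to\mathcal C(P,A)\to\mathcal C(P,B)\to\mathcal C(P,C)\to0$ is exact for every $\mathbb E$-triangle $A\to B\to C\dashrightarrow$ in $\xi$; $\xi$-injectives are defined dually; $\mathcal P(\xi)$ is the class of $\xi$-projectives. Enough $\xi$-projectives (injectives): every $A$ has an $\mathbb E$-triangle $K\to P\to A\dashrightarrow$ (resp. $A\to I\to K\dashrightarrow$) in $\xi$ with $P$ $\xi$-projective (resp. $I$ $\xi$-injective). A complex $\cdots\to X_{n+1}\to X_n\xrightarrow{d_n}X_{n-1}\to\cdots$ is $\xi$-exact if there are $\mathbb E$-triangles $K_{n+1}\xrightarrow{g_n}X_n\xrightarrow{f_n}K_n\dashrightarrow$ in $\xi$ (its $\xi$-resolution $\mathbb E$-triangles) with $d_n=g_{n-1}f_n$ for all $n$. For a bounded complex $0\to N\to X_{n-1}\to\cdots\to X_0\to M\to0$ this means such $\mathbb E$-triangles for $0\le i\le n-1$ with $K_0=M$, $K_n=N$; similarly for one-sided complexes. Terms whose index ranges are empty are omitted. All subcategories are full and additive. An $\mathcal X$-resolution of $M$ is a $\xi$-exact complex $\cdots\to X_1\to X_0\to M\to0$ with all $X_i\in\mathcal X$; $\mathrm{res}(\mathcal X)$ is the class of objects having one. $\mathcal P_{\mathcal X}(\xi)=\mathcal X\cap\mathcal P(\xi)$. $\mathcal X$ is quasi-resolving if for every $\mathbb E$-triangle $A\to B\to C\dashrightarrow$ in $\xi$: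 $A,C\in\mathcal X$ implies $B\in\mathcal X$ (closed under $\xi$-extensions) and $B,C\in\mathcal X$ implies $A\in\mathcal X$ (closed under $\xi$-cocones); and $\mathcal X\subseteq\mathrm{res}(\mathcal P_{\mathcal X}(\xi))$. For a subcategory $\mathcal Y$, $\mathrm{res.dim}_{\mathcal Y}(M)$ is the least $n\ge0$ for which there is a $\xi$-exact complex $0\to Y_n\to\cdots\to Y_0\to M\to0$ with all $Y_i\in\mathcal Y$, and $\infty$ if there is none; $\widehat{\mathcal Y}$ is the class of objects with finite $\mathrm{res.dim}_{\mathcal Y}$. By convention $\mathrm{res.dim}\le-1$ means the object is zero. For $n\ge0$, $\xi\mathrm{xt}^n_\xi(A,B)=H^n(\mathcal C(\mathbf P,B))$, where $\mathbf P\to A$ is a $\xi$-projective resolution, i.e. a $\xi$-exact complex $\cdots\to P_1\to P_0\to A\to0$ with $P_i\in\mathcal P(\xi)$ (equivalently, computed by a $\xi$-injective coresolution of $B$). An $\mathbb E$-triangle $A\to B\to C\dashrightarrow$ in $\xi$ is $\mathcal C(-,\mathcal X)$-exact if $0\to\mathcal C(C,X)\to\mathcal C(B,X)\to\mathcal C(A,X)\to0$ is exact for all $X\in\mathcal X$. A complex is $\mathcal C(-,\mathcal X)$-exact if it is $\xi$-exact with $\mathcal C(-,\mathcal X)$-exact $\xi$-resolution $\mathbb E$-triangles. A complete $\mathcal P_{\mathcal X}(\xi)$-resolution is a $\mathcal C(-,\mathcal X)$-exact complex $\cdots\to P_1\to P_0\to P_{-1}\to\cdots$ with all $P_n\in\mathcal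 P_{\mathcal X}(\xi)$; the objects $K_n$ in its ($\mathcal C(-,\mathcal X)$-exact) $\xi$-resolution $\mathbb E$-triangles $K_{n+1}\to P_n\to K_n\dashrightarrow$ are called $\mathcal{GQ}_{\mathcal X}(\xi)$-projective, and $\mathcal{GQP}_{\mathcal X}(\xi)$ is the subcategory of all of them. *)

theory Defs
  imports "HOL-Algebra.Exact_Sequence" "HOL-Library.Extended_Nat"
begin

text \<open>
  A category is given by a set of objects and a family of hom-groups (written multiplicatively, as
  all commutative groups in HOL-Algebra, so that the unit of \<open>Hom \<C> A B\<close> is the zero morphism
  and \<open>\<otimes>\<close> is addition of morphisms).  Hom-sets of different pairs of objects may overlap; the
  predicate \<open>arr\<close> carries source and target.  The group \<open>Ext \<C> C A\<close> is $E(C,A)$, contravariant in \<open>C\<close> and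
  covariant in \<open>A\<close>, with \<open>ExtMap \<C> c a\<close> being $E(c,a)$.  \<open>Realiz \<C> C A \<delta>\<close> is the equivalence class
  $s(\delta)$ of sequences from \<open>A\<close> to \<open>C\<close>; a sequence is represented by a triple \<open>(x, B, y)\<close>.
\<close>

record ('o, 'm, 'e) extri_data =
  Obj :: "'o set"
  Hom :: "'o \<Rightarrow> 'o \<Rightarrow> 'm monoid"
  Comp :: "'m \<Rightarrow> 'm \<Rightarrow> 'm" (infixl \<open>\<cdot>\<index>\<close> 75)
  Ident :: "'o \<Rightarrow> 'm"
  Ext :: "'o \<Rightarrow> 'o \<Rightarrow> 'e monoid"
  ExtMap :: "'m \<Rightarrow> 'm \<Rightarrow> 'e \<Rightarrow> 'e"
  Realiz :: "'o \<Rightarrow> 'o \<Rightarrow> 'e \<Rightarrow> ('m \<times> 'o \<times> 'm) set"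

type_synonym ('o, 'm, 'e) triangle = "'o \<times> 'm \<times> 'o \<times> 'm \<times> 'o \<times> 'e"

definition arr :: "('o, 'm, 'e) extri_data \<Rightarrow> 'm \<Rightarrow> 'o \<Rightarrow> 'o \<Rightarrow> bool" where
  "arr \<C> f A B \<longleftrightarrow> A \<in> Obj \<C> \<and> B \<in> Obj \<C> \<and> f \<in> carrier (Hom \<C> A B)"


section \<open>Additive categories\<close>

locale preadditive_category =
  fixes \<C> :: "('o, 'm, 'e) extri_data" (structure)
  assumes hom_group: "\<lbrakk>A \<in> Obj \<C>; B \<in> Obj \<C>\<rbrakk> \<Longrightarrow> comm_group (Hom \<C> A B)"
    and comp_closed: "\<lbrakk>arr \<C> f A B; arr \<C> g B D\<rbrakk> \<Longrightarrow> arr \<C> (g \<cdot> f) A D"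
    and comp_assoc: "\<lbrakk>arr \<C> f A B; arr \<C> g B D; arr \<C> h D F\<rbrakk> \<Longrightarrow> (h \<cdot> g) \<cdot> f = h \<cdot> (g \<cdot> f)"
    and ident_closed: "A \<in> Obj \<C> \<Longrightarrow> arr \<C> (Ident \<C> A) A A"
    and comp_ident_left: "arr \<C> f A B \<Longrightarrow> Ident \<C> B \<cdot> f = f"
    and comp_ident_right: "arr \<C> f A B \<Longrightarrow> f \<cdot> Ident \<C> A = f"
    and comp_add_right: "\<lbrakk>arr \<C> f A B; arr \<C> f' A B; arr \<C> g B D\<rbrakk>
      \<Longrightarrow> g \<cdot> (f \<otimes>\<^bsub>Hom \<C> A B\<^esub> f') = (g \<cdot> f) \<otimes>\<^bsub>Hom \<C> A D\<^esub> (g \<cdot> f')"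
    and comp_add_left: "\<lbrakk>arr \<C> f A B; arr \<C> g B D; arr \<C> g' B D\<rbrakk>
      \<Longrightarrow> (g \<otimes>\<^bsub>Hom \<C> B D\<^esub> g') \<cdot> f = (g \<cdot> f) \<otimes>\<^bsub>Hom \<C> A D\<^esub> (g' \<cdot> f)"

definition zero_object :: "('o, 'm, 'e) extri_data \<Rightarrow> 'o \<Rightarrow> bool" where
  "zero_object \<C> Z \<longleftrightarrow> Z \<in> Obj \<C> \<and>
     (\<forall>A \<in> Obj \<C>. (\<exists>!f. arr \<C> f Z A) \<and> (\<exists>!f. arr \<C> f A Z))"

definition is_biproduct ::
  "('o, 'm, 'e) extri_data \<Rightarrow> 'o \<Rightarrow> 'o \<Rightarrow> 'o \<Rightarrow> 'm \<Rightarrow> 'm \<Rightarrow> 'm \<Rightarrow> 'm \<Rightarrow> bool" where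
  "is_biproduct \<C> A B S iA iB pA pB \<longleftrightarrow>
     arr \<C> iA A S \<and> arr \<C> iB B S \<and> arr \<C> pA S A \<and> arr \<C> pB S B \<and>
     pA \<cdot>\<^bsub>\<C>\<^esub> iA = Ident \<C> A \<and> pB \<cdot>\<^bsub>\<C>\<^esub> iB = Ident \<C> B \<and>
     pA \<cdot>\<^bsub>\<C>\<^esub> iB = \<one>\<^bsub>Hom \<C> B A\<^esub> \<and> pB \<cdot>\<^bsub>\<C>\<^esub> iA = \<one>\<^bsub>Hom \<C> A B\<^esub> \<and>
     (iA \<cdot>\<^bsub>\<C>\<^esub> pA) \<otimes>\<^bsub>Hom \<C> S S\<^esub> (iB \<cdot>\<^bsub>\<C>\<^esub> pB) = Ident \<C> S"

locale additive_category = preadditive_category +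
  assumes has_zero: "\<exists>Z. zero_object \<C> Z"
    and has_biproducts: "\<lbrakk>A \<in> Obj \<C>; B \<in> Obj \<C>\<rbrakk>
      \<Longrightarrow> \<exists>S iA iB pA pB. is_biproduct \<C> A B S iA iB pA pB"

definition is_iso :: "('o, 'm, 'e) extri_data \<Rightarrow> 'm \<Rightarrow> 'o \<Rightarrow> 'o \<Rightarrow> bool" where
  "is_iso \<C> f A B \<longleftrightarrow> arr \<C> f A B \<and>
     (\<exists>g. arr \<C> g B A \<and> g \<cdot>\<^bsub>\<C>\<^esub> f = Ident \<C> A \<and> f \<cdot>\<^bsub>\<C>\<^esub> g = Ident \<C> B)"

text \<open>A full additive subcategory is given by its class of objects.  Since every zero object and
  every biproduct is admitted, it is closed under isomorphism.\<close>

definition additive_subcategory :: "('o, 'm, 'e) extri_data \<Rightarrow> 'o set \<Rightarrow> bool" where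
  "additive_subcategory \<C> \<X> \<longleftrightarrow> \<X> \<subseteq> Obj \<C> \<and>
     (\<forall>Z. zero_object \<C> Z \<longrightarrow> Z \<in> \<X>) \<and>
     (\<forall>A \<in> \<X>. \<forall>B \<in> \<X>. \<forall>S iA iB pA pB. is_biproduct \<C> A B S iA iB pA pB \<longrightarrow> S \<in> \<X>)"


section \<open>Extriangulated categories\<close>

text \<open>\<open>push \<C> C a \<delta>\<close> is $a_*\delta = E(C,a)(\delta)$ and \<open>pull \<C> A c \<delta>\<close> is $c^*\delta = E(c,A)(\delta)$.\<close>

definition push :: "('o, 'm, 'e) extri_data \<Rightarrow> 'o \<Rightarrow> 'm \<Rightarrow> 'e \<Rightarrow> 'e" where
  "push \<C> C a \<delta> = ExtMap \<C> (Ident \<C> C) a \<delta>"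

definition pull :: "('o, 'm, 'e) extri_data \<Rightarrow> 'o \<Rightarrow> 'm \<Rightarrow> 'e \<Rightarrow> 'e" where
  "pull \<C> A c \<delta> = ExtMap \<C> c (Ident \<C> A) \<delta>"

definition sequences :: "('o, 'm, 'e) extri_data \<Rightarrow> 'o \<Rightarrow> 'o \<Rightarrow> ('m \<times> 'o \<times> 'm) set" where
  "sequences \<C> A C = {(x, B, y). arr \<C> x A B \<and> arr \<C> y B C}"

definition seq_equiv ::
  "('o, 'm, 'e) extri_data \<Rightarrow> 'o \<Rightarrow> 'o \<Rightarrow> (('m \<times> 'o \<times> 'm) \<times> ('m \<times> 'o \<times> 'm)) set" where
  "seq_equiv \<C> A C = {((x, B, y), (x', B', y')).
     (x, B, y) \<in> sequences \<C> A C \<and> (x', B', y') \<in> sequences \<C> A C \<and>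
     (\<exists>b. is_iso \<C> b B B' \<and> b \<cdot>\<^bsub>\<C>\<^esub> x = x' \<and> y' \<cdot>\<^bsub>\<C>\<^esub> b = y)}"

definition E_triangles :: "('o, 'm, 'e) extri_data \<Rightarrow> ('o, 'm, 'e) triangle set" where
  "E_triangles \<C> = {(A, x, B, y, C, \<delta>).
     A \<in> Obj \<C> \<and> C \<in> Obj \<C> \<and> \<delta> \<in> carrier (Ext \<C> C A) \<and> (x, B, y) \<in> Realiz \<C> C A \<delta>}"

text \<open>The third triangle is a direct sum of the first two.  The class $\delta \oplus \delta'$ is the element of
  $E(C \oplus C', A \oplus A')$ corresponding to $(\delta,0,0,\delta')$ in
  $E(C,A) \oplus E(C,A') \oplus E(C',A) \oplus E(C',A')$.\<close>

fun is_direct_sum :: "('o, 'm, 'e) extri_data \<Rightarrow> ('o, 'm, 'e) triangle \<Rightarrow>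
    ('o, 'm, 'e) triangle \<Rightarrow> ('o, 'm, 'e) triangle \<Rightarrow> bool" where
  "is_direct_sum \<C> (A, x, B, y, C, \<delta>) (A', x', B', y', C', \<delta>') (SA, u, SB, v, SC, \<epsilon>) \<longleftrightarrow>
     (\<exists>iA iA' pA pA' iB iB' pB pB' iC iC' pC pC'.
        is_biproduct \<C> A A' SA iA iA' pA pA' \<and>
        is_biproduct \<C> B B' SB iB iB' pB pB' \<and>
        is_biproduct \<C> C C' SC iC iC' pC pC' \<and>
        u = (iB \<cdot>\<^bsub>\<C>\<^esub> x \<cdot>\<^bsub>\<C>\<^esub> pA) \<otimes>\<^bsub>Hom \<C> SA SB\<^esub> (iB' \<cdot>\<^bsub>\<C>\<^esub> x' \<cdot>\<^bsub>\<C>\<^esub> pA') \<and>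
        v = (iC \<cdot>\<^bsub>\<C>\<^esub> y \<cdot>\<^bsub>\<C>\<^esub> pB) \<otimes>\<^bsub>Hom \<C> SB SC\<^esub> (iC' \<cdot>\<^bsub>\<C>\<^esub> y' \<cdot>\<^bsub>\<C>\<^esub> pB') \<and>
        \<epsilon> = ExtMap \<C> pC iA \<delta> \<otimes>\<^bsub>Ext \<C> SC SA\<^esub> ExtMap \<C> pC' iA' \<delta>')"

locale extriangulated_category = additive_category +
  assumes ext_group: "\<lbrakk>C \<in> Obj \<C>; A \<in> Obj \<C>\<rbrakk> \<Longrightarrow> comm_group (Ext \<C> C A)"
    and ext_map_hom: "\<lbrakk>arr \<C> c C' C; arr \<C> a A A'\<rbrakk>
      \<Longrightarrow> ExtMap \<C> c a \<in> hom (Ext \<C> C A) (Ext \<C> C' A')"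
    and ext_map_ident: "\<lbrakk>C \<in> Obj \<C>; A \<in> Obj \<C>; \<delta> \<in> carrier (Ext \<C> C A)\<rbrakk>
      \<Longrightarrow> ExtMap \<C> (Ident \<C> C) (Ident \<C> A) \<delta> = \<delta>"
    and ext_map_comp: "\<lbrakk>arr \<C> c C' C; arr \<C> c' C'' C'; arr \<C> a A A'; arr \<C> a' A' A'';
        \<delta> \<in> carrier (Ext \<C> C A)\<rbrakk>
      \<Longrightarrow> ExtMap \<C> (c \<cdot> c') (a' \<cdot> a) \<delta> = ExtMap \<C> c' a' (ExtMap \<C> c a \<delta>)"
    and ext_map_add_right: "\<lbrakk>arr \<C> c C' C; arr \<C> a A A'; arr \<C> a' A A'; \<delta> \<in> carrier (Ext \<C> C A)\<rbrakk>
      \<Longrightarrow> ExtMap \<C> c (a \<otimes>\<^bsub>Hom \<C> A A'\<^esub> a') \<delta> = ExtMap \<C> c a \<delta> \<otimes>\<^bsub>Ext \<C> C' A'\<^esub> ExtMap \<C> c a' \<delta>"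
    and ext_map_add_left: "\<lbrakk>arr \<C> c C' C; arr \<C> c' C' C; arr \<C> a A A'; \<delta> \<in> carrier (Ext \<C> C A)\<rbrakk>
      \<Longrightarrow> ExtMap \<C> (c \<otimes>\<^bsub>Hom \<C> C' C\<^esub> c') a \<delta> = ExtMap \<C> c a \<delta> \<otimes>\<^bsub>Ext \<C> C' A'\<^esub> ExtMap \<C> c' a \<delta>"
    and realiz_class: "\<lbrakk>C \<in> Obj \<C>; A \<in> Obj \<C>; \<delta> \<in> carrier (Ext \<C> C A)\<rbrakk>
      \<Longrightarrow> Realiz \<C> C A \<delta> \<in> sequences \<C> A C // seq_equiv \<C> A C"
    and realiz_morphism: "\<lbrakk>(A, x, B, y, C, \<delta>) \<in> E_triangles \<C>; (A', x', B', y', C', \<delta>') \<in> E_triangles \<C>;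
        arr \<C> a A A'; arr \<C> c C C'; push \<C> C a \<delta> = pull \<C> A' c \<delta>'\<rbrakk>
      \<Longrightarrow> \<exists>b. arr \<C> b B B' \<and> b \<cdot> x = x' \<cdot> a \<and> y' \<cdot> b = c \<cdot> y"
    and realiz_zero: "is_biproduct \<C> A C S iA iC pA pC
      \<Longrightarrow> (A, iA, S, pC, C, \<one>\<^bsub>Ext \<C> C A\<^esub>) \<in> E_triangles \<C>"
    and realiz_direct_sum: "\<lbrakk>T \<in> E_triangles \<C>; T' \<in> E_triangles \<C>; is_direct_sum \<C> T T' T''\<rbrakk>
      \<Longrightarrow> T'' \<in> E_triangles \<C>"
    and ET3: "\<lbrakk>(A, x, B, y, C, \<delta>) \<in> E_triangles \<C>; (A', x', B', y', C', \<delta>') \<in> E_triangles \<C>;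
        arr \<C> a A A'; arr \<C> b B B'; b \<cdot> x = x' \<cdot> a\<rbrakk>
      \<Longrightarrow> \<exists>c. arr \<C> c C C' \<and> y' \<cdot> b = c \<cdot> y \<and> push \<C> C a \<delta> = pull \<C> A' c \<delta>'"
    and ET3_op: "\<lbrakk>(A, x, B, y, C, \<delta>) \<in> E_triangles \<C>; (A', x', B', y', C', \<delta>') \<in> E_triangles \<C>;
        arr \<C> b B B'; arr \<C> c C C'; y' \<cdot> b = c \<cdot> y\<rbrakk>
      \<Longrightarrow> \<exists>a. arr \<C> a A A' \<and> b \<cdot> x = x' \<cdot> a \<and> push \<C> C a \<delta> = pull \<C> A' c \<delta>'"
    and ET4: "\<lbrakk>(A, f, B, f', D, \<delta>) \<in> E_triangles \<C>; (B, g, C, g', F, \<delta>') \<in> E_triangles \<C>\<rbrakk>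
      \<Longrightarrow> \<exists>E h' d e \<delta>''.
            (A, g \<cdot> f, C, h', E, \<delta>'') \<in> E_triangles \<C> \<and>
            (D, d, E, e, F, push \<C> F f' \<delta>') \<in> E_triangles \<C> \<and>
            h' \<cdot> g = d \<cdot> f' \<and> e \<cdot> h' = g' \<and>
            pull \<C> A d \<delta>'' = \<delta> \<and> push \<C> E f \<delta>'' = pull \<C> B e \<delta>'"
    and ET4_op: "\<lbrakk>(D, f', B, f, A, \<delta>) \<in> E_triangles \<C>; (F, g', C, g, B, \<delta>') \<in> E_triangles \<C>\<rbrakk>
      \<Longrightarrow> \<exists>E h' d e \<delta>''.
            (E, h', C, f \<cdot> g, A, \<delta>'') \<in> E_triangles \<C> \<and>
            (F, e, E, d, D, pull \<C> F f' \<delta>') \<in> E_triangles \<C> \<and>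
            g \<cdot> h' = f' \<cdot> d \<and> h' \<cdot> e = g' \<and>
            push \<C> A d \<delta>'' = \<delta> \<and> pull \<C> E f \<delta>'' = push \<C> B e \<delta>'"

definition inflation :: "('o, 'm, 'e) extri_data \<Rightarrow> 'm \<Rightarrow> 'o \<Rightarrow> 'o \<Rightarrow> bool" where
  "inflation \<C> x A B \<longleftrightarrow> (\<exists>y C \<delta>. (A, x, B, y, C, \<delta>) \<in> E_triangles \<C>)"

definition deflation :: "('o, 'm, 'e) extri_data \<Rightarrow> 'm \<Rightarrow> 'o \<Rightarrow> 'o \<Rightarrow> bool" where
  "deflation \<C> y B C \<longleftrightarrow> (\<exists>A x \<delta>. (A, x, B, y, C, \<delta>) \<in> E_triangles \<C>)"

definition WIC :: "('o, 'm, 'e) extri_data \<Rightarrow> bool" where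
  "WIC \<C> \<longleftrightarrow> (\<forall>A B C f g. arr \<C> f A B \<and> arr \<C> g B C \<longrightarrow>
     (inflation \<C> (g \<cdot>\<^bsub>\<C>\<^esub> f) A C \<longrightarrow> inflation \<C> f A B) \<and>
     (deflation \<C> (g \<cdot>\<^bsub>\<C>\<^esub> f) A C \<longrightarrow> deflation \<C> g B C))"


section \<open>Proper classes\<close>

fun iso_triangles ::
  "('o, 'm, 'e) extri_data \<Rightarrow> ('o, 'm, 'e) triangle \<Rightarrow> ('o, 'm, 'e) triangle \<Rightarrow> bool" where
  "iso_triangles \<C> (A, x, B, y, C, \<delta>) (A', x', B', y', C', \<delta>') \<longleftrightarrow>
     (\<exists>a b c. is_iso \<C> a A A' \<and> is_iso \<C> b B B' \<and> is_iso \<C> c C C' \<and>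
        b \<cdot>\<^bsub>\<C>\<^esub> x = x' \<cdot>\<^bsub>\<C>\<^esub> a \<and> y' \<cdot>\<^bsub>\<C>\<^esub> b = c \<cdot>\<^bsub>\<C>\<^esub> y \<and> push \<C> C a \<delta> = pull \<C> A' c \<delta>')"

locale proper_class =
  fixes \<C> :: "('o, 'm, 'e) extri_data" and \<xi> :: "('o, 'm, 'e) triangle set"
  assumes xi_triangles: "\<xi> \<subseteq> E_triangles \<C>"
    and xi_iso: "\<lbrakk>T \<in> \<xi>; T' \<in> E_triangles \<C>; iso_triangles \<C> T T'\<rbrakk> \<Longrightarrow> T' \<in> \<xi>"
    and xi_coproduct: "\<lbrakk>T \<in> \<xi>; T' \<in> \<xi>; is_direct_sum \<C> T T' T''\<rbrakk> \<Longrightarrow> T'' \<in> \<xi>"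
    and xi_split: "(A, x, B, y, C, \<one>\<^bsub>Ext \<C> C A\<^esub>) \<in> E_triangles \<C>
      \<Longrightarrow> (A, x, B, y, C, \<one>\<^bsub>Ext \<C> C A\<^esub>) \<in> \<xi>"
    and xi_base_change: "\<lbrakk>(A, x, B, y, C, \<delta>) \<in> \<xi>; arr \<C> c C' C;
        (A, x', B', y', C', pull \<C> A c \<delta>) \<in> E_triangles \<C>\<rbrakk>
      \<Longrightarrow> (A, x', B', y', C', pull \<C> A c \<delta>) \<in> \<xi>"
    and xi_cobase_change: "\<lbrakk>(A, x, B, y, C, \<delta>) \<in> \<xi>; arr \<C> a A A';
        (A', x', B', y', C, push \<C> C a \<delta>) \<in> E_triangles \<C>\<rbrakk>
      \<Longrightarrow> (A', x', B', y', C, push \<C> C a \<delta>) \<in> \<xi>"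
    and xi_saturated: "\<lbrakk>(A\<^sub>1, x\<^sub>1, B\<^sub>1, y\<^sub>1, C, \<delta>\<^sub>1) \<in> E_triangles \<C>; (A\<^sub>2, x\<^sub>2, B\<^sub>2, y\<^sub>2, C, \<delta>\<^sub>2) \<in> \<xi>;
        (A\<^sub>1, u, M, v, B\<^sub>2, pull \<C> A\<^sub>1 y\<^sub>2 \<delta>\<^sub>1) \<in> \<xi>\<rbrakk>
      \<Longrightarrow> (A\<^sub>1, x\<^sub>1, B\<^sub>1, y\<^sub>1, C, \<delta>\<^sub>1) \<in> \<xi>"

text \<open>In \<^const>\<open>short_exact_sequence\<close> the groups are listed from the last to the first.\<close>

definition xi_projectives :: "('o, 'm, 'e) extri_data \<Rightarrow> ('o, 'm, 'e) triangle set \<Rightarrow> 'o set" where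
  "xi_projectives \<C> \<xi> = {P \<in> Obj \<C>. \<forall>A x B y C \<delta>. (A, x, B, y, C, \<delta>) \<in> \<xi> \<longrightarrow>
     short_exact_sequence (Hom \<C> P C) (Hom \<C> P B) (Hom \<C> P A) (\<lambda>f. y \<cdot>\<^bsub>\<C>\<^esub> f) (\<lambda>f. x \<cdot>\<^bsub>\<C>\<^esub> f)}"

definition xi_injectives :: "('o, 'm, 'e) extri_data \<Rightarrow> ('o, 'm, 'e) triangle set \<Rightarrow> 'o set" where
  "xi_injectives \<C> \<xi> = {I \<in> Obj \<C>. \<forall>A x B y C \<delta>. (A, x, B, y, C, \<delta>) \<in> \<xi> \<longrightarrow>
     short_exact_sequence (Hom \<C> A I) (Hom \<C> B I) (Hom \<C> C I) (\<lambda>f. f \<cdot>\<^bsub>\<C>\<^esub> x) (\<lambda>f. f \<cdot>\<^bsub>\<C>\<^esub> y)}"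

definition enough_xi_projectives ::
  "('o, 'm, 'e) extri_data \<Rightarrow> ('o, 'm, 'e) triangle set \<Rightarrow> bool" where
  "enough_xi_projectives \<C> \<xi> \<longleftrightarrow>
     (\<forall>A \<in> Obj \<C>. \<exists>K x P y \<delta>. (K, x, P, y, A, \<delta>) \<in> \<xi> \<and> P \<in> xi_projectives \<C> \<xi>)"

definition enough_xi_injectives ::
  "('o, 'm, 'e) extri_data \<Rightarrow> ('o, 'm, 'e) triangle set \<Rightarrow> bool" where
  "enough_xi_injectives \<C> \<xi> \<longleftrightarrow>
     (\<forall>A \<in> Obj \<C>. \<exists>I x K y \<delta>. (A, x, I, y, K, \<delta>) \<in> \<xi> \<and> I \<in> xi_injectives \<C> \<xi>)"


section \<open>Exact complexes and resolutions\<close>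

text \<open>
  The differentials of a $\xi$-exact complex are determined by its resolution triangles, and
  compose to zero because \<open>y \<cdot> x = 0\<close> in every E-triangle of an extriangulated category.

  \<open>xi_resolution \<C> \<xi> X d M\<close>: the complex $\cdots \to X_1 \to X_0 \to M \to 0$ is $\xi$-exact, where
  \<open>d 0\<close> is the map $X_0 \to M$ and \<open>d (Suc i)\<close> is the map $X_{i+1} \to X_i$.
\<close>

definition xi_resolution :: "('o, 'm, 'e) extri_data \<Rightarrow> ('o, 'm, 'e) triangle set \<Rightarrow>
    (nat \<Rightarrow> 'o) \<Rightarrow> (nat \<Rightarrow> 'm) \<Rightarrow> 'o \<Rightarrow> bool" where
  "xi_resolution \<C> \<xi> X d M \<longleftrightarrow> (\<exists>K g f \<delta>. K 0 = M \<and>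
     (\<forall>i. (K (Suc i), g i, X i, f i, K i, \<delta> i) \<in> \<xi>) \<and>
     d 0 = f 0 \<and> (\<forall>i. d (Suc i) = g i \<cdot>\<^bsub>\<C>\<^esub> f (Suc i)))"

text \<open>
  \<open>bounded_xi_exact \<C> \<xi> n Y d M\<close>: the complex $0 \to Y_n \to \cdots \to Y_0 \to M \to 0$ is $\xi$-exact.  There
  are resolution triangles for \<open>i < n\<close>, and the leftmost term $Y_n$ is $K_n$, so that with
  \<open>f n\<close> the identity the leftmost differential is $g_{n-1}$.  For \<open>n = 0\<close> this means that
  $Y_0 = M$.
\<close>

definition bounded_xi_exact :: "('o, 'm, 'e) extri_data \<Rightarrow> ('o, 'm, 'e) triangle set \<Rightarrow> nat \<Rightarrow>
    (nat \<Rightarrow> 'o) \<Rightarrow> (nat \<Rightarrow> 'm) \<Rightarrow> 'o \<Rightarrow> bool" where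
  "bounded_xi_exact \<C> \<xi> n Y d M \<longleftrightarrow> M \<in> Obj \<C> \<and> (\<exists>K g f \<delta>. K 0 = M \<and> K n = Y n \<and> f n = Ident \<C> (Y n) \<and>
     (\<forall>i<n. (K (Suc i), g i, Y i, f i, K i, \<delta> i) \<in> \<xi>) \<and>
     d 0 = f 0 \<and> (\<forall>i<n. d (Suc i) = g i \<cdot>\<^bsub>\<C>\<^esub> f (Suc i)))"

definition res_class ::
  "('o, 'm, 'e) extri_data \<Rightarrow> ('o, 'm, 'e) triangle set \<Rightarrow> 'o set \<Rightarrow> 'o set" where
  "res_class \<C> \<xi> \<X> = {M. \<exists>X d. xi_resolution \<C> \<xi> X d M \<and> (\<forall>i. X i \<in> \<X>)}"

text \<open>The infimum of the empty set is \<open>\<infinity>\<close>.\<close>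

definition res_dim ::
  "('o, 'm, 'e) extri_data \<Rightarrow> ('o, 'm, 'e) triangle set \<Rightarrow> 'o set \<Rightarrow> 'o \<Rightarrow> enat" where
  "res_dim \<C> \<xi> \<Y> M =
     Inf {enat n | n. \<exists>Y d. bounded_xi_exact \<C> \<xi> n Y d M \<and> (\<forall>i\<le>n. Y i \<in> \<Y>)}"

text \<open>The bound is an integer because of the convention that $\mathrm{res.dim} \le -1$ means that
  the object is zero.\<close>

definition res_dim_le ::
  "('o, 'm, 'e) extri_data \<Rightarrow> ('o, 'm, 'e) triangle set \<Rightarrow> 'o set \<Rightarrow> 'o \<Rightarrow> int \<Rightarrow> bool" where
  "res_dim_le \<C> \<xi> \<Y> M k \<longleftrightarrow>
     (if k < 0 then zero_object \<C> M else res_dim \<C> \<xi> \<Y> M \<le> enat (nat k))"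

definition res_hat ::
  "('o, 'm, 'e) extri_data \<Rightarrow> ('o, 'm, 'e) triangle set \<Rightarrow> 'o set \<Rightarrow> 'o set" where
  "res_hat \<C> \<xi> \<Y> = {M \<in> Obj \<C>. res_dim \<C> \<xi> \<Y> M < \<infinity>}"


section \<open>The derived functors\<close>

definition xi_projective_resolution :: "('o, 'm, 'e) extri_data \<Rightarrow> ('o, 'm, 'e) triangle set \<Rightarrow>
    (nat \<Rightarrow> 'o) \<Rightarrow> (nat \<Rightarrow> 'm) \<Rightarrow> 'o \<Rightarrow> bool" where
  "xi_projective_resolution \<C> \<xi> P d A \<longleftrightarrow>
     xi_resolution \<C> \<xi> P d A \<and> (\<forall>i. P i \<in> xi_projectives \<C> \<xi>)"

text \<open>The cohomology $H^n$ of the cochain complex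
  $0 \to \mathrm{Hom}(P_0,B) \to \mathrm{Hom}(P_1,B) \to \cdots$ obtained from the deleted resolution;
  the augmentation \<open>d 0\<close> does not occur in it.\<close>

definition hom_cohomology :: "('o, 'm, 'e) extri_data \<Rightarrow> (nat \<Rightarrow> 'o) \<Rightarrow> (nat \<Rightarrow> 'm) \<Rightarrow> nat \<Rightarrow> 'o
    \<Rightarrow> 'm set monoid" where
  "hom_cohomology \<C> P d n B =
     (Hom \<C> (P n) B)\<lparr>carrier :=
        kernel (Hom \<C> (P n) B) (Hom \<C> (P (Suc n)) B) (\<lambda>h. h \<cdot>\<^bsub>\<C>\<^esub> d (Suc n))\<rparr>
     Mod (if n = 0 then {\<one>\<^bsub>Hom \<C> (P 0) B\<^esub>}
          else (\<lambda>h. h \<cdot>\<^bsub>\<C>\<^esub> d n) ` carrier (Hom \<C> (P (n - 1)) B))"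

definition xixt :: "('o, 'm, 'e) extri_data \<Rightarrow> ('o, 'm, 'e) triangle set \<Rightarrow> nat \<Rightarrow> 'o \<Rightarrow> 'o
    \<Rightarrow> 'm set monoid" where
  "xixt \<C> \<xi> n A B =
     (let (P, d) = (SOME (P, d). xi_projective_resolution \<C> \<xi> P d A) in hom_cohomology \<C> P d n B)"


section \<open>Quasi-resolving subcategories and Gorenstein objects\<close>

definition proj_in ::
  "('o, 'm, 'e) extri_data \<Rightarrow> ('o, 'm, 'e) triangle set \<Rightarrow> 'o set \<Rightarrow> 'o set" where
  "proj_in \<C> \<xi> \<X> = \<X> \<inter> xi_projectives \<C> \<xi>"

definition quasi_resolving ::
  "('o, 'm, 'e) extri_data \<Rightarrow> ('o, 'm, 'e) triangle set \<Rightarrow> 'o set \<Rightarrow> bool" where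
  "quasi_resolving \<C> \<xi> \<X> \<longleftrightarrow> additive_subcategory \<C> \<X> \<and>
     (\<forall>A x B y C \<delta>. (A, x, B, y, C, \<delta>) \<in> \<xi> \<longrightarrow>
        (A \<in> \<X> \<and> C \<in> \<X> \<longrightarrow> B \<in> \<X>) \<and> (B \<in> \<X> \<and> C \<in> \<X> \<longrightarrow> A \<in> \<X>)) \<and>
     \<X> \<subseteq> res_class \<C> \<xi> (proj_in \<C> \<xi> \<X>)"

definition hom_exact_triangles ::
  "('o, 'm, 'e) extri_data \<Rightarrow> ('o, 'm, 'e) triangle set \<Rightarrow> 'o set \<Rightarrow> ('o, 'm, 'e) triangle set" where
  "hom_exact_triangles \<C> \<xi> \<X> = {(A, x, B, y, C, \<delta>). (A, x, B, y, C, \<delta>) \<in> \<xi> \<and>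
     (\<forall>X \<in> \<X>. short_exact_sequence (Hom \<C> A X) (Hom \<C> B X) (Hom \<C> C X)
        (\<lambda>f. f \<cdot>\<^bsub>\<C>\<^esub> x) (\<lambda>f. f \<cdot>\<^bsub>\<C>\<^esub> y))}"

text \<open>The two-sided complex \<open>(P, d)\<close>, together with a choice of resolution triangles.\<close>

definition complete_resolution :: "('o, 'm, 'e) extri_data \<Rightarrow> ('o, 'm, 'e) triangle set \<Rightarrow> 'o set \<Rightarrow>
    (int \<Rightarrow> 'o) \<Rightarrow> (int \<Rightarrow> 'm) \<Rightarrow>
    (int \<Rightarrow> 'o) \<Rightarrow> (int \<Rightarrow> 'm) \<Rightarrow> (int \<Rightarrow> 'm) \<Rightarrow> (int \<Rightarrow> 'e) \<Rightarrow> bool" where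
  "complete_resolution \<C> \<xi> \<X> P d K g f \<delta> \<longleftrightarrow>
     (\<forall>n. P n \<in> proj_in \<C> \<xi> \<X> \<and>
        (K (n + 1), g n, P n, f n, K n, \<delta> n) \<in> hom_exact_triangles \<C> \<xi> \<X> \<and>
        d n = g (n - 1) \<cdot>\<^bsub>\<C>\<^esub> f n)"

definition GQP :: "('o, 'm, 'e) extri_data \<Rightarrow> ('o, 'm, 'e) triangle set \<Rightarrow> 'o set \<Rightarrow> 'o set" where
  "GQP \<C> \<xi> \<X> = {G. \<exists>P d K g f \<delta> n. complete_resolution \<C> \<xi> \<X> P d K g f \<delta> \<and> G = K n}"

end

theory Submission
  imports Defs
begin

text \<open>
  Write \<open>\<G>\<close> for the Gorenstein objects and \<open>\<P> = \<X> \<inter> Proj\<close>.  The proof has three ingredients.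

  \<^bold>\<open>Membership in \<open>\<xi>\<close> is tested on projectives.\<close>  By saturation, an E-triangle lies in \<open>\<xi>\<close> if and only if its
  extension class is killed by every pullback to a \<open>\<xi>\<close>-projective (\<open>xi_iff\<close>).  With this test the
  triangles in \<open>\<xi>\<close> are seen to be closed under composition of inflations and of deflations, and
  to admit pullbacks and pushouts.  For the theory of approximations it is enough to know which
  triples of objects occur, so these closure properties are stated for the relation \<open>conf A B C\<close>.

  \<^bold>\<open>Auslander--Buchweitz approximation.\<close>  The class \<open>\<G>\<close> is the largest class of objects all of whose members
  are orthogonal to \<open>\<X>\<close> and admit a step to the left and a step to the right, through an object of
  \<open>\<P>\<close>, inside the class (\<open>G_unfold\<close>, \<open>G_coinduct\<close>).  Coinduction shows that \<open>\<G>\<close> is closed under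
  extensions and cocones.  Hence pushing out the first syzygy of \<open>M\<close> along its own embedding
  turns a resolution of length \<open>n\<close> by objects of \<open>\<G>\<close> into triangles \<open>M \<rightarrow> W \<rightarrow> G\<close> and \<open>K \<rightarrow> G' \<rightarrow> M\<close> where \<open>W\<close> and \<open>K\<close>
  have finite resolutions by objects of \<open>\<P>\<close> (\<open>G_res_imp_approximations\<close>).  This yields the
  equivalence of all the conditions on resolutions.

  \<^bold>\<open>Detection by derived functors.\<close>  Members of \<open>\<G>\<close> have vanishing derived functors against \<open>\<X>\<close>, so the long
  exact sequence bounds the degrees in which those of \<open>M\<close> survive.  Conversely, if \<open>M\<close> has finite
  dimension, take \<open>M \<rightarrow> W \<rightarrow> G\<close> as above.  Vanishing against \<open>\<P>\<close> passes from \<open>M\<close> and \<open>G\<close> to \<open>W\<close>, and a finite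
  resolution of \<open>W\<close> by objects of \<open>\<P>\<close> can be shortened because its last map splits as soon as
  the corresponding group vanishes (\<open>P_res_dim_detected\<close>).  The long exact sequences are obtained
  without a horseshoe lemma: \<open>Hom(P, -)\<close> is exact on \<open>\<xi>\<close> for a projective resolution \<open>P\<close>, \<open>Hom(-, I)\<close> is
  exact on \<open>\<xi>\<close> for an injective coresolution \<open>I\<close>, and both compute the same vanishing (\<open>balance\<close>).
  The functors \<open>Hom\<close> need not be the zeroth derived functors here, and inflations need not be monic;
  what is used instead is that inflations are monic on maps from projectives and deflations
  are epic on maps to injectives.
\<close>

section \<open>Calculus of morphisms in a preadditive category\<close>

context preadditive_category
begin

abbreviation in_hom (\<open>(<<_ : _ -> _>>)\<close>) where
  "<<f : A -> B>> \<equiv> arr \<C> f A B"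

abbreviation zero_mor (\<open>\<zero>\<^bsub>_,_\<^esub>\<close>) where
  "\<zero>\<^bsub>A,B\<^esub> \<equiv> \<one>\<^bsub>Hom \<C> A B\<^esub>"

text \<open>The source and the target are arguments because they determine the group in which to subtract.\<close>

definition diff where
  "diff A B f g = f \<otimes>\<^bsub>Hom \<C> A B\<^esub> inv\<^bsub>Hom \<C> A B\<^esub> g"

lemma arr_objD:
  assumes "<<f : A -> B>>" shows "A \<in> Obj \<C>" "B \<in> Obj \<C>"
  using assms by (auto simp: arr_def)

lemma post_comp_hom:
  assumes "<<g : B -> D>>" "A \<in> Obj \<C>"
  shows "group_hom (Hom \<C> A B) (Hom \<C> A D) (\<lambda>f. g \<cdot> f)"
proof -
  interpret X: comm_group "Hom \<C> A B" using assms hom_group by (auto simp: arr_def)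
  interpret Y: comm_group "Hom \<C> A D" using assms hom_group by (auto simp: arr_def)
  show ?thesis
    using assms comp_closed[of _ A B g D] comp_add_right[of _ A B _ g D]
    by unfold_locales (auto simp: hom_def arr_def)
qed

lemma pre_comp_hom:
  assumes "<<f : A -> B>>" "D \<in> Obj \<C>"
  shows "group_hom (Hom \<C> B D) (Hom \<C> A D) (\<lambda>g. g \<cdot> f)"
proof -
  interpret X: comm_group "Hom \<C> B D" using assms hom_group by (auto simp: arr_def)
  interpret Y: comm_group "Hom \<C> A D" using assms hom_group by (auto simp: arr_def)
  show ?thesis
    using assms comp_closed[of f A B _ D] comp_add_left[of f A B _ D]
    by unfold_locales (auto simp: hom_def arr_def)
qed

lemma zero_arr: "\<lbrakk>A \<in> Obj \<C>; B \<in> Obj \<C>\<rbrakk> \<Longrightarrow> <<\<zero>\<^bsub>A,B\<^esub> : A -> B>>"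
  using hom_group[of A B] by (auto simp: arr_def comm_group_def group_def monoid.one_closed)

lemma comp_zero_right: "\<lbrakk><<g : B -> D>>; A \<in> Obj \<C>\<rbrakk> \<Longrightarrow> g \<cdot> \<zero>\<^bsub>A,B\<^esub> = \<zero>\<^bsub>A,D\<^esub>"
  using group_hom.hom_one[OF post_comp_hom] by blast

lemma comp_zero_left: "\<lbrakk><<f : A -> B>>; D \<in> Obj \<C>\<rbrakk> \<Longrightarrow> \<zero>\<^bsub>B,D\<^esub> \<cdot> f = \<zero>\<^bsub>A,D\<^esub>"
  using group_hom.hom_one[OF pre_comp_hom] by blast

lemma diff_arr: "\<lbrakk><<f : A -> B>>; <<g : A -> B>>\<rbrakk> \<Longrightarrow> <<diff A B f g : A -> B>>"
  using hom_group[of A B]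
  by (auto simp: arr_def diff_def comm_group_def group.inv_closed group_def
      intro!: monoid.m_closed group.inv_closed)

lemma diff_eq_zero_iff:
  assumes "<<f : A -> B>>" "<<g : A -> B>>"
  shows "diff A B f g = \<zero>\<^bsub>A,B\<^esub> \<longleftrightarrow> f = g"
proof -
  interpret X: comm_group "Hom \<C> A B" using assms hom_group by (auto simp: arr_def)
  show ?thesis using assms unfolding diff_def arr_def
    by (metis X.inv_closed X.inv_equality X.inv_inv X.r_inv)
qed

lemma diff_zero:
  assumes "<<f : A -> B>>" shows "diff A B f \<zero>\<^bsub>A,B\<^esub> = f"
proof -
  interpret X: comm_group "Hom \<C> A B" using assms hom_group by (auto simp: arr_def)
  show ?thesis using assms by (simp add: diff_def arr_def)
qed

lemma comp_diff:
  assumes "<<f : A -> B>>" "<<f' : A -> B>>" "<<g : B -> D>>"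
  shows "g \<cdot> diff A B f f' = diff A D (g \<cdot> f) (g \<cdot> f')"
proof -
  interpret group_hom "Hom \<C> A B" "Hom \<C> A D" "\<lambda>f. g \<cdot> f"
    using assms by (intro post_comp_hom) (auto simp: arr_def)
  show ?thesis using assms by (auto simp: diff_def arr_def)
qed

lemma diff_comp:
  assumes "<<f : A -> B>>" "<<g : B -> D>>" "<<g' : B -> D>>"
  shows "diff B D g g' \<cdot> f = diff A D (g \<cdot> f) (g' \<cdot> f)"
proof -
  interpret group_hom "Hom \<C> B D" "Hom \<C> A D" "\<lambda>g. g \<cdot> f"
    using assms by (intro pre_comp_hom) (auto simp: arr_def)
  show ?thesis using assms by (auto simp: diff_def arr_def)
qed

lemma diff_add:
  assumes "<<f : A -> B>>" "<<g : A -> B>>"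
  shows "g \<otimes>\<^bsub>Hom \<C> A B\<^esub> diff A B f g = f"
proof -
  interpret X: comm_group "Hom \<C> A B" using assms hom_group by (auto simp: arr_def)
  show ?thesis using assms unfolding diff_def arr_def
    by (simp add: X.m_lcomm)
qed

lemma zero_object_id:
  assumes "zero_object \<C> Z"
  shows "Z \<in> Obj \<C>" "Ident \<C> Z = \<zero>\<^bsub>Z,Z\<^esub>"
  using assms zero_arr[of Z Z] ident_closed[of Z] unfolding zero_object_def by blast+

lemma arr_from_zero:
  assumes "zero_object \<C> Z" "<<f : Z -> A>>"
  shows "f = \<zero>\<^bsub>Z,A\<^esub>"
  using assms zero_arr[of Z A] unfolding zero_object_def by (metis arr_objD(2))

lemma biproduct_zero_right:
  assumes "zero_object \<C> Z" "A \<in> Obj \<C>"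
  shows "is_biproduct \<C> A Z A (Ident \<C> A) \<zero>\<^bsub>Z,A\<^esub> (Ident \<C> A) \<zero>\<^bsub>A,Z\<^esub>"
proof -
  interpret X: comm_group "Hom \<C> A A" using assms hom_group by auto
  have Z: "Z \<in> Obj \<C>" using assms zero_object_id by blast
  note arrs = ident_closed[OF assms(2)] zero_arr[OF Z assms(2)] zero_arr[OF assms(2) Z]
  show ?thesis unfolding is_biproduct_def
    using arrs zero_object_id[OF assms(1)] assms(2)
    by (simp add: comp_zero_right comp_zero_left comp_ident_right comp_ident_left
        comp_zero_right[OF arrs(3) Z] comp_zero_right[OF arrs(2)]
        comp_zero_right[OF arrs(1)] comp_zero_left[OF arrs(1)]
        comp_ident_left[OF arrs(2)] comp_ident_right[OF arrs(3)] comp_ident_left[OF arrs(1)])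
      (use arrs(1) in \<open>auto simp: arr_def\<close>)
qed

lemma biproduct_swap:
  assumes "is_biproduct \<C> A B S iA iB pA pB"
  shows "is_biproduct \<C> B A S iB iA pB pA"
proof -
  have a: "<<iA : A -> S>>" "<<iB : B -> S>>" "<<pA : S -> A>>" "<<pB : S -> B>>"
    using assms by (auto simp: is_biproduct_def)
  interpret X: comm_group "Hom \<C> S S" using a hom_group by (auto simp: arr_def)
  show ?thesis
    using assms X.m_comm[of "iA \<cdot> pA" "iB \<cdot> pB"] comp_closed[OF a(3,1)] comp_closed[OF a(4,2)]
    by (auto simp: is_biproduct_def arr_def)
qed

lemma biproduct_zero_left:
  assumes "zero_object \<C> Z" "A \<in> Obj \<C>"
  shows "is_biproduct \<C> Z A A \<zero>\<^bsub>Z,A\<^esub> (Ident \<C> A) \<zero>\<^bsub>A,Z\<^esub> (Ident \<C> A)"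
  using biproduct_swap[OF biproduct_zero_right[OF assms]] .

lemma is_iso_ident: "A \<in> Obj \<C> \<Longrightarrow> is_iso \<C> (Ident \<C> A) A A"
  unfolding is_iso_def using ident_closed comp_ident_left by metis

lemma is_iso_comp:
  assumes "is_iso \<C> f A B" "is_iso \<C> g B D"
  shows "is_iso \<C> (g \<cdot> f) A D"
proof -
  from assms obtain f' g' where f: "<<f : A -> B>>" and f': "<<f' : B -> A>>" "f' \<cdot> f = Ident \<C> A" "f \<cdot> f' = Ident \<C> B"
    and g: "<<g : B -> D>>" and g': "<<g' : D -> B>>" "g' \<cdot> g = Ident \<C> B" "g \<cdot> g' = Ident \<C> D"
    unfolding is_iso_def by blast
  have "(f' \<cdot> g') \<cdot> (g \<cdot> f) = Ident \<C> A"
    using comp_assoc[OF f g g'(1)] comp_assoc[OF comp_closed[OF f g] g'(1) f'(1)] f' g' f g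
    by (metis comp_ident_left)
  moreover have "(g \<cdot> f) \<cdot> (f' \<cdot> g') = Ident \<C> D"
    using comp_assoc[OF f'(1) f g] comp_assoc[OF g'(1) f'(1) comp_closed[OF f g]] f' g' f g
    by (metis comp_ident_right)
  ultimately show ?thesis
    unfolding is_iso_def using comp_closed[OF f g] comp_closed[OF g'(1) f'(1)] by blast
qed

lemma is_iso_inverse:
  assumes "is_iso \<C> f A B"
  obtains g where "is_iso \<C> g B A" "g \<cdot> f = Ident \<C> A" "f \<cdot> g = Ident \<C> B"
  using assms unfolding is_iso_def by blast

end

section \<open>Extriangulated categories\<close>

context extriangulated_category
begin

subsection \<open>The bifunctor of extensions\<close>

abbreviation zero_ext (\<open>\<zero>\<E>\<^bsub>_,_\<^esub>\<close>) where
  "\<zero>\<E>\<^bsub>C,A\<^esub> \<equiv> \<one>\<^bsub>Ext \<C> C A\<^esub>"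

lemma zero_ext_closed: "\<lbrakk>C \<in> Obj \<C>; A \<in> Obj \<C>\<rbrakk> \<Longrightarrow> \<zero>\<E>\<^bsub>C,A\<^esub> \<in> carrier (Ext \<C> C A)"
  using ext_group[of C A] by (auto simp: comm_group_def group_def monoid.one_closed)

lemma ext_map_group_hom:
  assumes "<<c : C' -> C>>" "<<a : A -> A'>>"
  shows "group_hom (Ext \<C> C A) (Ext \<C> C' A') (ExtMap \<C> c a)"
proof -
  interpret X: comm_group "Ext \<C> C A" using assms ext_group by (auto simp: arr_def)
  interpret Y: comm_group "Ext \<C> C' A'" using assms ext_group by (auto simp: arr_def)
  show ?thesis using ext_map_hom[OF assms] by unfold_locales
qed

lemma ext_map_closed:
  "\<lbrakk><<c : C' -> C>>; <<a : A -> A'>>; \<delta> \<in> carrier (Ext \<C> C A)\<rbrakk>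
    \<Longrightarrow> ExtMap \<C> c a \<delta> \<in> carrier (Ext \<C> C' A')"
  using group_hom.hom_closed[OF ext_map_group_hom] by blast

lemma push_closed:
  "\<lbrakk>C \<in> Obj \<C>; <<a : A -> A'>>; \<delta> \<in> carrier (Ext \<C> C A)\<rbrakk> \<Longrightarrow> push \<C> C a \<delta> \<in> carrier (Ext \<C> C A')"
  unfolding push_def using ext_map_closed[OF ident_closed] by blast

lemma pull_closed:
  "\<lbrakk>A \<in> Obj \<C>; <<c : C' -> C>>; \<delta> \<in> carrier (Ext \<C> C A)\<rbrakk> \<Longrightarrow> pull \<C> A c \<delta> \<in> carrier (Ext \<C> C' A)"
  unfolding pull_def using ext_map_closed[OF _ ident_closed] by blast

lemma push_zero: "\<lbrakk>C \<in> Obj \<C>; <<a : A -> A'>>\<rbrakk> \<Longrightarrow> push \<C> C a \<zero>\<E>\<^bsub>C,A\<^esub> = \<zero>\<E>\<^bsub>C,A'\<^esub>"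
  unfolding push_def using group_hom.hom_one[OF ext_map_group_hom[OF ident_closed]] by blast

lemma pull_zero: "\<lbrakk>A \<in> Obj \<C>; <<c : C' -> C>>\<rbrakk> \<Longrightarrow> pull \<C> A c \<zero>\<E>\<^bsub>C,A\<^esub> = \<zero>\<E>\<^bsub>C',A\<^esub>"
  unfolding pull_def using group_hom.hom_one[OF ext_map_group_hom[OF _ ident_closed]] by blast

lemma push_ident: "\<lbrakk>C \<in> Obj \<C>; A \<in> Obj \<C>; \<delta> \<in> carrier (Ext \<C> C A)\<rbrakk> \<Longrightarrow> push \<C> C (Ident \<C> A) \<delta> = \<delta>"
  unfolding push_def by (rule ext_map_ident)

lemma pull_ident: "\<lbrakk>C \<in> Obj \<C>; A \<in> Obj \<C>; \<delta> \<in> carrier (Ext \<C> C A)\<rbrakk> \<Longrightarrow> pull \<C> A (Ident \<C> C) \<delta> = \<delta>"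
  unfolding pull_def by (rule ext_map_ident)

lemma push_comp:
  assumes "C \<in> Obj \<C>" "<<a : A -> A'>>" "<<a' : A' -> A''>>" "\<delta> \<in> carrier (Ext \<C> C A)"
  shows "push \<C> C (a' \<cdot> a) \<delta> = push \<C> C a' (push \<C> C a \<delta>)"
  unfolding push_def
  using ext_map_comp[OF ident_closed[OF assms(1)] ident_closed[OF assms(1)] assms(2-4)]
    comp_ident_left[OF ident_closed[OF assms(1)]] by simp

lemma pull_comp:
  assumes "A \<in> Obj \<C>" "<<c : C' -> C>>" "<<c' : C'' -> C'>>" "\<delta> \<in> carrier (Ext \<C> C A)"
  shows "pull \<C> A (c \<cdot> c') \<delta> = pull \<C> A c' (pull \<C> A c \<delta>)"
  unfolding pull_def
  using ext_map_comp[OF assms(2,3) ident_closed[OF assms(1)] ident_closed[OF assms(1)] assms(4)]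
    comp_ident_left[OF ident_closed[OF assms(1)]] by simp

lemma push_pull:
  assumes "<<c : C' -> C>>" "<<a : A -> A'>>" "\<delta> \<in> carrier (Ext \<C> C A)"
  shows "push \<C> C' a (pull \<C> A c \<delta>) = ExtMap \<C> c a \<delta>"
    and "pull \<C> A' c (push \<C> C a \<delta>) = ExtMap \<C> c a \<delta>"
proof -
  note o = arr_objD[OF assms(1)] arr_objD[OF assms(2)]
  show "push \<C> C' a (pull \<C> A c \<delta>) = ExtMap \<C> c a \<delta>"
    using ext_map_comp[OF assms(1) ident_closed ident_closed assms(2,3)] o
      comp_ident_right[OF assms(1)] comp_ident_right[OF assms(2)]
    by (simp add: push_def pull_def)
  show "pull \<C> A' c (push \<C> C a \<delta>) = ExtMap \<C> c a \<delta>"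
    using ext_map_comp[OF ident_closed assms(1,2) ident_closed assms(3)] o
      comp_ident_left[OF assms(1)] comp_ident_left[OF assms(2)]
    by (simp add: push_def pull_def)
qed

lemma push_zero_mor:
  assumes "C \<in> Obj \<C>" "A \<in> Obj \<C>" "A' \<in> Obj \<C>" "\<delta> \<in> carrier (Ext \<C> C A)"
  shows "push \<C> C \<zero>\<^bsub>A,A'\<^esub> \<delta> = \<zero>\<E>\<^bsub>C,A'\<^esub>"
proof -
  interpret X: comm_group "Hom \<C> A A'" using assms hom_group by auto
  interpret Y: comm_group "Ext \<C> C A'" using assms ext_group by auto
  have z: "<<\<zero>\<^bsub>A,A'\<^esub> : A -> A'>>" using assms zero_arr by auto
  have "push \<C> C \<zero>\<^bsub>A,A'\<^esub> \<delta> = push \<C> C \<zero>\<^bsub>A,A'\<^esub> \<delta> \<otimes>\<^bsub>Ext \<C> C A'\<^esub> push \<C> C \<zero>\<^bsub>A,A'\<^esub> \<delta>"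
    using ext_map_add_right[OF ident_closed[OF assms(1)] z z assms(4)] by (simp add: push_def)
  then show ?thesis using push_closed[OF assms(1) z assms(4)] by simp
qed

lemma pull_zero_mor:
  assumes "C \<in> Obj \<C>" "C' \<in> Obj \<C>" "A \<in> Obj \<C>" "\<delta> \<in> carrier (Ext \<C> C A)"
  shows "pull \<C> A \<zero>\<^bsub>C',C\<^esub> \<delta> = \<zero>\<E>\<^bsub>C',A\<^esub>"
proof -
  interpret X: comm_group "Hom \<C> C' C" using assms hom_group by auto
  interpret Y: comm_group "Ext \<C> C' A" using assms ext_group by auto
  have z: "<<\<zero>\<^bsub>C',C\<^esub> : C' -> C>>" using assms zero_arr by auto
  have "pull \<C> A \<zero>\<^bsub>C',C\<^esub> \<delta> = pull \<C> A \<zero>\<^bsub>C',C\<^esub> \<delta> \<otimes>\<^bsub>Ext \<C> C' A\<^esub> pull \<C> A \<zero>\<^bsub>C',C\<^esub> \<delta>"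
    using ext_map_add_left[OF z z ident_closed[OF assms(3)] assms(4)] by (simp add: pull_def)
  then show ?thesis using pull_closed[OF assms(3) z assms(4)] by simp
qed

lemma ext_zero_object_right:
  assumes "zero_object \<C> Z" "C \<in> Obj \<C>" "\<delta> \<in> carrier (Ext \<C> C Z)"
  shows "\<delta> = \<zero>\<E>\<^bsub>C,Z\<^esub>"
  using push_ident[of C Z \<delta>] push_zero_mor[of C Z Z \<delta>] zero_object_id[OF assms(1)] assms by simp


subsection \<open>Realizations\<close>

lemma seq_equivD:
  assumes "((x, B, y), (x', B', y')) \<in> seq_equiv \<C> A C"
  shows "\<exists>b. is_iso \<C> b B B' \<and> b \<cdot> x = x' \<and> y' \<cdot> b = y" "<<x : A -> B>>" "<<y : B -> C>>"
    "<<x' : A -> B'>>" "<<y' : B' -> C>>"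
  using assms unfolding seq_equiv_def sequences_def mem_Collect_eq prod.case by blast+

lemma seq_equivI:
  assumes "is_iso \<C> b B B'" "b \<cdot> x = x'" "y' \<cdot> b = y" "<<x : A -> B>>" "<<y' : B' -> C>>"
  shows "((x, B, y), (x', B', y')) \<in> seq_equiv \<C> A C"
proof -
  have b: "<<b : B -> B'>>" using assms(1) by (simp add: is_iso_def)
  show ?thesis unfolding seq_equiv_def sequences_def mem_Collect_eq prod.case
    using assms comp_closed[OF assms(4) b] comp_closed[OF b assms(5)] by blast
qed

text \<open>The realization of \<open>\<delta>\<close> is a quotient class; fixing one representative \<open>(x, B, y)\<close> reduces every
  later question about it to the relation \<open>seq_equiv\<close> with that representative.\<close>

lemma realiz_representative:
  assumes "C \<in> Obj \<C>" "A \<in> Obj \<C>" "\<delta> \<in> carrier (Ext \<C> C A)"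
  obtains x B y where "<<x : A -> B>>" "<<y : B -> C>>"
    "\<And>t. (A, fst t, fst (snd t), snd (snd t), C, \<delta>) \<in> E_triangles \<C> \<longleftrightarrow> ((x, B, y), t) \<in> seq_equiv \<C> A C"
proof -
  obtain z where z: "Realiz \<C> C A \<delta> = seq_equiv \<C> A C `` {z}" "z \<in> sequences \<C> A C"
    using realiz_class[OF assms] by (rule quotientE)
  obtain x B y where xy: "z = (x, B, y)" by (cases z)
  show ?thesis
    by (rule that[of x B y])
      (use z assms xy in \<open>simp_all add: E_triangles_def sequences_def\<close>)
qed

lemma triangleD:
  assumes "(A, x, B, y, C, \<delta>) \<in> E_triangles \<C>"
  shows "<<x : A -> B>>" "<<y : B -> C>>" "\<delta> \<in> carrier (Ext \<C> C A)"
    "A \<in> Obj \<C>" "B \<in> Obj \<C>" "C \<in> Obj \<C>"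
proof -
  show d: "\<delta> \<in> carrier (Ext \<C> C A)" "A \<in> Obj \<C>" "C \<in> Obj \<C>"
    using assms by (simp_all add: E_triangles_def)
  obtain u Z v where "\<And>t. (A, fst t, fst (snd t), snd (snd t), C, \<delta>) \<in> E_triangles \<C> \<longleftrightarrow> ((u, Z, v), t) \<in> seq_equiv \<C> A C"
    using realiz_representative[OF d(3,2,1)] by metis
  from this[of "(x, B, y)"] show "<<x : A -> B>>" "<<y : B -> C>>"
    using assms seq_equivD(4,5) by auto
  then show "B \<in> Obj \<C>" using arr_objD by blast
qed

lemma realiz_exists:
  assumes "C \<in> Obj \<C>" "A \<in> Obj \<C>" "\<delta> \<in> carrier (Ext \<C> C A)"
  obtains x B y where "(A, x, B, y, C, \<delta>) \<in> E_triangles \<C>"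
proof -
  obtain x B y where x: "<<x : A -> B>>" and y: "<<y : B -> C>>"
    and t: "\<And>t. (A, fst t, fst (snd t), snd (snd t), C, \<delta>) \<in> E_triangles \<C> \<longleftrightarrow> ((x, B, y), t) \<in> seq_equiv \<C> A C"
    using realiz_representative[OF assms] by metis
  have "((x, B, y), (x, B, y)) \<in> seq_equiv \<C> A C"
    using seq_equivI[OF is_iso_ident[OF arr_objD(2)[OF x]] comp_ident_left[OF x] comp_ident_right[OF y] x y] .
  then show ?thesis using that t[of "(x, B, y)"] by simp
qed

lemma iso_compat_comp:
  assumes "<<x : A -> B>>" "<<b : B -> B'>>" "<<b' : B' -> B''>>" "<<y'' : B'' -> C>>"
  shows "(b' \<cdot> b) \<cdot> x = b' \<cdot> (b \<cdot> x)" "y'' \<cdot> (b' \<cdot> b) = (y'' \<cdot> b') \<cdot> b"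
  using comp_assoc[OF assms(1-3)] comp_assoc[OF assms(2-4)] by auto

lemma realiz_unique:
  assumes T: "(A, x, B, y, C, \<delta>) \<in> E_triangles \<C>" and T': "(A, x', B', y', C, \<delta>) \<in> E_triangles \<C>"
  obtains b where "is_iso \<C> b B B'" "b \<cdot> x = x'" "y' \<cdot> b = y"
proof -
  note D = triangleD[OF T] and D' = triangleD[OF T']
  obtain x0 B0 y0 where
      r: "\<And>t. (A, fst t, fst (snd t), snd (snd t), C, \<delta>) \<in> E_triangles \<C> \<longleftrightarrow> ((x0, B0, y0), t) \<in> seq_equiv \<C> A C"
    using realiz_representative[OF D(6,4,3)] by metis
  have z: "((x0, B0, y0), (x, B, y)) \<in> seq_equiv \<C> A C" "((x0, B0, y0), (x', B', y')) \<in> seq_equiv \<C> A C"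
    using T T' r[of "(x, B, y)"] r[of "(x', B', y')"] by simp_all
  obtain b where b: "is_iso \<C> b B0 B" "b \<cdot> x0 = x" "y \<cdot> b = y0" and x0: "<<x0 : A -> B0>>"
    using seq_equivD[OF z(1)] by blast
  obtain b' where b': "is_iso \<C> b' B0 B'" "b' \<cdot> x0 = x'" "y' \<cdot> b' = y0"
    using seq_equivD[OF z(2)] by blast
  obtain c where c: "is_iso \<C> c B B0" "c \<cdot> b = Ident \<C> B0" "b \<cdot> c = Ident \<C> B"
    using is_iso_inverse[OF b(1)] .
  have a: "<<b : B0 -> B>>" "<<b' : B0 -> B'>>" "<<c : B -> B0>>"
    using b b' c by (auto simp: is_iso_def)
  have "c \<cdot> x = x0" using b(2) c(2) comp_assoc[OF x0 a(1) a(3)] comp_ident_left[OF x0] by simp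
  then have 1: "(b' \<cdot> c) \<cdot> x = x'" using comp_assoc[OF D(1) a(3) a(2)] b'(2) by simp
  have "y0 \<cdot> c = y" using b(3) c(3) comp_assoc[OF a(3) a(1) D(2)] comp_ident_right[OF D(2)] by simp
  then have 2: "y' \<cdot> (b' \<cdot> c) = y" using comp_assoc[OF a(3,2) D'(2)] b'(3) by simp
  show ?thesis using that[OF is_iso_comp[OF c(1) b'(1)] 1 2] .
qed

lemma realiz_iso_closed:
  assumes T: "(A, x, B, y, C, \<delta>) \<in> E_triangles \<C>" and b: "is_iso \<C> b B B'" "b \<cdot> x = x'" "y' \<cdot> b = y"
    and y': "<<y' : B' -> C>>"
  shows "(A, x', B', y', C, \<delta>) \<in> E_triangles \<C>"
proof -
  note D = triangleD[OF T]
  obtain x0 B0 y0 where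
      r: "\<And>t. (A, fst t, fst (snd t), snd (snd t), C, \<delta>) \<in> E_triangles \<C> \<longleftrightarrow> ((x0, B0, y0), t) \<in> seq_equiv \<C> A C"
    using realiz_representative[OF D(6,4,3)] by metis
  have e: "((x0, B0, y0), (x, B, y)) \<in> seq_equiv \<C> A C"
    using T r[of "(x, B, y)"] by simp
  obtain b0 where b0: "is_iso \<C> b0 B0 B" "b0 \<cdot> x0 = x" "y \<cdot> b0 = y0" and x0: "<<x0 : A -> B0>>"
    using seq_equivD[OF e] by blast
  have a: "<<b : B -> B'>>" "<<b0 : B0 -> B>>" using b b0 by (auto simp: is_iso_def)
  have "(b \<cdot> b0) \<cdot> x0 = x'" "y' \<cdot> (b \<cdot> b0) = y0"
    using iso_compat_comp[OF x0 a(2,1) y'] b b0 by auto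
  then have "((x0, B0, y0), (x', B', y')) \<in> seq_equiv \<C> A C"
    using seq_equivI[OF is_iso_comp[OF b0(1) b(1)] _ _ x0 y'] by blast
  then show ?thesis using r[of "(x', B', y')"] by simp
qed


subsection \<open>Exactness properties of an E-triangle\<close>

definition zero_ob where "zero_ob = (SOME Z. zero_object \<C> Z)"

lemma zero_ob: "zero_object \<C> zero_ob"
  unfolding zero_ob_def using has_zero by (rule someI_ex)

lemma zero_ob_Obj: "zero_ob \<in> Obj \<C>"
  using zero_ob zero_object_id by blast

lemma triangle_ident_zero:
  assumes "zero_object \<C> Z" "A \<in> Obj \<C>"
  shows "(A, Ident \<C> A, A, \<zero>\<^bsub>A,Z\<^esub>, Z, \<zero>\<E>\<^bsub>Z,A\<^esub>) \<in> E_triangles \<C>"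
  using realiz_zero[OF biproduct_zero_right[OF assms]] .

lemma triangle_zero_ident:
  assumes "zero_object \<C> Z" "A \<in> Obj \<C>"
  shows "(Z, \<zero>\<^bsub>Z,A\<^esub>, A, Ident \<C> A, A, \<zero>\<E>\<^bsub>A,Z\<^esub>) \<in> E_triangles \<C>"
  using realiz_zero[OF biproduct_zero_left[OF assms]] .

context
  fixes A x B y C \<delta>
  assumes T: "(A, x, B, y, C, \<delta>) \<in> E_triangles \<C>"
begin

text \<open>Every object sits in the trivial E-triangles \<open>A = A \<rightarrow> 0\<close> and \<open>0 \<rightarrow> A = A\<close>.  The statements up to the factorization
  lemmas arise by mapping one of these to or from the given triangle and completing the map with a
  morphism axiom.\<close>

lemma triangle_comp_zero: "y \<cdot> x = \<zero>\<^bsub>A,C\<^esub>"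
proof -
  note TD = triangleD[OF T]
  have "x \<cdot> Ident \<C> A = x \<cdot> Ident \<C> A" ..
  from ET3[OF triangle_ident_zero[OF zero_ob TD(4)] T ident_closed[OF TD(4)] TD(1) this]
  obtain c where c: "<<c : zero_ob -> C>>" "y \<cdot> x = c \<cdot> \<zero>\<^bsub>A,zero_ob\<^esub>" by blast
  then show ?thesis using comp_zero_right TD by simp
qed

lemma triangle_weak_cokernel:
  assumes "<<f : B -> Z>>" "f \<cdot> x = \<zero>\<^bsub>A,Z\<^esub>"
  obtains h where "<<h : C -> Z>>" "f = h \<cdot> y"
proof -
  note TD = triangleD[OF T]
  have Z: "Z \<in> Obj \<C>" using assms arr_objD by blast
  have "f \<cdot> x = \<zero>\<^bsub>zero_ob,Z\<^esub> \<cdot> \<zero>\<^bsub>A,zero_ob\<^esub>"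
    using assms Z comp_zero_right[OF zero_arr[OF zero_ob_Obj Z] TD(4)] by simp
  from ET3[OF T triangle_zero_ident[OF zero_ob Z] zero_arr[OF TD(4) zero_ob_Obj] assms(1) this]
  show ?thesis using that comp_ident_left[OF assms(1)] by metis
qed

lemma triangle_weak_kernel:
  assumes "<<f : Z -> B>>" "y \<cdot> f = \<zero>\<^bsub>Z,C\<^esub>"
  obtains h where "<<h : Z -> A>>" "f = x \<cdot> h"
proof -
  note TD = triangleD[OF T]
  have Z: "Z \<in> Obj \<C>" using assms arr_objD by blast
  have "y \<cdot> f = \<zero>\<^bsub>zero_ob,C\<^esub> \<cdot> \<zero>\<^bsub>Z,zero_ob\<^esub>"
    using assms Z comp_zero_left[OF zero_arr[OF Z zero_ob_Obj] TD(6)] by simp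
  from ET3_op[OF triangle_ident_zero[OF zero_ob Z] T assms(1) zero_arr[OF zero_ob_Obj TD(6)] this]
  show ?thesis using that comp_ident_right[OF assms(1)] by metis
qed

lemma push_inflation: "push \<C> C x \<delta> = \<zero>\<E>\<^bsub>C,B\<^esub>"
proof -
  note TD = triangleD[OF T]
  have "Ident \<C> B \<cdot> x = Ident \<C> B \<cdot> x" ..
  from ET3[OF T triangle_ident_zero[OF zero_ob TD(5)] TD(1) ident_closed[OF TD(5)] this]
  show ?thesis using pull_zero[OF TD(5)] by auto
qed

lemma pull_deflation: "pull \<C> A y \<delta> = \<zero>\<E>\<^bsub>B,A\<^esub>"
proof -
  note TD = triangleD[OF T]
  have "y \<cdot> Ident \<C> B = y \<cdot> Ident \<C> B" ..
  from ET3_op[OF triangle_zero_ident[OF zero_ob TD(5)] T ident_closed[OF TD(5)] TD(2) this]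
  show ?thesis using push_zero[OF TD(5)] by auto
qed

lemma push_eq_zero_factors:
  assumes "<<a : A -> Z>>" "push \<C> C a \<delta> = \<zero>\<E>\<^bsub>C,Z\<^esub>"
  obtains b where "<<b : B -> Z>>" "b \<cdot> x = a"
proof -
  note TD = triangleD[OF T]
  have Z: "Z \<in> Obj \<C>" using assms arr_objD by blast
  have "push \<C> C a \<delta> = pull \<C> Z \<zero>\<^bsub>C,zero_ob\<^esub> \<zero>\<E>\<^bsub>zero_ob,Z\<^esub>"
    using assms pull_zero[OF Z zero_arr[OF TD(6) zero_ob_Obj]] by simp
  from realiz_morphism[OF T triangle_ident_zero[OF zero_ob Z] assms(1) zero_arr[OF TD(6) zero_ob_Obj] this]
  show ?thesis using that comp_ident_left[OF assms(1)] by metis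
qed

lemma pull_eq_zero_factors:
  assumes "<<c : Z -> C>>" "pull \<C> A c \<delta> = \<zero>\<E>\<^bsub>Z,A\<^esub>"
  obtains b where "<<b : Z -> B>>" "y \<cdot> b = c"
proof -
  note TD = triangleD[OF T]
  have Z: "Z \<in> Obj \<C>" using assms arr_objD by blast
  have "push \<C> Z \<zero>\<^bsub>zero_ob,A\<^esub> \<zero>\<E>\<^bsub>Z,zero_ob\<^esub> = pull \<C> A c \<delta>"
    using assms push_zero[OF Z zero_arr[OF zero_ob_Obj TD(4)]] by simp
  from realiz_morphism[OF triangle_zero_ident[OF zero_ob Z] T zero_arr[OF zero_ob_Obj TD(4)] assms(1) this]
  show ?thesis using that comp_ident_right[OF assms(1)] by metis
qed

text \<open>Exactness at \<open>Ext C Z\<close>: if \<open>y\<close> lifts to the middle term of a realization of \<open>\<epsilon>\<close>, then this lift together with the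
  identity of \<open>C\<close> is completed by a map of kernels.\<close>

lemma ext_exact_left:
  assumes "Z \<in> Obj \<C>" "\<epsilon> \<in> carrier (Ext \<C> C Z)" "pull \<C> Z y \<epsilon> = \<zero>\<E>\<^bsub>B,Z\<^esub>"
  obtains a where "<<a : A -> Z>>" "push \<C> C a \<delta> = \<epsilon>"
proof -
  note TD = triangleD[OF T]
  obtain u W v where W: "(Z, u, W, v, C, \<epsilon>) \<in> E_triangles \<C>" using realiz_exists[OF TD(6) assms(1,2)] .
  obtain b where b: "<<b : B -> W>>" "v \<cdot> b = y"
    using extriangulated_category.pull_eq_zero_factors[OF extriangulated_category_axioms W TD(2) assms(3)] .
  have "v \<cdot> b = Ident \<C> C \<cdot> y" using b comp_ident_left[OF TD(2)] by simp
  from ET3_op[OF T W b(1) ident_closed[OF TD(6)] this]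
  show ?thesis using that pull_ident[OF TD(6) assms(1,2)] by auto
qed

lemma ext_exact_right:
  assumes "Z \<in> Obj \<C>" "\<epsilon> \<in> carrier (Ext \<C> Z A)" "push \<C> Z x \<epsilon> = \<zero>\<E>\<^bsub>Z,B\<^esub>"
  obtains c where "<<c : Z -> C>>" "pull \<C> A c \<delta> = \<epsilon>"
proof -
  note TD = triangleD[OF T]
  obtain u W v where W: "(A, u, W, v, Z, \<epsilon>) \<in> E_triangles \<C>" using realiz_exists[OF assms(1) TD(4) assms(2)] .
  obtain b where b: "<<b : W -> B>>" "b \<cdot> u = x"
    using extriangulated_category.push_eq_zero_factors[OF extriangulated_category_axioms W TD(1) assms(3)] .
  have "b \<cdot> u = x \<cdot> Ident \<C> A" using b comp_ident_right[OF TD(1)] by simp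
  from ET3[OF W T ident_closed[OF TD(4)] b(1) this]
  show ?thesis using that push_ident[OF assms(1) TD(4) assms(2)] by auto
qed

text \<open>The only case of the five lemma that needs an argument; the general one follows by composing
  morphisms of triangles in both directions.\<close>

lemma endomorphism_iso:
  assumes b: "<<b : B -> B>>" "b \<cdot> x = x" "y \<cdot> b = y"
  shows "is_iso \<C> b B B"
proof -
  note TD = triangleD[OF T]
  \<comment> \<open>\<open>n = 1 - b\<close> squares to zero, so \<open>b\<close> is inverted by \<open>1 + n = 1 - (b - 1)\<close>\<close>
  let ?I = "Ident \<C> B"
  define n where "n = diff B B b ?I"
  have i: "<<?I : B -> B>>" using ident_closed TD by blast
  have n: "<<n : B -> B>>" unfolding n_def using diff_arr[OF b(1) i] .
  have "n \<cdot> x = \<zero>\<^bsub>A,B\<^esub>"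
    unfolding n_def diff_comp[OF TD(1) b(1) i]
    using diff_eq_zero_iff[OF TD(1) TD(1)] b(2) comp_ident_left[OF TD(1)] by simp
  then obtain h where h: "<<h : C -> B>>" "n = h \<cdot> y" using triangle_weak_cokernel[OF n] by blast
  have "y \<cdot> n = \<zero>\<^bsub>B,C\<^esub>"
    unfolding n_def comp_diff[OF b(1) i TD(2)]
    using diff_eq_zero_iff[OF TD(2) TD(2)] b(3) comp_ident_right[OF TD(2)] by simp
  then have nn: "n \<cdot> n = \<zero>\<^bsub>B,B\<^esub>"
    using h comp_assoc[OF n TD(2) h(1)] comp_zero_right[OF h(1) TD(5)] by simp
  define m where "m = diff B B ?I n"
  have m: "<<m : B -> B>>" unfolding m_def using diff_arr[OF i n] .
  interpret X: comm_group "Hom \<C> B B" using hom_group TD by blast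
  have bn: "b = ?I \<otimes>\<^bsub>Hom \<C> B B\<^esub> n" using diff_add[OF b(1) i] n_def by simp
  have mn: "m \<cdot> n = n"
    unfolding m_def diff_comp[OF n i n] nn using diff_zero[OF n] comp_ident_left[OF n] by simp
  have nm: "n \<cdot> m = n"
    unfolding m_def comp_diff[OF i n n] nn using diff_zero[OF n] comp_ident_right[OF n] by simp
  have s: "m \<otimes>\<^bsub>Hom \<C> B B\<^esub> n = ?I"
    unfolding m_def diff_def using i n by (auto simp: arr_def X.m_assoc)
  have "m \<cdot> b = ?I"
    unfolding bn comp_add_right[OF i n m] mn using comp_ident_right[OF m] s by simp
  moreover have "b \<cdot> m = ?I"
    unfolding bn comp_add_left[OF m i n] nm using comp_ident_left[OF m] s by simp
  ultimately show ?thesis unfolding is_iso_def using b m by blast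
qed

end

lemma triangle_morphism_iso:
  assumes T: "(A, x, B, y, C, \<delta>) \<in> E_triangles \<C>" and T': "(A', x', B', y', C', \<delta>') \<in> E_triangles \<C>"
    and a: "is_iso \<C> a A A'" and c: "is_iso \<C> c C C'" and p: "push \<C> C a \<delta> = pull \<C> A' c \<delta>'"
  obtains b where "is_iso \<C> b B B'" "b \<cdot> x = x' \<cdot> a" "y' \<cdot> b = c \<cdot> y"
proof -
  note D = triangleD[OF T] and D' = triangleD[OF T']
  obtain a' where a': "is_iso \<C> a' A' A" "a' \<cdot> a = Ident \<C> A" "a \<cdot> a' = Ident \<C> A'"
    using is_iso_inverse[OF a] .
  obtain c' where c': "is_iso \<C> c' C' C" "c' \<cdot> c = Ident \<C> C" "c \<cdot> c' = Ident \<C> C'"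
    using is_iso_inverse[OF c] .
  have ar: "<<a : A -> A'>>" "<<a' : A' -> A>>" "<<c : C -> C'>>" "<<c' : C' -> C>>"
    using a a' c c' by (auto simp: is_iso_def)
  obtain b where b: "<<b : B -> B'>>" "b \<cdot> x = x' \<cdot> a" "y' \<cdot> b = c \<cdot> y"
    using realiz_morphism[OF T T' ar(1,3) p] by blast
  have "push \<C> C' a' \<delta>' = push \<C> C' a' (pull \<C> A' c' (pull \<C> A' c \<delta>'))"
    using pull_comp[OF D'(4) ar(3,4) D'(3)] c'(3) pull_ident[OF D'(6,4,3)] by simp
  also have "\<dots> = push \<C> C' a' (pull \<C> A' c' (push \<C> C a \<delta>))" using p by simp
  also have "\<dots> = push \<C> C' a' (push \<C> C' a (pull \<C> A c' \<delta>))"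
    using push_pull[OF ar(4,1) D(3)] by simp
  also have "\<dots> = pull \<C> A c' \<delta>"
    using push_comp[OF D'(6) ar(1,2), of "pull \<C> A c' \<delta>"] pull_closed[OF D(4) ar(4) D(3)] a'(2)
      push_ident[OF D'(6) D(4)] by simp
  finally obtain b' where b': "<<b' : B' -> B>>" "b' \<cdot> x' = x \<cdot> a'" "y \<cdot> b' = c' \<cdot> y'"
    using realiz_morphism[OF T' T ar(2,4)] by blast
  have "(b' \<cdot> b) \<cdot> x = x"
    using comp_assoc[OF D(1) b(1) b'(1)] b(2) comp_assoc[OF ar(1) D'(1) b'(1)] b'(2)
      comp_assoc[OF ar(1,2) D(1)] a'(2) comp_ident_right[OF D(1)] by simp
  moreover have "y \<cdot> (b' \<cdot> b) = y"
    using comp_assoc[OF b(1) b'(1) D(2)] b(3) comp_assoc[OF b(1) D'(2) ar(4)] b'(3)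
      comp_assoc[OF D(2) ar(3,4)] c'(2) comp_ident_left[OF D(2)] by simp
  ultimately have 1: "is_iso \<C> (b' \<cdot> b) B B"
    using endomorphism_iso[OF T comp_closed[OF b(1) b'(1)]] by blast
  have "(b \<cdot> b') \<cdot> x' = x'"
    using comp_assoc[OF D'(1) b'(1) b(1)] b'(2) comp_assoc[OF ar(2) D(1) b(1)] b(2)
      comp_assoc[OF ar(2,1) D'(1)] a'(3) comp_ident_right[OF D'(1)] by simp
  moreover have "y' \<cdot> (b \<cdot> b') = y'"
    using comp_assoc[OF b'(1) b(1) D'(2)] b'(3) comp_assoc[OF b'(1) D(2) ar(3)] b(3)
      comp_assoc[OF D'(2) ar(4,3)] c'(3) comp_ident_left[OF D'(2)] by simp
  ultimately have 2: "is_iso \<C> (b \<cdot> b') B' B'"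
    using endomorphism_iso[OF T' comp_closed[OF b'(1) b(1)]] by blast
  obtain u where u: "<<u : B -> B>>" "u \<cdot> (b' \<cdot> b) = Ident \<C> B" using 1 unfolding is_iso_def by blast
  obtain v where v: "<<v : B' -> B'>>" "(b \<cdot> b') \<cdot> v = Ident \<C> B'" using 2 unfolding is_iso_def by blast
  let ?l = "u \<cdot> b'" and ?r = "b' \<cdot> v"
  have l: "<<?l : B' -> B>>" "?l \<cdot> b = Ident \<C> B"
    using comp_closed[OF b'(1) u(1)] comp_assoc[OF b(1) b'(1) u(1)] u(2) by auto
  have r: "<<?r : B' -> B>>" "b \<cdot> ?r = Ident \<C> B'"
    using comp_closed[OF v(1) b'(1)] comp_assoc[OF v(1) b'(1) b(1)] v(2) by auto
  have "?l = ?r" using comp_assoc[OF r(1) b(1) l(1)] l r comp_ident_left[OF r(1)] comp_ident_right[OF l(1)] by simp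
  then have "is_iso \<C> b B B'" unfolding is_iso_def using b(1) l r by auto
  then show ?thesis using that b by blast
qed

text \<open>The transported class is realized by some sequence, and the five lemma identifies it with
  the given sequence.\<close>

lemma triangle_iso_ends:
  assumes T: "(A, x, B, y, C, \<delta>) \<in> E_triangles \<C>" and a: "is_iso \<C> a A A'" and c: "is_iso \<C> c C C'"
  obtains x' y' \<delta>' where "(A', x', B, y', C', \<delta>') \<in> E_triangles \<C>"
    "iso_triangles \<C> (A, x, B, y, C, \<delta>) (A', x', B, y', C', \<delta>')"
proof -
  note D = triangleD[OF T]
  obtain a' where a': "is_iso \<C> a' A' A" "a' \<cdot> a = Ident \<C> A" "a \<cdot> a' = Ident \<C> A'"
    using is_iso_inverse[OF a] .
  obtain c' where c': "is_iso \<C> c' C' C" "c' \<cdot> c = Ident \<C> C" "c \<cdot> c' = Ident \<C> C'"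
    using is_iso_inverse[OF c] .
  have ar: "<<a : A -> A'>>" "<<a' : A' -> A>>" "<<c : C -> C'>>" "<<c' : C' -> C>>"
    using a a' c c' by (auto simp: is_iso_def)
  note A' = arr_objD[OF ar(2)] and C' = arr_objD[OF ar(4)]
  define \<delta>' where "\<delta>' = ExtMap \<C> c' a \<delta>"
  have d': "\<delta>' \<in> carrier (Ext \<C> C' A')" unfolding \<delta>'_def using ext_map_closed[OF ar(4,1) D(3)] .
  have p: "push \<C> C a \<delta> = pull \<C> A' c \<delta>'"
    unfolding \<delta>'_def push_pull(2)[OF ar(4,1) D(3), symmetric]
    using pull_comp[OF A'(1) ar(4,3) push_closed[OF D(6) ar(1) D(3)]] c'(2)
      pull_ident[OF D(6) A'(1) push_closed[OF D(6) ar(1) D(3)]] by simp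
  obtain x1 B1 y1 where T1: "(A', x1, B1, y1, C', \<delta>') \<in> E_triangles \<C>"
    using realiz_exists[OF C'(1) A'(1) d'] .
  note D1 = triangleD[OF T1]
  obtain b where b: "is_iso \<C> b B B1" "b \<cdot> x = x1 \<cdot> a" "y1 \<cdot> b = c \<cdot> y"
    using triangle_morphism_iso[OF T T1 a c p] .
  obtain b' where b': "is_iso \<C> b' B1 B" "b' \<cdot> b = Ident \<C> B" "b \<cdot> b' = Ident \<C> B1"
    using is_iso_inverse[OF b(1)] .
  have br: "<<b : B -> B1>>" "<<b' : B1 -> B>>" using b b' by (auto simp: is_iso_def)
  have "b' \<cdot> x1 = x \<cdot> a'"
  proof -
    have "x1 = (x1 \<cdot> a) \<cdot> a'" using comp_assoc[OF ar(2,1) D1(1)] a'(3) comp_ident_right[OF D1(1)] by simp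
    also have "\<dots> = b \<cdot> (x \<cdot> a')" using b(2)[symmetric] comp_assoc[OF ar(2) D(1) br(1)] by simp
    finally show ?thesis
      using comp_assoc[OF comp_closed[OF ar(2) D(1)] br] b'(2) comp_ident_left[OF comp_closed[OF ar(2) D(1)]] by simp
  qed
  moreover have "(c \<cdot> y) \<cdot> b' = y1"
    using b(3)[symmetric] comp_assoc[OF br(2,1) D1(2)] b'(3) comp_ident_right[OF D1(2)] by simp
  ultimately have T2: "(A', x \<cdot> a', B, c \<cdot> y, C', \<delta>') \<in> E_triangles \<C>"
    using realiz_iso_closed[OF T1 b'(1)] comp_closed[OF D(2) ar(3)] by blast
  have "Ident \<C> B \<cdot> x = (x \<cdot> a') \<cdot> a" "(c \<cdot> y) \<cdot> Ident \<C> B = c \<cdot> y"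
    using comp_ident_left[OF D(1)] comp_ident_right[OF comp_closed[OF D(2) ar(3)]] 
      comp_assoc[OF ar(1,2) D(1)] a'(2) comp_ident_right[OF D(1)] by auto
  then have "iso_triangles \<C> (A, x, B, y, C, \<delta>) (A', x \<cdot> a', B, c \<cdot> y, C', \<delta>')"
    unfolding iso_triangles.simps using a c is_iso_ident[OF D(5)] p by blast
  then show ?thesis using that T2 by blast
qed

text \<open>The biproduct sequence of the ends realizes \<open>0\<close> as well, so an isomorphism of the middle terms carries the
  biproduct structure over.\<close>

lemma split_triangle_biproduct:
  assumes T: "(A, x, B, y, C, \<zero>\<E>\<^bsub>C,A\<^esub>) \<in> E_triangles \<C>"
  obtains s r where "is_biproduct \<C> A C B x s r y"
proof -
  note D = triangleD[OF T]
  obtain S iA iC pA pC where S: "is_biproduct \<C> A C S iA iC pA pC"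
    using has_biproducts[OF D(4,6)] by blast
  obtain b where b: "is_iso \<C> b S B" "b \<cdot> iA = x" "y \<cdot> b = pC"
    using realiz_unique[OF realiz_zero[OF S] T] .
  obtain c where c: "is_iso \<C> c B S" "c \<cdot> b = Ident \<C> S" "b \<cdot> c = Ident \<C> B"
    using is_iso_inverse[OF b(1)] .
  have ar: "<<b : S -> B>>" "<<c : B -> S>>" using b c by (auto simp: is_iso_def)
  have s: "<<iA : A -> S>>" "<<iC : C -> S>>" "<<pA : S -> A>>" "<<pC : S -> C>>"
    "pA \<cdot> iA = Ident \<C> A" "pC \<cdot> iC = Ident \<C> C" "pA \<cdot> iC = \<zero>\<^bsub>C,A\<^esub>" "pC \<cdot> iA = \<zero>\<^bsub>A,C\<^esub>"
    "(iA \<cdot> pA) \<otimes>\<^bsub>Hom \<C> S S\<^esub> (iC \<cdot> pC) = Ident \<C> S"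
    using S by (auto simp: is_biproduct_def)
  let ?s = "b \<cdot> iC" and ?r = "pA \<cdot> c"
  have a: "<<?s : C -> B>>" "<<?r : B -> A>>" using comp_closed ar s by blast+
  have cb: "c \<cdot> (b \<cdot> i) = i" if "<<i : Z -> S>>" for i Z
    using comp_assoc[OF that ar] c(2) comp_ident_left[OF that] by simp
  have yc: "pC \<cdot> c = y"
    using b(3)[symmetric] comp_assoc[OF ar(2,1) D(2)] c(3) comp_ident_right[OF D(2)] by simp
  have 1: "?r \<cdot> x = Ident \<C> A" "?r \<cdot> ?s = \<zero>\<^bsub>C,A\<^esub>"
    using comp_assoc[OF D(1) ar(2) s(3)] comp_assoc[OF a(1) ar(2) s(3)] cb s b(2) by auto
  have 2: "y \<cdot> ?s = Ident \<C> C" "y \<cdot> x = \<zero>\<^bsub>A,C\<^esub>"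
    using comp_assoc[OF s(2) ar(1) D(2)] triangle_comp_zero[OF T] b(3) s by auto
  have "Ident \<C> B = b \<cdot> (Ident \<C> S \<cdot> c)"
    using c(3) comp_ident_left[OF ar(2)] by simp
  also have "\<dots> = (b \<cdot> ((iA \<cdot> pA) \<cdot> c)) \<otimes>\<^bsub>Hom \<C> B B\<^esub> (b \<cdot> ((iC \<cdot> pC) \<cdot> c))"
    unfolding s(9)[symmetric]
    using comp_add_left[OF ar(2) comp_closed[OF s(3,1)] comp_closed[OF s(4,2)]]
      comp_add_right[OF comp_closed[OF ar(2) comp_closed[OF s(3,1)]] comp_closed[OF ar(2) comp_closed[OF s(4,2)]] ar(1)]
    by simp
  also have "b \<cdot> ((iA \<cdot> pA) \<cdot> c) = x \<cdot> ?r"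
    using comp_assoc[OF ar(2) s(3,1)] comp_assoc[OF a(2) s(1) ar(1)] b(2) by simp
  also have "b \<cdot> ((iC \<cdot> pC) \<cdot> c) = ?s \<cdot> y"
    using comp_assoc[OF ar(2) s(4,2)] comp_assoc[OF D(2) s(2) ar(1)] yc by simp
  finally show ?thesis
    using that[of ?s ?r] unfolding is_biproduct_def using D a 1 2 by auto
qed

text \<open>Exactness at \<open>Ext B Z\<close>: in the composite of the deflation of a realization of \<open>\<epsilon>\<close> with \<open>y\<close>, the kernel \<open>E\<close> is an
  extension of \<open>A\<close> by \<open>Z\<close> which splits by assumption; pushing the class of the composite along
  the retraction gives the preimage.\<close>

lemma ext_exact_middle:
  assumes T: "(A, x, B, y, C, \<delta>) \<in> E_triangles \<C>"
    and Z: "Z \<in> Obj \<C>" and e: "\<epsilon> \<in> carrier (Ext \<C> B Z)" and z: "pull \<C> Z x \<epsilon> = \<zero>\<E>\<^bsub>A,Z\<^esub>"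
  obtains \<theta> where "\<theta> \<in> carrier (Ext \<C> C Z)" "pull \<C> Z y \<theta> = \<epsilon>"
proof -
  note D = triangleD[OF T]
  obtain u W w where W: "(Z, u, W, w, B, \<epsilon>) \<in> E_triangles \<C>" using realiz_exists[OF D(5) Z e] .
  obtain E h i d \<delta>' where 1: "(E, h, W, y \<cdot> w, C, \<delta>') \<in> E_triangles \<C>"
    and 2: "(Z, i, E, d, A, pull \<C> Z x \<epsilon>) \<in> E_triangles \<C>"
    and 3: "pull \<C> E y \<delta>' = push \<C> B i \<epsilon>"
    using ET4_op[OF T W] by blast
  note D1 = triangleD[OF 1] and D2 = triangleD[OF 2]
  obtain r where r: "<<r : E -> Z>>" "r \<cdot> i = Ident \<C> Z"
    using split_triangle_biproduct 2 z unfolding is_biproduct_def by metis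
  have "pull \<C> Z y (push \<C> C r \<delta>') = push \<C> B r (push \<C> B i \<epsilon>)"
    using push_pull[OF D(2) r(1) D1(3)] 3 by simp
  also have "\<dots> = \<epsilon>" using push_comp[OF D(5) D2(1) r(1) e] r(2) push_ident[OF D(5) Z e] by simp
  finally show ?thesis using that push_closed[OF D(6) r(1) D1(3)] by blast
qed

lemma split_triangle_swap:
  assumes "(A, x, B, y, C, \<zero>\<E>\<^bsub>C,A\<^esub>) \<in> E_triangles \<C>"
  obtains s r where "(C, s, B, r, A, \<zero>\<E>\<^bsub>A,C\<^esub>) \<in> E_triangles \<C>"
  using split_triangle_biproduct[OF assms] realiz_zero[OF biproduct_swap] by metis

lemma retraction_imp_split:
  assumes T: "(A, x, B, y, C, \<delta>) \<in> E_triangles \<C>" and "<<r : B -> A>>" "r \<cdot> x = Ident \<C> A"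
  shows "\<delta> = \<zero>\<E>\<^bsub>C,A\<^esub>"
  using push_comp[OF triangleD(6,1)[OF T] assms(2) triangleD(3)[OF T]] push_inflation[OF T]
    push_zero[OF triangleD(6)[OF T] assms(2)] push_ident[OF triangleD(6,4,3)[OF T]] assms(3) by simp

end

section \<open>Proper classes with enough projectives and injectives\<close>

lemma short_exact_sequence_pointwise:
  assumes g: "group_hom C B g" and f: "group_hom B A f" and k: "kernel B A f = g ` carrier C"
  shows "short_exact_sequence A B C f g \<longleftrightarrow>
    (\<forall>h\<in>carrier C. g h = \<one>\<^bsub>B\<^esub> \<longrightarrow> h = \<one>\<^bsub>C\<^esub>) \<and> (\<forall>a\<in>carrier A. \<exists>b\<in>carrier B. f b = a)"
proof -
  interpret g: group_hom C B g by (rule g)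
  interpret f: group_hom B A f by (rule f)
  have "g \<in> mon C B \<longleftrightarrow> (\<forall>h\<in>carrier C. g h = \<one>\<^bsub>B\<^esub> \<longrightarrow> h = \<one>\<^bsub>C\<^esub>)"
    using g.inj_iff_trivial_ker g.homh by (auto simp: mon_def kernel_def)
  moreover have "f \<in> epi B A \<longleftrightarrow> (\<forall>a\<in>carrier A. \<exists>b\<in>carrier B. f b = a)"
    unfolding epi_iff_subset using f.homh by (auto simp: subset_iff image_iff)
  moreover have "exact_seq ([A, B, C], [f, g])"
    using g f k f.homh f.H.is_group by simp
  ultimately show ?thesis by (auto simp: short_exact_sequence_iff)
qed

context extriangulated_category
begin

lemma triangle_contravariant_short_exact_iff:
  assumes T: "(A, x, B, y, C, \<delta>) \<in> E_triangles \<C>" and X: "X \<in> Obj \<C>"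
  shows "short_exact_sequence (Hom \<C> A X) (Hom \<C> B X) (Hom \<C> C X) (\<lambda>f. f \<cdot> x) (\<lambda>f. f \<cdot> y) \<longleftrightarrow>
    (\<forall>h. <<h : C -> X>> \<longrightarrow> h \<cdot> y = \<zero>\<^bsub>B,X\<^esub> \<longrightarrow> h = \<zero>\<^bsub>C,X\<^esub>) \<and>
    (\<forall>a. <<a : A -> X>> \<longrightarrow> (\<exists>b. <<b : B -> X>> \<and> b \<cdot> x = a))"
proof -
  note D = triangleD[OF T]
  have z: "(h \<cdot> y) \<cdot> x = \<zero>\<^bsub>A,X\<^esub>" if "<<h : C -> X>>" for h
    using comp_assoc[OF D(1,2) that] triangle_comp_zero[OF T] comp_zero_right[OF that D(4)] by simp
  have "kernel (Hom \<C> B X) (Hom \<C> A X) (\<lambda>f. f \<cdot> x) = (\<lambda>f. f \<cdot> y) ` carrier (Hom \<C> C X)"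
  proof (rule Set.set_eqI, rule iffI)
    fix f assume "f \<in> kernel (Hom \<C> B X) (Hom \<C> A X) (\<lambda>f. f \<cdot> x)"
    then have "<<f : B -> X>>" "f \<cdot> x = \<zero>\<^bsub>A,X\<^esub>" using D X by (auto simp: kernel_def arr_def)
    then obtain h where "<<h : C -> X>>" "f = h \<cdot> y" using triangle_weak_cokernel[OF T] by blast
    then show "f \<in> (\<lambda>f. f \<cdot> y) ` carrier (Hom \<C> C X)" by (auto simp: arr_def)
  next
    fix f assume "f \<in> (\<lambda>f. f \<cdot> y) ` carrier (Hom \<C> C X)"
    then obtain h where h: "<<h : C -> X>>" "f = h \<cdot> y" using D X by (auto simp: arr_def)
    then show "f \<in> kernel (Hom \<C> B X) (Hom \<C> A X) (\<lambda>f. f \<cdot> x)"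
      using z[OF h(1)] comp_closed[OF D(2) h(1)] by (auto simp: kernel_def arr_def)
  qed
  from short_exact_sequence_pointwise[OF pre_comp_hom[OF D(2) X] pre_comp_hom[OF D(1) X] this]
  show ?thesis using D X by (auto simp: arr_def)
qed

lemma triangle_covariant_short_exact_iff:
  assumes T: "(A, x, B, y, C, \<delta>) \<in> E_triangles \<C>" and X: "X \<in> Obj \<C>"
  shows "short_exact_sequence (Hom \<C> X C) (Hom \<C> X B) (Hom \<C> X A) (\<lambda>f. y \<cdot> f) (\<lambda>f. x \<cdot> f) \<longleftrightarrow>
    (\<forall>h. <<h : X -> A>> \<longrightarrow> x \<cdot> h = \<zero>\<^bsub>X,B\<^esub> \<longrightarrow> h = \<zero>\<^bsub>X,A\<^esub>) \<and>
    (\<forall>c. <<c : X -> C>> \<longrightarrow> (\<exists>b. <<b : X -> B>> \<and> y \<cdot> b = c))"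
proof -
  note D = triangleD[OF T]
  have z: "y \<cdot> (x \<cdot> h) = \<zero>\<^bsub>X,C\<^esub>" if "<<h : X -> A>>" for h
    using comp_assoc[OF that D(1,2)] triangle_comp_zero[OF T] comp_zero_left[OF that D(6)] by simp
  have "kernel (Hom \<C> X B) (Hom \<C> X C) (\<lambda>f. y \<cdot> f) = (\<lambda>f. x \<cdot> f) ` carrier (Hom \<C> X A)"
  proof (rule Set.set_eqI, rule iffI)
    fix f assume "f \<in> kernel (Hom \<C> X B) (Hom \<C> X C) (\<lambda>f. y \<cdot> f)"
    then have "<<f : X -> B>>" "y \<cdot> f = \<zero>\<^bsub>X,C\<^esub>" using D X by (auto simp: kernel_def arr_def)
    then obtain h where "<<h : X -> A>>" "f = x \<cdot> h" using triangle_weak_kernel[OF T] by blast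
    then show "f \<in> (\<lambda>f. x \<cdot> f) ` carrier (Hom \<C> X A)" by (auto simp: arr_def)
  next
    fix f assume "f \<in> (\<lambda>f. x \<cdot> f) ` carrier (Hom \<C> X A)"
    then obtain h where h: "<<h : X -> A>>" "f = x \<cdot> h" using D X by (auto simp: arr_def)
    then show "f \<in> kernel (Hom \<C> X B) (Hom \<C> X C) (\<lambda>f. y \<cdot> f)"
      using z[OF h(1)] comp_closed[OF h(1) D(1)] by (auto simp: kernel_def arr_def)
  qed
  from short_exact_sequence_pointwise[OF post_comp_hom[OF D(1) X] post_comp_hom[OF D(2) X] this]
  show ?thesis using D X by (auto simp: arr_def)
qed

end

locale enough_xi_category = extriangulated_category \<C> + proper_class \<C> \<xi>
  for \<C> :: "('o, 'm, 'e) extri_data" (structure) and \<xi> +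
  assumes enough_projectives: "enough_xi_projectives \<C> \<xi>"
    and enough_injectives: "enough_xi_injectives \<C> \<xi>"
begin

abbreviation "Proj \<equiv> xi_projectives \<C> \<xi>"
abbreviation "Inj \<equiv> xi_injectives \<C> \<xi>"

lemma xi_E: "T \<in> \<xi> \<Longrightarrow> T \<in> E_triangles \<C>"
  using xi_triangles by blast

lemmas xiD = triangleD[OF xi_E]

lemma projI:
  assumes "P \<in> Obj \<C>"
    and "\<And>A x B y C \<delta> c. (A, x, B, y, C, \<delta>) \<in> \<xi> \<Longrightarrow> <<c : P -> C>> \<Longrightarrow> \<exists>b. <<b : P -> B>> \<and> y \<cdot> b = c"
    and "\<And>A x B y C \<delta> a. (A, x, B, y, C, \<delta>) \<in> \<xi> \<Longrightarrow> <<a : P -> A>> \<Longrightarrow> x \<cdot> a = \<zero>\<^bsub>P,B\<^esub> \<Longrightarrow> a = \<zero>\<^bsub>P,A\<^esub>"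
  shows "P \<in> Proj"
  unfolding xi_projectives_def mem_Collect_eq
proof (intro conjI allI impI)
  fix A x B y C \<delta> assume T: "(A, x, B, y, C, \<delta>) \<in> \<xi>"
  show "short_exact_sequence (Hom \<C> P C) (Hom \<C> P B) (Hom \<C> P A) (\<lambda>f. y \<cdot> f) (\<lambda>f. x \<cdot> f)"
    unfolding triangle_covariant_short_exact_iff[OF xi_E[OF T] assms(1)] using assms(2,3)[OF T] by blast
qed (rule assms(1))

lemma proj_Obj: "P \<in> Proj \<Longrightarrow> P \<in> Obj \<C>"
  by (simp add: xi_projectives_def)

lemma proj_lift:
  assumes "P \<in> Proj" "(A, x, B, y, C, \<delta>) \<in> \<xi>" "<<c : P -> C>>"
  obtains b where "<<b : P -> B>>" "y \<cdot> b = c"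
proof -
  have "short_exact_sequence (Hom \<C> P C) (Hom \<C> P B) (Hom \<C> P A) (\<lambda>f. y \<cdot> f) (\<lambda>f. x \<cdot> f)"
    using assms(1,2) unfolding xi_projectives_def by blast
  then show ?thesis
    unfolding triangle_covariant_short_exact_iff[OF xi_E[OF assms(2)] proj_Obj[OF assms(1)]]
    using assms(3) that by blast
qed

text \<open>Inflations are not monomorphisms in general; that projectives see them as such is part of the
  definition of a projective.\<close>

lemma proj_mono:
  assumes "P \<in> Proj" "(A, x, B, y, C, \<delta>) \<in> \<xi>" "<<a : P -> A>>" "x \<cdot> a = \<zero>\<^bsub>P,B\<^esub>"
  shows "a = \<zero>\<^bsub>P,A\<^esub>"
proof -
  have "short_exact_sequence (Hom \<C> P C) (Hom \<C> P B) (Hom \<C> P A) (\<lambda>f. y \<cdot> f) (\<lambda>f. x \<cdot> f)"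
    using assms(1,2) unfolding xi_projectives_def by blast
  then show ?thesis
    unfolding triangle_covariant_short_exact_iff[OF xi_E[OF assms(2)] proj_Obj[OF assms(1)]]
    using assms(3,4) by blast
qed

lemma proj_mono_eq:
  assumes "P \<in> Proj" "(A, x, B, y, C, \<delta>) \<in> \<xi>" "<<a : P -> A>>" "<<a' : P -> A>>" "x \<cdot> a = x \<cdot> a'"
  shows "a = a'"
proof -
  have "x \<cdot> diff P A a a' = \<zero>\<^bsub>P,B\<^esub>"
    using comp_diff[OF assms(3,4) xiD(1)[OF assms(2)]] assms(5)
      diff_eq_zero_iff[OF comp_closed comp_closed, OF assms(3) xiD(1)[OF assms(2)] assms(4) xiD(1)[OF assms(2)]]
    by simp
  then show ?thesis
    using proj_mono[OF assms(1,2) diff_arr[OF assms(3,4)]] diff_eq_zero_iff[OF assms(3,4)] by simp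
qed

lemma inj_Obj: "I \<in> Inj \<Longrightarrow> I \<in> Obj \<C>"
  by (simp add: xi_injectives_def)

lemma inj_extend:
  assumes "I \<in> Inj" "(A, x, B, y, C, \<delta>) \<in> \<xi>" "<<a : A -> I>>"
  obtains b where "<<b : B -> I>>" "b \<cdot> x = a"
proof -
  have "short_exact_sequence (Hom \<C> A I) (Hom \<C> B I) (Hom \<C> C I) (\<lambda>f. f \<cdot> x) (\<lambda>f. f \<cdot> y)"
    using assms(1,2) unfolding xi_injectives_def by blast
  then show ?thesis
    unfolding triangle_contravariant_short_exact_iff[OF xi_E[OF assms(2)] inj_Obj[OF assms(1)]]
    using assms(3) that by blast
qed

lemma inj_epi:
  assumes "I \<in> Inj" "(A, x, B, y, C, \<delta>) \<in> \<xi>" "<<c : C -> I>>" "c \<cdot> y = \<zero>\<^bsub>B,I\<^esub>"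
  shows "c = \<zero>\<^bsub>C,I\<^esub>"
proof -
  have "short_exact_sequence (Hom \<C> A I) (Hom \<C> B I) (Hom \<C> C I) (\<lambda>f. f \<cdot> x) (\<lambda>f. f \<cdot> y)"
    using assms(1,2) unfolding xi_injectives_def by blast
  then show ?thesis
    unfolding triangle_contravariant_short_exact_iff[OF xi_E[OF assms(2)] inj_Obj[OF assms(1)]]
    using assms(3,4) by blast
qed

lemma inj_epi_eq:
  assumes "I \<in> Inj" "(A, x, B, y, C, \<delta>) \<in> \<xi>" "<<c : C -> I>>" "<<c' : C -> I>>" "c \<cdot> y = c' \<cdot> y"
  shows "c = c'"
proof -
  have "diff C I c c' \<cdot> y = \<zero>\<^bsub>B,I\<^esub>"
    using diff_comp[OF xiD(2)[OF assms(2)] assms(3,4)] assms(5)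
      diff_eq_zero_iff[OF comp_closed comp_closed, OF xiD(2)[OF assms(2)] assms(3) xiD(2)[OF assms(2)] assms(4)]
    by simp
  then show ?thesis
    using inj_epi[OF assms(1,2) diff_arr[OF assms(3,4)]] diff_eq_zero_iff[OF assms(3,4)] by simp
qed

lemma proj_retract:
  assumes P: "P \<in> Proj" and s: "<<s : Q -> P>>" and r: "<<r : P -> Q>>" and rs: "r \<cdot> s = Ident \<C> Q"
  shows "Q \<in> Proj"
proof (rule projI)
  show "Q \<in> Obj \<C>" using s arr_objD by blast
  fix A x B y C \<delta> assume T: "(A, x, B, y, C, \<delta>) \<in> \<xi>"
  {
    fix c assume c: "<<c : Q -> C>>"
    obtain b where b: "<<b : P -> B>>" "y \<cdot> b = c \<cdot> r" using proj_lift[OF P T comp_closed[OF r c]] .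
    have "y \<cdot> (b \<cdot> s) = c"
      using comp_assoc[OF s b(1) xiD(2)[OF T]] b(2) comp_assoc[OF s r c] rs comp_ident_right[OF c] by simp
    then show "\<exists>b. <<b : Q -> B>> \<and> y \<cdot> b = c" using comp_closed[OF s b(1)] by blast
  next
    fix a assume a: "<<a : Q -> A>>" "x \<cdot> a = \<zero>\<^bsub>Q,B\<^esub>"
    have "x \<cdot> (a \<cdot> r) = \<zero>\<^bsub>P,B\<^esub>"
      using comp_assoc[OF r a(1) xiD(1)[OF T]] a(2) comp_zero_left[OF r xiD(5)[OF T]] by simp
    then have "a \<cdot> r = \<zero>\<^bsub>P,A\<^esub>" using proj_mono[OF P T comp_closed[OF r a(1)]] by simp
    then have "a \<cdot> (r \<cdot> s) = \<zero>\<^bsub>Q,A\<^esub>"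
      using comp_assoc[OF s r a(1)] comp_zero_left[OF s xiD(4)[OF T]] by simp
    then show "a = \<zero>\<^bsub>Q,A\<^esub>" using rs comp_ident_right[OF a(1)] by simp
  }
qed

lemma proj_biproduct:
  assumes P: "P \<in> Proj" and Q: "Q \<in> Proj" and S: "is_biproduct \<C> P Q S i j p q"
  shows "S \<in> Proj"
proof (rule projI)
  have a: "<<i : P -> S>>" "<<j : Q -> S>>" "<<p : S -> P>>" "<<q : S -> Q>>"
    and e: "(i \<cdot> p) \<otimes>\<^bsub>Hom \<C> S S\<^esub> (j \<cdot> q) = Ident \<C> S"
    using S by (auto simp: is_biproduct_def)
  show SO: "S \<in> Obj \<C>" using a arr_objD by blast
  have dec: "f = (f \<cdot> i \<cdot> p) \<otimes>\<^bsub>Hom \<C> S Z\<^esub> (f \<cdot> j \<cdot> q)" if f: "<<f : S -> Z>>" for f Z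
    using comp_add_right[OF comp_closed[OF a(3,1)] comp_closed[OF a(4,2)] f]
      e comp_ident_right[OF f] comp_assoc[OF a(3,1) f] comp_assoc[OF a(4,2) f] by simp
  fix A x B y C \<delta> assume T: "(A, x, B, y, C, \<delta>) \<in> \<xi>"
  note D = xiD[OF T]
  {
    fix c assume c: "<<c : S -> C>>"
    obtain b where b: "<<b : P -> B>>" "y \<cdot> b = c \<cdot> i" using proj_lift[OF P T comp_closed[OF a(1) c]] .
    obtain b' where b': "<<b' : Q -> B>>" "y \<cdot> b' = c \<cdot> j" using proj_lift[OF Q T comp_closed[OF a(2) c]] .
    interpret X: comm_group "Hom \<C> S B" using hom_group SO D by blast
    have "<<(b \<cdot> p) \<otimes>\<^bsub>Hom \<C> S B\<^esub> (b' \<cdot> q) : S -> B>>"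
      using comp_closed[OF a(3) b(1)] comp_closed[OF a(4) b'(1)] by (auto simp: arr_def)
    moreover have "y \<cdot> ((b \<cdot> p) \<otimes>\<^bsub>Hom \<C> S B\<^esub> (b' \<cdot> q)) = c"
      using comp_add_right[OF comp_closed[OF a(3) b(1)] comp_closed[OF a(4) b'(1)] D(2)]
        comp_assoc[OF a(3) b(1) D(2)] comp_assoc[OF a(4) b'(1) D(2)] b b' dec[OF c] by simp
    ultimately show "\<exists>b. <<b : S -> B>> \<and> y \<cdot> b = c" by blast
  next
    fix f assume f: "<<f : S -> A>>" "x \<cdot> f = \<zero>\<^bsub>S,B\<^esub>"
    interpret X: comm_group "Hom \<C> S A" using hom_group SO D by blast
    have "f \<cdot> i = \<zero>\<^bsub>P,A\<^esub>"
      using proj_mono[OF P T comp_closed[OF a(1) f(1)]] comp_assoc[OF a(1) f(1) D(1)] f(2)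
        comp_zero_left[OF a(1) D(5)] by simp
    moreover have "f \<cdot> j = \<zero>\<^bsub>Q,A\<^esub>"
      using proj_mono[OF Q T comp_closed[OF a(2) f(1)]] comp_assoc[OF a(2) f(1) D(1)] f(2)
        comp_zero_left[OF a(2) D(5)] by simp
    ultimately show "f = \<zero>\<^bsub>S,A\<^esub>"
      using dec[OF f(1)] comp_zero_left[OF a(3) D(4)] comp_zero_left[OF a(4) D(4)] by simp
  }
qed


subsection \<open>The subfunctor of extensions in the proper class\<close>

text \<open>Saturation, applied to a deflation from a projective, turns membership in \<open>\<xi>\<close> into the
  vanishing of all pullbacks to projectives.  This description makes all the closure
  properties of \<open>\<xi>\<close> immediate, also those dual to the axioms.\<close>

lemma xi_iff:
  assumes T: "(A, x, B, y, C, \<delta>) \<in> E_triangles \<C>"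
  shows "(A, x, B, y, C, \<delta>) \<in> \<xi> \<longleftrightarrow> (\<forall>P\<in>Proj. \<forall>p. <<p : P -> C>> \<longrightarrow> pull \<C> A p \<delta> = \<zero>\<E>\<^bsub>P,A\<^esub>)"
proof (intro iffI ballI allI impI)
  note D = triangleD[OF T]
  fix P p assume X: "(A, x, B, y, C, \<delta>) \<in> \<xi>" and P: "P \<in> Proj" and p: "<<p : P -> C>>"
  obtain b where b: "<<b : P -> B>>" "y \<cdot> b = p" using proj_lift[OF P X p] .
  show "pull \<C> A p \<delta> = \<zero>\<E>\<^bsub>P,A\<^esub>"
    using pull_comp[OF D(4,2) b(1) D(3)] b(2) pull_deflation[OF T] pull_zero[OF D(4) b(1)] by simp
next
  note D = triangleD[OF T]
  assume v: "\<forall>P\<in>Proj. \<forall>p. <<p : P -> C>> \<longrightarrow> pull \<C> A p \<delta> = \<zero>\<E>\<^bsub>P,A\<^esub>"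
  obtain K g P p \<epsilon> where P: "(K, g, P, p, C, \<epsilon>) \<in> \<xi>" "P \<in> Proj"
    using enough_projectives D(6) unfolding enough_xi_projectives_def by blast
  have z: "pull \<C> A p \<delta> = \<zero>\<E>\<^bsub>P,A\<^esub>" using v P xiD(2)[OF P(1)] by blast
  obtain u M w where M: "(A, u, M, w, P, \<zero>\<E>\<^bsub>P,A\<^esub>) \<in> E_triangles \<C>"
    using realiz_exists[OF proj_Obj[OF P(2)] D(4) zero_ext_closed[OF proj_Obj[OF P(2)] D(4)]] .
  show "(A, x, B, y, C, \<delta>) \<in> \<xi>"
    using xi_saturated[OF T P(1)] xi_split[OF M] z by metis
qed

lemma xi_proj_end_splits:
  assumes "(A, x, B, y, P, \<delta>) \<in> \<xi>" "P \<in> Proj"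
  shows "\<delta> = \<zero>\<E>\<^bsub>P,A\<^esub>"
  using xi_iff[OF xi_E[OF assms(1)]] assms ident_closed[OF proj_Obj[OF assms(2)]]
    pull_ident[OF proj_Obj[OF assms(2)] xiD(4,3)[OF assms(1)]] by metis

lemma xi_pull_to_proj:
  assumes "(A, x, B, y, C, \<delta>) \<in> \<xi>" "P \<in> Proj" "<<p : P -> C>>"
  shows "pull \<C> A p \<delta> = \<zero>\<E>\<^bsub>P,A\<^esub>"
  using xi_iff[OF xi_E[OF assms(1)]] assms by blast

text \<open>The approximation arguments only ask which objects are joined by a triangle in \<open>\<xi>\<close>; forgetting the
  morphisms turns composites, pullbacks and pushouts into a calculus of triples.\<close>

definition conf where
  "conf A B C \<longleftrightarrow> (\<exists>x y \<delta>. (A, x, B, y, C, \<delta>) \<in> \<xi>)"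

lemma confI: "(A, x, B, y, C, \<delta>) \<in> \<xi> \<Longrightarrow> conf A B C"
  unfolding conf_def by blast

lemma conf_Obj: "conf A B C \<Longrightarrow> A \<in> Obj \<C> \<and> B \<in> Obj \<C> \<and> C \<in> Obj \<C>"
  unfolding conf_def by (auto dest: xiD)

lemma conf_iso_ends:
  assumes "conf A B C" "is_iso \<C> a A A'" "is_iso \<C> c C C'"
  shows "conf A' B C'"
proof -
  obtain x y \<delta> where T: "(A, x, B, y, C, \<delta>) \<in> \<xi>" using assms(1) unfolding conf_def by blast
  show ?thesis using triangle_iso_ends[OF xi_E[OF T] assms(2,3)] xi_iso[OF T] confI by metis
qed

lemma conf_split_swap:
  assumes "(A, x, B, y, C, \<zero>\<E>\<^bsub>C,A\<^esub>) \<in> E_triangles \<C>"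
  shows "conf C B A"
  using split_triangle_swap[OF assms] xi_split confI by metis

lemma conf_zero_left: "\<lbrakk>zero_object \<C> Z; A \<in> Obj \<C>\<rbrakk> \<Longrightarrow> conf Z A A"
  using confI[OF xi_split[OF triangle_zero_ident]] .

lemma conf_zero_right: "\<lbrakk>zero_object \<C> Z; A \<in> Obj \<C>\<rbrakk> \<Longrightarrow> conf A A Z"
  using confI[OF xi_split[OF triangle_ident_zero]] .

text \<open>For a projective test object \<open>P\<close>, the pullback of the class of \<open>A \<rightarrow> C \<rightarrow> E\<close> dies in \<open>Ext P B\<close>, hence is a pullback of
  the class of \<open>A \<rightarrow> B \<rightarrow> D\<close>, which is killed as well.\<close>

lemma conf_compose_inflations:
  assumes "conf A B D" "conf B C F"
  obtains E where "conf A C E" "conf D E F"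
proof -
  obtain f f' \<delta> where T: "(A, f, B, f', D, \<delta>) \<in> \<xi>" using assms(1) unfolding conf_def by blast
  obtain g g' \<delta>' where T': "(B, g, C, g', F, \<delta>') \<in> \<xi>" using assms(2) unfolding conf_def by blast
  obtain E h' d e \<delta>'' where 1: "(A, g \<cdot> f, C, h', E, \<delta>'') \<in> E_triangles \<C>"
    and 2: "(D, d, E, e, F, push \<C> F f' \<delta>') \<in> E_triangles \<C>"
    and 3: "pull \<C> A d \<delta>'' = \<delta>" "push \<C> E f \<delta>'' = pull \<C> B e \<delta>'"
    using ET4[OF xi_E[OF T] xi_E[OF T']] by blast
  note D = xiD[OF T] and D' = xiD[OF T'] and D1 = triangleD[OF 1] and D2 = triangleD[OF 2]
  have "(A, g \<cdot> f, C, h', E, \<delta>'') \<in> \<xi>"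
    unfolding xi_iff[OF 1]
  proof (intro ballI allI impI)
    fix P p assume P: "P \<in> Proj" and p: "<<p : P -> E>>"
    have "push \<C> P f (pull \<C> A p \<delta>'') = pull \<C> B p (pull \<C> B e \<delta>')"
      using push_pull[OF p D(1) D1(3)] 3(2) by simp
    also have "\<dots> = \<zero>\<E>\<^bsub>P,B\<^esub>"
      using pull_comp[OF D'(4) D2(2) p D'(3)] xi_pull_to_proj[OF T' P comp_closed[OF p D2(2)]] by simp
    finally obtain c where "<<c : P -> D>>" "pull \<C> A c \<delta> = pull \<C> A p \<delta>''"
      using ext_exact_right[OF xi_E[OF T] proj_Obj[OF P] pull_closed[OF D(4) p D1(3)]] by blast
    then show "pull \<C> A p \<delta>'' = \<zero>\<E>\<^bsub>P,A\<^esub>" using xi_pull_to_proj[OF T P] by metis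
  qed
  then show ?thesis using that xi_cobase_change[OF T' D(2) 2] confI by blast
qed

text \<open>Maps from a projective lift along both deflations, hence along their composite.\<close>

lemma conf_compose_deflations:
  assumes "conf D B A" "conf F C B"
  obtains E where "conf E C A" "conf F E D"
proof -
  obtain f' f \<delta> where T: "(D, f', B, f, A, \<delta>) \<in> \<xi>" using assms(1) unfolding conf_def by blast
  obtain g' g \<delta>' where T': "(F, g', C, g, B, \<delta>') \<in> \<xi>" using assms(2) unfolding conf_def by blast
  obtain E h' d e \<delta>'' where 1: "(E, h', C, f \<cdot> g, A, \<delta>'') \<in> E_triangles \<C>"
    and 2: "(F, e, E, d, D, pull \<C> F f' \<delta>') \<in> E_triangles \<C>"
    using ET4_op[OF xi_E[OF T] xi_E[OF T']] by blast
  note D = xiD[OF T] and D' = xiD[OF T'] and D1 = triangleD[OF 1]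
  have "(E, h', C, f \<cdot> g, A, \<delta>'') \<in> \<xi>"
    unfolding xi_iff[OF 1]
  proof (intro ballI allI impI)
    fix P p assume P: "P \<in> Proj" and p: "<<p : P -> A>>"
    obtain q where q: "<<q : P -> B>>" "f \<cdot> q = p" using proj_lift[OF P T p] .
    obtain r where r: "<<r : P -> C>>" "g \<cdot> r = q" using proj_lift[OF P T' q(1)] .
    have "p = (f \<cdot> g) \<cdot> r" using comp_assoc[OF r(1) D'(2) D(2)] q r by simp
    then show "pull \<C> E p \<delta>'' = \<zero>\<E>\<^bsub>P,E\<^esub>"
      using pull_comp[OF D1(4,2) r(1) D1(3)] pull_deflation[OF 1] pull_zero[OF D1(4) r(1)] by simp
  qed
  then show ?thesis using that xi_base_change[OF T' D(1) 2] confI by blast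
qed

text \<open>Both pullback squares come from one extension \<open>\<mu>\<close> by the biproduct of the kernels, whose
  components are the given extensions: dividing out either summand of the kernel leaves
  the other extension.\<close>

lemma conf_pullback:
  assumes "conf A1 B1 C" "conf A2 B2 C"
  obtains M where "conf A1 M B2" "conf A2 M B1"
proof -
  obtain x y \<delta> where T: "(A1, x, B1, y, C, \<delta>) \<in> \<xi>" using assms(1) unfolding conf_def by blast
  obtain x' y' \<delta>' where T': "(A2, x', B2, y', C, \<delta>') \<in> \<xi>" using assms(2) unfolding conf_def by blast
  note D = xiD[OF T] and D' = xiD[OF T']
  obtain S i j p q where S: "is_biproduct \<C> A1 A2 S i j p q" using has_biproducts[OF D(4) D'(4)] by blast
  have a: "<<i : A1 -> S>>" "<<j : A2 -> S>>" "<<p : S -> A1>>" "<<q : S -> A2>>"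
    "p \<cdot> i = Ident \<C> A1" "q \<cdot> j = Ident \<C> A2" "p \<cdot> j = \<zero>\<^bsub>A2,A1\<^esub>" "q \<cdot> i = \<zero>\<^bsub>A1,A2\<^esub>"
    using S by (auto simp: is_biproduct_def)
  have SO: "S \<in> Obj \<C>" using a arr_objD by blast
  interpret X: comm_group "Ext \<C> C S" using ext_group D SO by blast
  interpret X1: comm_group "Ext \<C> C A1" using ext_group D by blast
  interpret X2: comm_group "Ext \<C> C A2" using ext_group D' by blast
  have idC: "<<Ident \<C> C : C -> C>>" using ident_closed D by blast
  define \<mu> where "\<mu> = push \<C> C i \<delta> \<otimes>\<^bsub>Ext \<C> C S\<^esub> push \<C> C j \<delta>'"
  have c: "push \<C> C i \<delta> \<in> carrier (Ext \<C> C S)" "push \<C> C j \<delta>' \<in> carrier (Ext \<C> C S)"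
    using push_closed[OF D(6) a(1) D(3)] push_closed[OF D(6) a(2) D'(3)] .
  then have mu: "\<mu> \<in> carrier (Ext \<C> C S)" unfolding \<mu>_def by simp
  interpret hp: group_hom "Ext \<C> C S" "Ext \<C> C A1" "push \<C> C p"
    unfolding push_def by (rule ext_map_group_hom[OF idC a(3)])
  interpret hq: group_hom "Ext \<C> C S" "Ext \<C> C A2" "push \<C> C q"
    unfolding push_def by (rule ext_map_group_hom[OF idC a(4)])
  have pm: "push \<C> C p \<mu> = \<delta>"
    using c push_comp[OF D(6) a(1,3) D(3)] push_comp[OF D(6) a(2,3) D'(3)] a
      push_ident[OF D(6,4,3)] push_zero_mor[OF D(6) D'(4) D(4) D'(3)] D by (simp add: \<mu>_def)
  have qm: "push \<C> C q \<mu> = \<delta>'"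
    using c push_comp[OF D(6) a(1,4) D(3)] push_comp[OF D(6) a(2,4) D'(3)] a
      push_ident[OF D'(6,4,3)] push_zero_mor[OF D(6) D(4) D'(4) D(3)] D' by (simp add: \<mu>_def)
  obtain u M v where M: "(S, u, M, v, C, \<mu>) \<in> E_triangles \<C>" using realiz_exists[OF D(6) SO mu] .
  have Mxi: "(S, u, M, v, C, \<mu>) \<in> \<xi>"
    unfolding xi_iff[OF M]
  proof (intro ballI allI impI)
    fix P r assume P: "P \<in> Proj" and r: "<<r : P -> C>>"
    interpret h: group_hom "Ext \<C> C S" "Ext \<C> P S" "pull \<C> S r"
      unfolding pull_def by (rule ext_map_group_hom[OF r ident_closed[OF SO]])
    have "pull \<C> S r (push \<C> C i \<delta>) = push \<C> P i (pull \<C> A1 r \<delta>)"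
         "pull \<C> S r (push \<C> C j \<delta>') = push \<C> P j (pull \<C> A2 r \<delta>')"
      using push_pull[OF r a(1) D(3)] push_pull[OF r a(2) D'(3)] by simp_all
    then show "pull \<C> S r \<mu> = \<zero>\<E>\<^bsub>P,S\<^esub>"
      using c xi_pull_to_proj[OF T P r] xi_pull_to_proj[OF T' P r] push_zero[OF proj_Obj[OF P]] a
      by (simp add: \<mu>_def)
  qed
  have one: "conf A1' M B2'"
    if b: "is_biproduct \<C> A1' A2' S i j p q" and T2: "(A2', x', B2', y', C, \<delta>') \<in> \<xi>" and qm: "push \<C> C q \<mu> = \<delta>'"
    for A1' A2' B2' i j p q x' y' \<delta>'
  proof -
    have T1: "(A1', i, S, q, A2', \<zero>\<E>\<^bsub>A2',A1'\<^esub>) \<in> E_triangles \<C>" using realiz_zero[OF b] .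
    obtain E h' d e \<delta>'' where 1: "(A1', u \<cdot> i, M, h', E, \<delta>'') \<in> E_triangles \<C>"
      and 2: "(A2', d, E, e, C, push \<C> C q \<mu>) \<in> E_triangles \<C>"
      and 3: "pull \<C> A1' d \<delta>'' = \<zero>\<E>\<^bsub>A2',A1'\<^esub>" "push \<C> E i \<delta>'' = pull \<C> S e \<mu>"
      using ET4[OF T1 M] by blast
    have "(A1', u \<cdot> i, M, h', E, \<delta>'') \<in> \<xi>"
      unfolding xi_iff[OF 1]
    proof (intro ballI allI impI)
      fix P r assume P: "P \<in> Proj" and r: "<<r : P -> E>>"
      have e: "<<e : E -> C>>" using triangleD[OF 2] by blast
      have i: "<<i : A1' -> S>>" "<<p : S -> A1'>>" "p \<cdot> i = Ident \<C> A1'" using b by (auto simp: is_biproduct_def)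
      note d1 = triangleD[OF 1]
      have pr: "pull \<C> A1' r \<delta>'' \<in> carrier (Ext \<C> P A1')" using pull_closed[OF d1(4) r d1(3)] .
      have "push \<C> P i (pull \<C> A1' r \<delta>'') = pull \<C> S (e \<cdot> r) \<mu>"
        using push_pull[OF r i(1) d1(3)] 3(2) pull_comp[OF SO e r mu] by simp
      also have "\<dots> = \<zero>\<E>\<^bsub>P,S\<^esub>" using xi_pull_to_proj[OF Mxi P comp_closed[OF r e]] .
      finally show "pull \<C> A1' r \<delta>'' = \<zero>\<E>\<^bsub>P,A1'\<^esub>"
        using push_comp[OF proj_Obj[OF P] i(1,2) pr] i(3) push_ident[OF proj_Obj[OF P] d1(4) pr]
          push_zero[OF proj_Obj[OF P] i(2)] by simp
    qed
    then have "conf A1' M E" by (rule confI)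
    moreover obtain b where "is_iso \<C> b E B2'" using realiz_unique[OF 2] xi_E[OF T2] qm by metis
    ultimately show ?thesis using conf_iso_ends is_iso_ident triangleD(4)[OF 1] by blast
  qed
  show ?thesis using that one[OF S T' qm] one[OF biproduct_swap[OF S] T pm] by blast
qed

text \<open>Dual to the preceding lemma: one extension of the biproduct of the cokernels, restricted to
  either summand.\<close>

lemma conf_pushout:
  assumes "conf A B1 C1" "conf A B2 C2"
  obtains M where "conf B2 M C1" "conf B1 M C2"
proof -
  obtain x y \<delta> where T: "(A, x, B1, y, C1, \<delta>) \<in> \<xi>" using assms(1) unfolding conf_def by blast
  obtain x' y' \<delta>' where T': "(A, x', B2, y', C2, \<delta>') \<in> \<xi>" using assms(2) unfolding conf_def by blast
  note D = xiD[OF T] and D' = xiD[OF T']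
  obtain S i j p q where S: "is_biproduct \<C> C1 C2 S i j p q" using has_biproducts[OF D(6) D'(6)] by blast
  have a: "<<i : C1 -> S>>" "<<j : C2 -> S>>" "<<p : S -> C1>>" "<<q : S -> C2>>"
    "p \<cdot> i = Ident \<C> C1" "q \<cdot> j = Ident \<C> C2" "p \<cdot> j = \<zero>\<^bsub>C2,C1\<^esub>" "q \<cdot> i = \<zero>\<^bsub>C1,C2\<^esub>"
    using S by (auto simp: is_biproduct_def)
  have SO: "S \<in> Obj \<C>" using a arr_objD by blast
  interpret X: comm_group "Ext \<C> S A" using ext_group D SO by blast
  interpret X1: comm_group "Ext \<C> C1 A" using ext_group D by blast
  interpret X2: comm_group "Ext \<C> C2 A" using ext_group D' by blast
  have idA: "<<Ident \<C> A : A -> A>>" using ident_closed D by blast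
  define \<mu> where "\<mu> = pull \<C> A p \<delta> \<otimes>\<^bsub>Ext \<C> S A\<^esub> pull \<C> A q \<delta>'"
  have c: "pull \<C> A p \<delta> \<in> carrier (Ext \<C> S A)" "pull \<C> A q \<delta>' \<in> carrier (Ext \<C> S A)"
    using pull_closed[OF D(4) a(3) D(3)] pull_closed[OF D(4) a(4) D'(3)] .
  then have mu: "\<mu> \<in> carrier (Ext \<C> S A)" unfolding \<mu>_def by simp
  interpret hi: group_hom "Ext \<C> S A" "Ext \<C> C1 A" "pull \<C> A i"
    unfolding pull_def by (rule ext_map_group_hom[OF a(1) idA])
  interpret hj: group_hom "Ext \<C> S A" "Ext \<C> C2 A" "pull \<C> A j"
    unfolding pull_def by (rule ext_map_group_hom[OF a(2) idA])
  have im: "pull \<C> A i \<mu> = \<delta>"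
    using c pull_comp[OF D(4) a(3,1) D(3)] pull_comp[OF D(4) a(4,1) D'(3)] a
      pull_ident[OF D(6,4,3)] pull_zero_mor[OF D'(6) D(6) D(4) D'(3)] D by (simp add: \<mu>_def)
  have jm: "pull \<C> A j \<mu> = \<delta>'"
    using c pull_comp[OF D(4) a(3,2) D(3)] pull_comp[OF D(4) a(4,2) D'(3)] a
      pull_ident[OF D'(6,4,3)] pull_zero_mor[OF D(6) D'(6) D(4) D(3)] D' by (simp add: \<mu>_def)
  obtain u M v where M: "(A, u, M, v, S, \<mu>) \<in> E_triangles \<C>" using realiz_exists[OF SO D(4) mu] .
  have Mxi: "(A, u, M, v, S, \<mu>) \<in> \<xi>"
    unfolding xi_iff[OF M]
  proof (intro ballI allI impI)
    fix P r assume P: "P \<in> Proj" and r: "<<r : P -> S>>"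
    interpret h: group_hom "Ext \<C> S A" "Ext \<C> P A" "pull \<C> A r"
      unfolding pull_def by (rule ext_map_group_hom[OF r idA])
    show "pull \<C> A r \<mu> = \<zero>\<E>\<^bsub>P,A\<^esub>"
      using c xi_pull_to_proj[OF T P comp_closed[OF r a(3)]] xi_pull_to_proj[OF T' P comp_closed[OF r a(4)]]
        pull_comp[OF D(4) a(3) r D(3)] pull_comp[OF D(4) a(4) r D'(3)]
      by (simp add: \<mu>_def)
  qed
  have one: "conf B2' M C1'"
    if b: "is_biproduct \<C> C1' C2' S i j p q" and T2: "(A, x', B2', y', C2', \<delta>') \<in> \<xi>" and jm: "pull \<C> A j \<mu> = \<delta>'"
    for C1' C2' B2' i j p q x' y' \<delta>'
  proof -
    have "(C2', j, S, p, C1', \<zero>\<E>\<^bsub>C1',C2'\<^esub>) \<in> E_triangles \<C>" using realiz_zero[OF biproduct_swap[OF b]] .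
    note T1 = xi_split[OF this]
    obtain E h' d e \<delta>'' where 1: "(E, h', M, p \<cdot> v, C1', \<delta>'') \<in> E_triangles \<C>"
      and 2: "(A, e, E, d, C2', pull \<C> A j \<mu>) \<in> E_triangles \<C>"
      using ET4_op[OF xi_E[OF T1] M] by blast
    have "(E, h', M, p \<cdot> v, C1', \<delta>'') \<in> \<xi>"
      unfolding xi_iff[OF 1]
    proof (intro ballI allI impI)
      fix P r assume P: "P \<in> Proj" and r: "<<r : P -> C1'>>"
      note d1 = triangleD[OF 1]
      obtain s where s: "<<s : P -> S>>" "p \<cdot> s = r" using proj_lift[OF P T1 r] .
      obtain t where t: "<<t : P -> M>>" "v \<cdot> t = s" using proj_lift[OF P Mxi s(1)] .
      have "r = (p \<cdot> v) \<cdot> t" using comp_assoc[OF t(1) xiD(2)[OF Mxi] xiD(2)[OF T1]] s t by simp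
      then show "pull \<C> E r \<delta>'' = \<zero>\<E>\<^bsub>P,E\<^esub>"
        using pull_comp[OF d1(4,2) t(1) d1(3)] pull_deflation[OF 1] pull_zero[OF d1(4) t(1)] by simp
    qed
    then have "conf E M C1'" by (rule confI)
    moreover obtain b where "is_iso \<C> b E B2'" using realiz_unique[OF 2] xi_E[OF T2] jm by metis
    ultimately show ?thesis using conf_iso_ends is_iso_ident triangleD(6)[OF 1] by blast
  qed
  show ?thesis using that one[OF S T' jm] one[OF biproduct_swap[OF S] T im] by blast
qed

lemma conf_proj_end_biproduct:
  assumes "conf A B P" "P \<in> Proj"
  obtains i j p q where "is_biproduct \<C> A P B i j p q"
proof -
  obtain x y \<delta> where T: "(A, x, B, y, P, \<delta>) \<in> \<xi>" using assms(1) unfolding conf_def by blast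
  then have "(A, x, B, y, P, \<zero>\<E>\<^bsub>P,A\<^esub>) \<in> E_triangles \<C>" using xi_proj_end_splits[OF T assms(2)] xi_E by metis
  then show ?thesis using split_triangle_biproduct that by metis
qed

lemma conf_proj_end_swap:
  assumes "conf A B P" "P \<in> Proj" shows "conf P B A"
  using conf_proj_end_biproduct[OF assms] confI[OF xi_split[OF realiz_zero[OF biproduct_swap]]] by metis

lemma proj_extension:
  assumes "conf P S Q" "P \<in> Proj" "Q \<in> Proj" shows "S \<in> Proj"
  using conf_proj_end_biproduct[OF assms(1,3)] proj_biproduct[OF assms(2,3)] by metis

lemma proj_cocone:
  assumes "conf Q S P" "S \<in> Proj" "P \<in> Proj" shows "Q \<in> Proj"
proof -
  obtain i j p q where "is_biproduct \<C> Q P S i j p q" using conf_proj_end_biproduct[OF assms(1,3)] .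
  then show ?thesis using proj_retract[OF assms(2), of i Q p] by (simp add: is_biproduct_def)
qed

lemma zero_object_proj:
  assumes "zero_object \<C> Z" shows "Z \<in> Proj"
proof (rule projI)
  show Z: "Z \<in> Obj \<C>" using zero_object_id[OF assms] by blast
  fix A x B y C \<delta> assume T: "(A, x, B, y, C, \<delta>) \<in> \<xi>"
  note D = xiD[OF T]
  show "\<exists>b. <<b : Z -> B>> \<and> y \<cdot> b = c" if "<<c : Z -> C>>" for c
    using zero_arr[OF Z D(5)] comp_zero_right[OF D(2) Z] arr_from_zero[OF assms that] by auto
  show "a = \<zero>\<^bsub>Z,A\<^esub>" if "<<a : Z -> A>>" for a using arr_from_zero[OF assms that] .
qed

end


section \<open>Gorenstein objects of a quasi-resolving subcategory\<close>

locale quasi_resolving_category = enough_xi_category +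
  fixes \<X> assumes quasi_resolving: "quasi_resolving \<C> \<xi> \<X>"
begin

abbreviation "\<P> \<equiv> proj_in \<C> \<xi> \<X>"
abbreviation "\<G> \<equiv> GQP \<C> \<xi> \<X>"

lemma X_Obj: "X \<in> \<X> \<Longrightarrow> X \<in> Obj \<C>"
  using quasi_resolving unfolding quasi_resolving_def additive_subcategory_def by blast

lemma zero_object_X: "zero_object \<C> Z \<Longrightarrow> Z \<in> \<X>"
  using quasi_resolving unfolding quasi_resolving_def additive_subcategory_def by blast

lemma X_extension: "conf A B C \<Longrightarrow> A \<in> \<X> \<Longrightarrow> C \<in> \<X> \<Longrightarrow> B \<in> \<X>"
  using quasi_resolving unfolding quasi_resolving_def conf_def by blast

lemma X_cocone: "conf A B C \<Longrightarrow> B \<in> \<X> \<Longrightarrow> C \<in> \<X> \<Longrightarrow> A \<in> \<X>"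
  using quasi_resolving unfolding quasi_resolving_def conf_def by blast

lemma P_iff: "P \<in> \<P> \<longleftrightarrow> P \<in> \<X> \<and> P \<in> Proj"
  by (simp add: proj_in_def)

lemma P_Obj: "P \<in> \<P> \<Longrightarrow> P \<in> Obj \<C>"
  using P_iff proj_Obj by blast

lemma zero_object_P: "zero_object \<C> Z \<Longrightarrow> Z \<in> \<P>"
  using zero_object_X zero_object_proj P_iff by blast

lemma P_extension: "conf P S Q \<Longrightarrow> P \<in> \<P> \<Longrightarrow> Q \<in> \<P> \<Longrightarrow> S \<in> \<P>"
  using proj_extension X_extension P_iff by blast

lemma P_cocone: "conf Q S P \<Longrightarrow> S \<in> \<P> \<Longrightarrow> P \<in> \<P> \<Longrightarrow> Q \<in> \<P>"
  using proj_cocone X_cocone P_iff by blast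


subsection \<open>Objects orthogonal to the subcategory\<close>

text \<open>The intrinsic form of the condition that triangles ending in \<open>C\<close> are \<open>Hom(-, \<X>)\<close>-exact: the
  extensions of \<open>C\<close> by \<open>X\<close> in \<open>\<xi>\<close> split, so that maps to \<open>X\<close> extend, and the maps \<open>C \<rightarrow> X\<close> that vanish on all projectives
  (phantom maps) are zero, so that \<open>Hom(C, X) \<rightarrow> Hom(B, X)\<close> is injective.\<close>

definition clean where
  "clean C \<longleftrightarrow> C \<in> Obj \<C> \<and> (\<forall>X\<in>\<X>.
     (\<forall>x B y \<delta>. (X, x, B, y, C, \<delta>) \<in> \<xi> \<longrightarrow> \<delta> = \<zero>\<E>\<^bsub>C,X\<^esub>) \<and>
     (\<forall>f. <<f : C -> X>> \<longrightarrow> (\<forall>P\<in>Proj. \<forall>p. <<p : P -> C>> \<longrightarrow> f \<cdot> p = \<zero>\<^bsub>P,X\<^esub>) \<longrightarrow> f = \<zero>\<^bsub>C,X\<^esub>))"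

lemma clean_ext:
  assumes "clean C" "X \<in> \<X>" "\<epsilon> \<in> carrier (Ext \<C> C X)"
    and "\<And>P p. P \<in> Proj \<Longrightarrow> <<p : P -> C>> \<Longrightarrow> pull \<C> X p \<epsilon> = \<zero>\<E>\<^bsub>P,X\<^esub>"
  shows "\<epsilon> = \<zero>\<E>\<^bsub>C,X\<^esub>"
proof -
  have C: "C \<in> Obj \<C>" using assms(1) by (simp add: clean_def)
  obtain x B y where T: "(X, x, B, y, C, \<epsilon>) \<in> E_triangles \<C>"
    using realiz_exists[OF C X_Obj[OF assms(2)] assms(3)] .
  then have "(X, x, B, y, C, \<epsilon>) \<in> \<xi>" using xi_iff assms(4) by blast
  then show ?thesis using assms(1,2) unfolding clean_def by blast
qed

lemma clean_phantom:
  assumes "clean C" "X \<in> \<X>" "<<f : C -> X>>"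
    and "\<And>P p. P \<in> Proj \<Longrightarrow> <<p : P -> C>> \<Longrightarrow> f \<cdot> p = \<zero>\<^bsub>P,X\<^esub>"
  shows "f = \<zero>\<^bsub>C,X\<^esub>"
  using assms unfolding clean_def by blast

lemma cleanI:
  assumes "C \<in> Obj \<C>"
    and "\<And>X \<epsilon>. X \<in> \<X> \<Longrightarrow> \<epsilon> \<in> carrier (Ext \<C> C X) \<Longrightarrow>
      (\<And>P p. P \<in> Proj \<Longrightarrow> <<p : P -> C>> \<Longrightarrow> pull \<C> X p \<epsilon> = \<zero>\<E>\<^bsub>P,X\<^esub>) \<Longrightarrow> \<epsilon> = \<zero>\<E>\<^bsub>C,X\<^esub>"
    and "\<And>X f. X \<in> \<X> \<Longrightarrow> <<f : C -> X>> \<Longrightarrow>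
      (\<And>P p. P \<in> Proj \<Longrightarrow> <<p : P -> C>> \<Longrightarrow> f \<cdot> p = \<zero>\<^bsub>P,X\<^esub>) \<Longrightarrow> f = \<zero>\<^bsub>C,X\<^esub>"
  shows "clean C"
  unfolding clean_def
proof (intro conjI ballI allI impI)
  fix X x B y \<delta> assume "X \<in> \<X>" "(X, x, B, y, C, \<delta>) \<in> \<xi>"
  then show "\<delta> = \<zero>\<E>\<^bsub>C,X\<^esub>" using assms(2) xiD(3) xi_pull_to_proj by blast
next
  fix X f assume "X \<in> \<X>" "<<f : C -> X>>" "\<forall>P\<in>Proj. \<forall>p. <<p : P -> C>> \<longrightarrow> f \<cdot> p = \<zero>\<^bsub>P,X\<^esub>"
  then show "f = \<zero>\<^bsub>C,X\<^esub>" using assms(3) by blast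
qed (rule assms(1))

lemma hom_exact_triangle_iff:
  assumes T: "(A, x, B, y, C, \<delta>) \<in> \<xi>"
  shows "(A, x, B, y, C, \<delta>) \<in> hom_exact_triangles \<C> \<xi> \<X> \<longleftrightarrow>
    (\<forall>X\<in>\<X>. (\<forall>h. <<h : C -> X>> \<longrightarrow> h \<cdot> y = \<zero>\<^bsub>B,X\<^esub> \<longrightarrow> h = \<zero>\<^bsub>C,X\<^esub>) \<and>
      (\<forall>a. <<a : A -> X>> \<longrightarrow> (\<exists>b. <<b : B -> X>> \<and> b \<cdot> x = a)))"
  using T triangle_contravariant_short_exact_iff[OF xi_E[OF T] X_Obj]
  unfolding hom_exact_triangles_def by simp

lemma clean_imp_hom_exact:
  assumes T: "(A, x, B, y, C, \<delta>) \<in> \<xi>" and C: "clean C"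
  shows "(A, x, B, y, C, \<delta>) \<in> hom_exact_triangles \<C> \<xi> \<X>"
  unfolding hom_exact_triangle_iff[OF T]
proof (intro ballI conjI allI impI)
  note D = xiD[OF T]
  fix X assume X: "X \<in> \<X>"
  {
    fix h assume h: "<<h : C -> X>>" "h \<cdot> y = \<zero>\<^bsub>B,X\<^esub>"
    show "h = \<zero>\<^bsub>C,X\<^esub>"
    proof (rule clean_phantom[OF C X h(1)])
      fix P p assume P: "P \<in> Proj" and p: "<<p : P -> C>>"
      obtain b where b: "<<b : P -> B>>" "y \<cdot> b = p" using proj_lift[OF P T p] .
      show "h \<cdot> p = \<zero>\<^bsub>P,X\<^esub>"
        using comp_assoc[OF b(1) D(2) h(1)] b(2) h(2) comp_zero_left[OF b(1) X_Obj[OF X]] by simp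
    qed
  next
    fix a assume a: "<<a : A -> X>>"
    have "push \<C> C a \<delta> = \<zero>\<E>\<^bsub>C,X\<^esub>"
    proof (rule clean_ext[OF C X push_closed[OF D(6) a D(3)]])
      fix P p assume P: "P \<in> Proj" and p: "<<p : P -> C>>"
      show "pull \<C> X p (push \<C> C a \<delta>) = \<zero>\<E>\<^bsub>P,X\<^esub>"
        using push_pull[OF p a D(3)] xi_pull_to_proj[OF T P p] push_zero[OF proj_Obj[OF P] a] by simp
    qed
    then show "\<exists>b. <<b : B -> X>> \<and> b \<cdot> x = a" using push_eq_zero_factors[OF xi_E[OF T] a] by blast
  }
qed

text \<open>A single exact triangle with projective middle term suffices, since every extension of \<open>C\<close> is a
  pushout of it and every phantom vanishes on it.\<close>

lemma hom_exact_imp_clean: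
  assumes "(K, g, P, f, C, \<delta>) \<in> hom_exact_triangles \<C> \<xi> \<X>" and P: "P \<in> Proj"
  shows "clean C"
proof (rule cleanI)
  have T: "(K, g, P, f, C, \<delta>) \<in> \<xi>" using assms(1) unfolding hom_exact_triangles_def by simp
  note D = xiD[OF T]
  show "C \<in> Obj \<C>" using D by blast
  fix X assume X: "X \<in> \<X>"
  have mono: "h = \<zero>\<^bsub>C,X\<^esub>" if "<<h : C -> X>>" "h \<cdot> f = \<zero>\<^bsub>P,X\<^esub>" for h
    using assms(1) that X unfolding hom_exact_triangle_iff[OF T] by blast
  have ext: "\<exists>b. <<b : P -> X>> \<and> b \<cdot> g = a" if "<<a : K -> X>>" for a
    using assms(1) that X unfolding hom_exact_triangle_iff[OF T] by blast
  {
    fix \<epsilon> assume e: "\<epsilon> \<in> carrier (Ext \<C> C X)"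
      and v: "\<And>P p. P \<in> Proj \<Longrightarrow> <<p : P -> C>> \<Longrightarrow> pull \<C> X p \<epsilon> = \<zero>\<E>\<^bsub>P,X\<^esub>"
    obtain a where a: "<<a : K -> X>>" "push \<C> C a \<delta> = \<epsilon>"
      using ext_exact_left[OF xi_E[OF T] X_Obj[OF X] e v[OF P D(2)]] .
    obtain b where b: "<<b : P -> X>>" "b \<cdot> g = a" using ext[OF a(1)] by blast
    show "\<epsilon> = \<zero>\<E>\<^bsub>C,X\<^esub>"
      using push_comp[OF D(6,1) b(1) D(3)] push_inflation[OF xi_E[OF T]] push_zero[OF D(6) b(1)] a b by simp
  next
    fix h assume h: "<<h : C -> X>>"
      and v: "\<And>P p. P \<in> Proj \<Longrightarrow> <<p : P -> C>> \<Longrightarrow> h \<cdot> p = \<zero>\<^bsub>P,X\<^esub>"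
    show "h = \<zero>\<^bsub>C,X\<^esub>" using mono[OF h v[OF P D(2)]] .
  }
qed

lemma proj_clean:
  assumes "P \<in> Proj" shows "clean P"
proof (rule cleanI)
  show P: "P \<in> Obj \<C>" using proj_Obj[OF assms] .
  note i = ident_closed[OF P]
  show "\<epsilon> = \<zero>\<E>\<^bsub>P,X\<^esub>"
    if "X \<in> \<X>" "\<epsilon> \<in> carrier (Ext \<C> P X)"
      "\<And>Q p. Q \<in> Proj \<Longrightarrow> <<p : Q -> P>> \<Longrightarrow> pull \<C> X p \<epsilon> = \<zero>\<E>\<^bsub>Q,X\<^esub>" for X \<epsilon>
    using that(3)[OF assms i] pull_ident[OF P X_Obj[OF that(1)] that(2)] by simp
  show "f = \<zero>\<^bsub>P,X\<^esub>"
    if "X \<in> \<X>" "<<f : P -> X>>"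
      "\<And>Q p. Q \<in> Proj \<Longrightarrow> <<p : Q -> P>> \<Longrightarrow> f \<cdot> p = \<zero>\<^bsub>Q,X\<^esub>" for X f
    using that(3)[OF assms i] comp_ident_right[OF that(2)] by simp
qed

lemma clean_retract:
  assumes Z: "clean Z" and s: "<<s : A -> Z>>" and r: "<<r : Z -> A>>" and rs: "r \<cdot> s = Ident \<C> A"
  shows "clean A"
proof (rule cleanI)
  show A: "A \<in> Obj \<C>" using s arr_objD by blast
  fix X assume X: "X \<in> \<X>"
  note XO = X_Obj[OF X]
  {
    fix \<epsilon> assume e: "\<epsilon> \<in> carrier (Ext \<C> A X)"
      and v: "\<And>P p. P \<in> Proj \<Longrightarrow> <<p : P -> A>> \<Longrightarrow> pull \<C> X p \<epsilon> = \<zero>\<E>\<^bsub>P,X\<^esub>"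
    have "pull \<C> X r \<epsilon> = \<zero>\<E>\<^bsub>Z,X\<^esub>"
    proof (rule clean_ext[OF Z X pull_closed[OF XO r e]])
      fix P p assume P: "P \<in> Proj" and p: "<<p : P -> Z>>"
      show "pull \<C> X p (pull \<C> X r \<epsilon>) = \<zero>\<E>\<^bsub>P,X\<^esub>"
        using pull_comp[OF XO r p e] v[OF P comp_closed[OF p r]] by simp
    qed
    then show "\<epsilon> = \<zero>\<E>\<^bsub>A,X\<^esub>"
      using pull_comp[OF XO r s e] rs pull_ident[OF A XO e] pull_zero[OF XO s] by simp
  next
    fix h assume h: "<<h : A -> X>>"
      and v: "\<And>P p. P \<in> Proj \<Longrightarrow> <<p : P -> A>> \<Longrightarrow> h \<cdot> p = \<zero>\<^bsub>P,X\<^esub>"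
    have "h \<cdot> r = \<zero>\<^bsub>Z,X\<^esub>"
    proof (rule clean_phantom[OF Z X comp_closed[OF r h]])
      fix P p assume P: "P \<in> Proj" and p: "<<p : P -> Z>>"
      show "(h \<cdot> r) \<cdot> p = \<zero>\<^bsub>P,X\<^esub>" using comp_assoc[OF p r h] v[OF P comp_closed[OF p r]] by simp
    qed
    then show "h = \<zero>\<^bsub>A,X\<^esub>"
      using comp_assoc[OF s r h] rs comp_ident_right[OF h] comp_zero_left[OF s XO] by simp
  }
qed

text \<open>An extension of \<open>B\<close> that splits over \<open>A\<close> comes from \<open>C\<close>, and so does a map that vanishes on \<open>A\<close>; both are
  again invisible to projectives, since maps from projectives lift along \<open>B \<rightarrow> C\<close>.\<close>

lemma clean_extension:
  assumes "conf A B C" and A: "clean A" and C: "clean C"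
  shows "clean B"
proof (rule cleanI)
  obtain x y \<delta> where T: "(A, x, B, y, C, \<delta>) \<in> \<xi>" using assms(1) unfolding conf_def by blast
  note D = xiD[OF T]
  show "B \<in> Obj \<C>" using D by blast
  fix X assume X: "X \<in> \<X>"
  note XO = X_Obj[OF X]
  {
    fix \<epsilon> assume e: "\<epsilon> \<in> carrier (Ext \<C> B X)"
      and v: "\<And>P p. P \<in> Proj \<Longrightarrow> <<p : P -> B>> \<Longrightarrow> pull \<C> X p \<epsilon> = \<zero>\<E>\<^bsub>P,X\<^esub>"
    have "pull \<C> X x \<epsilon> = \<zero>\<E>\<^bsub>A,X\<^esub>"
    proof (rule clean_ext[OF A X pull_closed[OF XO D(1) e]])
      fix P p assume P: "P \<in> Proj" and p: "<<p : P -> A>>"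
      show "pull \<C> X p (pull \<C> X x \<epsilon>) = \<zero>\<E>\<^bsub>P,X\<^esub>"
        using pull_comp[OF XO D(1) p e] v[OF P comp_closed[OF p D(1)]] by simp
    qed
    then obtain \<theta> where t: "\<theta> \<in> carrier (Ext \<C> C X)" "pull \<C> X y \<theta> = \<epsilon>"
      using ext_exact_middle[OF xi_E[OF T] XO e] by blast
    have "\<theta> = \<zero>\<E>\<^bsub>C,X\<^esub>"
    proof (rule clean_ext[OF C X t(1)])
      fix P p assume P: "P \<in> Proj" and p: "<<p : P -> C>>"
      obtain b where b: "<<b : P -> B>>" "y \<cdot> b = p" using proj_lift[OF P T p] .
      show "pull \<C> X p \<theta> = \<zero>\<E>\<^bsub>P,X\<^esub>" using pull_comp[OF XO D(2) b(1) t(1)] b t v[OF P b(1)] by simp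
    qed
    then show "\<epsilon> = \<zero>\<E>\<^bsub>B,X\<^esub>" using t pull_zero[OF XO D(2)] by simp
  next
    fix h assume h: "<<h : B -> X>>"
      and v: "\<And>P p. P \<in> Proj \<Longrightarrow> <<p : P -> B>> \<Longrightarrow> h \<cdot> p = \<zero>\<^bsub>P,X\<^esub>"
    have "h \<cdot> x = \<zero>\<^bsub>A,X\<^esub>"
    proof (rule clean_phantom[OF A X comp_closed[OF D(1) h]])
      fix P p assume P: "P \<in> Proj" and p: "<<p : P -> A>>"
      show "(h \<cdot> x) \<cdot> p = \<zero>\<^bsub>P,X\<^esub>" using comp_assoc[OF p D(1) h] v[OF P comp_closed[OF p D(1)]] by simp
    qed
    then obtain k where k: "<<k : C -> X>>" "h = k \<cdot> y" using triangle_weak_cokernel[OF xi_E[OF T] h] by blast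
    have "k = \<zero>\<^bsub>C,X\<^esub>"
    proof (rule clean_phantom[OF C X k(1)])
      fix P p assume P: "P \<in> Proj" and p: "<<p : P -> C>>"
      obtain b where b: "<<b : P -> B>>" "y \<cdot> b = p" using proj_lift[OF P T p] .
      show "k \<cdot> p = \<zero>\<^bsub>P,X\<^esub>" using comp_assoc[OF b(1) D(2) k(1)] b k v[OF P b(1)] by simp
    qed
    then show "h = \<zero>\<^bsub>B,X\<^esub>" using k comp_zero_left[OF D(2) XO] by simp
  }
qed


subsection \<open>Coinductive description of the Gorenstein objects\<close>

lemma hom_exact_triangle_xi: "T \<in> hom_exact_triangles \<C> \<xi> \<X> \<Longrightarrow> T \<in> \<xi>"
  unfolding hom_exact_triangles_def by auto

lemma complete_resolution_G:
  assumes "complete_resolution \<C> \<xi> \<X> P d K g f \<delta>"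
  shows "K n \<in> \<G>"
  using assms unfolding GQP_def by blast

lemma G_unfold:
  assumes "G \<in> \<G>"
  obtains P K P' K' where "P \<in> \<P>" "K \<in> \<G>" "conf K P G" "P' \<in> \<P>" "K' \<in> \<G>" "conf G P' K'" "clean G"
proof -
  obtain P d K g f \<delta> n where c: "complete_resolution \<C> \<xi> \<X> P d K g f \<delta>" and G: "G = K n"
    using assms unfolding GQP_def by blast
  have T: "(K (m + 1), g m, P m, f m, K m, \<delta> m) \<in> hom_exact_triangles \<C> \<xi> \<X>" and P: "P m \<in> \<P>" for m
    using c unfolding complete_resolution_def by auto
  have "conf (K (m + 1)) (P m) (K m)" for m using confI[OF hom_exact_triangle_xi[OF T]] .
  then have "conf (K (n + 1)) (P n) G" "conf G (P (n - 1)) (K (n - 1))"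
    using G by (metis, metis diff_add_cancel)
  moreover have "clean G" using hom_exact_imp_clean[OF T[of n]] P G P_iff by simp
  ultimately show ?thesis using that P complete_resolution_G[OF c] by blast
qed

lemma G_Obj: "G \<in> \<G> \<Longrightarrow> G \<in> Obj \<C>"
  using G_unfold conf_Obj by metis

lemma G_clean: "G \<in> \<G> \<Longrightarrow> clean G"
  using G_unfold by metis

text \<open>The two kinds of steps, iterated from \<open>G\<close> to the left and to the right, are spliced into a complete
  resolution in which \<open>G\<close> has index \<open>0\<close>; orthogonality makes its triangles exact.\<close>

lemma G_coinduct:
  assumes W: "G \<in> W" and step: "\<And>G. G \<in> W \<Longrightarrow> clean G \<and> (\<exists>P\<in>\<P>. \<exists>K\<in>W. conf K P G) \<and> (\<exists>P\<in>\<P>. \<exists>K\<in>W. conf G P K)"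
  shows "G \<in> \<G>"
proof -
  obtain l where l: "\<And>G. G \<in> W \<Longrightarrow> l G \<in> W \<and> (\<exists>P\<in>\<P>. conf (l G) P G)" using step by metis
  obtain r where r: "\<And>G. G \<in> W \<Longrightarrow> r G \<in> W \<and> (\<exists>P\<in>\<P>. conf G P (r G))" using step by metis
  have lW: "(l ^^ i) G \<in> W" and rW: "(r ^^ i) G \<in> W" for i
    by (induction i) (use W l r in auto)
  define K where "K n = (if n \<ge> 0 then (l ^^ nat n) G else (r ^^ nat (- n)) G)" for n :: int
  have KW: "K n \<in> W" for n using lW rW by (simp add: K_def)
  have "\<exists>P\<in>\<P>. conf (K (n + 1)) P (K n)" for n
  proof (cases "n \<ge> 0")
    case True
    then have "K (n + 1) = l (K n)" by (simp add: K_def nat_add_distrib)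
    then show ?thesis using l KW by metis
  next
    case False
    then have e: "nat (- n) = Suc (nat (- (n + 1)))" by simp
    have "K n = r ((r ^^ nat (- (n + 1))) G)" using False by (simp add: K_def e del: minus_add_distrib)
    moreover have "K (n + 1) = (r ^^ nat (- (n + 1))) G"
    proof (cases "n + 1 = 0")
      case True then show ?thesis unfolding K_def by (simp only: True) simp
    next
      case neg: False then show ?thesis unfolding K_def using False by simp
    qed
    ultimately show ?thesis using r rW by metis
  qed
  then have "\<forall>n. \<exists>P g f \<delta>. P \<in> \<P> \<and> (K (n + 1), g, P, f, K n, \<delta>) \<in> \<xi>" unfolding conf_def by blast
  then obtain P g f \<delta> where T: "\<And>n. P n \<in> \<P> \<and> (K (n + 1), g n, P n, f n, K n, \<delta> n) \<in> \<xi>" by metis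
  have "(K (n + 1), g n, P n, f n, K n, \<delta> n) \<in> hom_exact_triangles \<C> \<xi> \<X>" for n
    using clean_imp_hom_exact T step KW by blast
  then have "complete_resolution \<C> \<xi> \<X> P (\<lambda>n. g (n - 1) \<cdot> f n) K g f \<delta>"
    unfolding complete_resolution_def using T by blast
  from complete_resolution_G[OF this, of 0] show ?thesis by (simp add: K_def)
qed

lemma P_subset_G: "P \<in> \<P> \<Longrightarrow> P \<in> \<G>"
proof (rule G_coinduct[of P \<P>])
  fix Q assume Q: "Q \<in> \<P>"
  show "clean Q \<and> (\<exists>P\<in>\<P>. \<exists>K\<in>\<P>. conf K P Q) \<and> (\<exists>P\<in>\<P>. \<exists>K\<in>\<P>. conf Q P K)"
    using Q proj_clean P_iff zero_object_P[OF zero_ob] conf_zero_left[OF zero_ob P_Obj[OF Q]]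
      conf_zero_right[OF zero_ob P_Obj[OF Q]] by blast
qed

text \<open>The counterpart of \<open>conf_proj_end_swap\<close> that makes the right half of the horseshoe work, where
  \<open>P\<close> is not injective.\<close>

lemma conf_clean_end_splits:
  assumes "conf P Z C" "P \<in> \<X>" "clean C"
  shows "conf C Z P"
proof -
  obtain x y \<delta> where T: "(P, x, Z, y, C, \<delta>) \<in> \<xi>" using assms(1) unfolding conf_def by blast
  then have "\<delta> = \<zero>\<E>\<^bsub>C,P\<^esub>" using assms unfolding clean_def by blast
  then show ?thesis using conf_split_swap xi_E[OF T] by blast
qed

text \<open>Both one-step horseshoes come from two pullbacks (pushouts) along split sequences; the
  middle term of the resulting resolution step is an extension of objects of \<open>\<P>\<close>.\<close>

lemma G_extension:
  assumes "conf A B C" "A \<in> \<G>" "C \<in> \<G>"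
  shows "B \<in> \<G>"
proof (rule G_coinduct)
  let ?W = "{B. \<exists>A\<in>\<G>. \<exists>C\<in>\<G>. conf A B C}"
  show "B \<in> ?W" using assms by blast
  fix B assume "B \<in> ?W"
  then obtain A C where A: "A \<in> \<G>" and C: "C \<in> \<G>" and c: "conf A B C" by blast
  obtain PA KA PA' KA' where A': "PA \<in> \<P>" "KA \<in> \<G>" "conf KA PA A" "PA' \<in> \<P>" "KA' \<in> \<G>" "conf A PA' KA'"
    using G_unfold[OF A] by metis
  obtain PC KC PC' KC' where C': "PC \<in> \<P>" "KC \<in> \<G>" "conf KC PC C" "PC' \<in> \<P>" "KC' \<in> \<G>" "conf C PC' KC'"
    using G_unfold[OF C] by metis
  have cl: "clean B" using clean_extension[OF c G_clean[OF A] G_clean[OF C]] .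
  obtain Z where Z: "conf A Z PC" "conf KC Z B" using conf_pullback[OF c C'(3)] .
  have "conf PC Z A" using conf_proj_end_swap[OF Z(1)] C' P_iff by blast
  then obtain Y where Y: "conf PC Y PA" "conf KA Y Z" using conf_pullback[OF _ A'(3)] by blast
  have YP: "Y \<in> \<P>" using P_extension[OF Y(1)] A' C' by blast
  obtain E where E: "conf E Y B" "conf KA E KC" using conf_compose_deflations[OF Z(2) Y(2)] .
  obtain Z' where Z': "conf PA' Z' C" "conf B Z' KA'" using conf_pushout[OF c A'(6)] .
  have "conf C Z' PA'" using conf_clean_end_splits[OF Z'(1)] A' G_clean[OF C] P_iff by blast
  then obtain Y' where Y': "conf PC' Y' PA'" "conf Z' Y' KC'" using conf_pushout[OF _ C'(6)] by blast
  have Y'P: "Y' \<in> \<P>" using P_extension[OF Y'(1)] A' C' by blast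
  obtain E' where E': "conf B Y' E'" "conf KA' E' KC'" using conf_compose_inflations[OF Z'(2) Y'(2)] .
  show "clean B \<and> (\<exists>P\<in>\<P>. \<exists>K\<in>?W. conf K P B) \<and> (\<exists>P\<in>\<P>. \<exists>K\<in>?W. conf B P K)"
    using cl YP E Y'P E' A' C' by blast
qed

text \<open>The right step of \<open>A\<close> is the composite \<open>A \<rightarrow> B \<rightarrow> PB\<close>.  For the left step, pull \<open>B\<close> back to a projective cover of \<open>C\<close>:
  the pullback \<open>Y\<close> is in \<open>\<G>\<close> and contains \<open>A\<close> as a direct summand with complement in \<open>\<P>\<close>, so the cover of \<open>Y\<close>
  restricts to a cover of \<open>A\<close>.\<close>

lemma G_cocone:
  assumes c: "conf A B C" and B: "B \<in> \<G>" and C: "C \<in> \<G>"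
  shows "A \<in> \<G>"
proof (rule G_coinduct)
  obtain PB KB where B': "PB \<in> \<P>" "KB \<in> \<G>" "conf B PB KB" using G_unfold[OF B] by metis
  obtain PC KC where C': "PC \<in> \<P>" "KC \<in> \<G>" "conf KC PC C" using G_unfold[OF C] by metis
  have PC: "PC \<in> Proj" using C' P_iff by blast
  obtain Z where Z: "conf A PB Z" "conf C Z KB" using conf_compose_inflations[OF c B'(3)] .
  have ZG: "Z \<in> \<G>" using G_extension[OF Z(2) C B'(2)] .
  obtain Y where Y: "conf A Y PC" "conf KC Y B" using conf_pullback[OF c C'(3)] .
  have YG: "Y \<in> \<G>" using G_extension[OF Y(2) C'(2) B] .
  obtain PY KY where Y': "PY \<in> \<P>" "KY \<in> \<G>" "conf KY PY Y" using G_unfold[OF YG] by metis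
  obtain Q where Q: "conf Q PY PC" "conf KY Q A" using conf_compose_deflations[OF Y(1) Y'(3)] .
  have QP: "Q \<in> \<P>" using P_cocone[OF Q(1)] Y' C' by blast
  obtain i j p q where "is_biproduct \<C> A PC Y i j p q" using conf_proj_end_biproduct[OF Y(1) PC] .
  then have cl: "clean A" using clean_retract[OF G_clean[OF YG], of i A p] by (simp add: is_biproduct_def)
  show "A \<in> insert A \<G>" by blast
  fix D assume "D \<in> insert A \<G>"
  then show "clean D \<and> (\<exists>P\<in>\<P>. \<exists>K\<in>insert A \<G>. conf K P D) \<and> (\<exists>P\<in>\<P>. \<exists>K\<in>insert A \<G>. conf D P K)"
  proof
    assume "D = A"
    then show ?thesis using cl QP Q Y' Z ZG B' by blast
  next
    assume "D \<in> \<G>"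
    then show ?thesis using G_unfold[of D] by (metis insertCI)
  qed
qed

lemma zero_object_G: "zero_object \<C> Z \<Longrightarrow> Z \<in> \<G>"
  using P_subset_G zero_object_P by blast

end

section \<open>Resolution dimension and approximations\<close>

lemma Inf_enat_le_iff: "Inf A \<le> enat n \<longleftrightarrow> (\<exists>k\<in>A. k \<le> enat n)"
proof
  assume "Inf A \<le> enat n"
  show "\<exists>k\<in>A. k \<le> enat n"
  proof (rule ccontr)
    assume "\<not> ?thesis"
    then have "\<And>k. k \<in> A \<Longrightarrow> eSuc (enat n) \<le> k" using ileI1 not_le by blast
    then have "eSuc (enat n) \<le> Inf A" by (rule Inf_greatest)
    then show False using \<open>Inf A \<le> enat n\<close> by (metis eSuc_enat enat_ord_simps(1) not_less_eq_eq order_refl order_trans)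
  qed
next
  assume "\<exists>k\<in>A. k \<le> enat n" then show "Inf A \<le> enat n" by (meson Inf_lower order_trans)
qed

context enough_xi_category
begin

text \<open>\<open>has_resolution n S M\<close>: there is a \<open>\<xi>\<close>-exact complex \<open>0 \<rightarrow> Y\<^sub>n \<rightarrow> \<dots> \<rightarrow> Y\<^sub>0 \<rightarrow> M \<rightarrow> 0\<close> with \<open>Y\<^sub>i\<close> in \<open>S i\<close>.
  Letting the class depend on the position covers all the mixed resolutions.\<close>

primrec has_resolution where
  "has_resolution 0 S M \<longleftrightarrow> M \<in> S 0"
| "has_resolution (Suc n) S M \<longleftrightarrow> (\<exists>K Y. conf K Y M \<and> Y \<in> S 0 \<and> has_resolution n (\<lambda>i. S (Suc i)) K)"

lemma bounded_xi_exact_iff_has_resolution: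
  assumes "\<And>i. S i \<subseteq> Obj \<C>"
  shows "(\<exists>Y d. bounded_xi_exact \<C> \<xi> n Y d M \<and> (\<forall>i\<le>n. Y i \<in> S i)) \<longleftrightarrow> has_resolution n S M"
  using assms
proof (induction n arbitrary: S M)
  case 0
  show ?case
  proof
    assume "\<exists>Y d. bounded_xi_exact \<C> \<xi> 0 Y d M \<and> (\<forall>i\<le>0. Y i \<in> S i)"
    then show "has_resolution 0 S M" unfolding bounded_xi_exact_def by auto
  next
    assume "has_resolution 0 S M"
    then have "M \<in> S 0" "M \<in> Obj \<C>" using 0 by auto
    then have "bounded_xi_exact \<C> \<xi> 0 (\<lambda>_. M) (\<lambda>_. Ident \<C> M) M \<and> (\<forall>i\<le>0. M \<in> S i)"
      unfolding bounded_xi_exact_def by auto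
    then show "\<exists>Y d. bounded_xi_exact \<C> \<xi> 0 Y d M \<and> (\<forall>i\<le>0. Y i \<in> S i)" by blast
  qed
next
  case (Suc n)
  note IH = Suc.IH[of "\<lambda>i. S (Suc i)", OF Suc.prems]
  show ?case
  proof
    assume "\<exists>Y d. bounded_xi_exact \<C> \<xi> (Suc n) Y d M \<and> (\<forall>i\<le>Suc n. Y i \<in> S i)"
    then obtain Y d K g f \<delta> where Y: "\<And>i. i \<le> Suc n \<Longrightarrow> Y i \<in> S i"
      and K: "K 0 = M" "K (Suc n) = Y (Suc n)" "f (Suc n) = Ident \<C> (Y (Suc n))"
        "\<And>i. i < Suc n \<Longrightarrow> (K (Suc i), g i, Y i, f i, K i, \<delta> i) \<in> \<xi>"
        "\<And>i. i < Suc n \<Longrightarrow> d (Suc i) = g i \<cdot> f (Suc i)"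
      unfolding bounded_xi_exact_def by blast
    have c: "conf (K 1) (Y 0) M" using confI[OF K(4)[of 0]] K(1) by simp
    have "bounded_xi_exact \<C> \<xi> n (\<lambda>i. Y (Suc i)) (\<lambda>i. if i = 0 then f 1 else d (Suc i)) (K 1)"
      unfolding bounded_xi_exact_def
      using K conf_Obj[OF c]
      by (intro conjI exI[of _ "\<lambda>i. K (Suc i)"] exI[of _ "\<lambda>i. g (Suc i)"] exI[of _ "\<lambda>i. f (Suc i)"]
          exI[of _ "\<lambda>i. \<delta> (Suc i)"]) auto
    moreover have "\<forall>i\<le>n. Y (Suc i) \<in> S (Suc i)" using Y by simp
    ultimately have "has_resolution n (\<lambda>i. S (Suc i)) (K 1)" using IH by blast
    then show "has_resolution (Suc n) S M" using c Y by auto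
  next
    assume "has_resolution (Suc n) S M"
    then obtain K1 Y0 where c: "conf K1 Y0 M" and Y0: "Y0 \<in> S 0" and r: "has_resolution n (\<lambda>i. S (Suc i)) K1" by auto
    obtain g0 f0 \<delta>0 where T: "(K1, g0, Y0, f0, M, \<delta>0) \<in> \<xi>" using c unfolding conf_def by blast
    obtain Y d K g f \<delta> where Y: "\<And>i. i \<le> n \<Longrightarrow> Y i \<in> S (Suc i)"
      and K: "K 0 = K1" "K n = Y n" "f n = Ident \<C> (Y n)"
        "\<And>i. i < n \<Longrightarrow> (K (Suc i), g i, Y i, f i, K i, \<delta> i) \<in> \<xi>"
      using r[folded IH] unfolding bounded_xi_exact_def by blast
    let ?Y = "case_nat Y0 Y" and ?K = "case_nat M K" and ?g = "case_nat g0 g" and ?f = "case_nat f0 f"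
    let ?d = "\<lambda>i. if i = 0 then f0 else ?g (i - 1) \<cdot> ?f i"
    have "(?K (Suc i), ?g i, ?Y i, ?f i, ?K i, case_nat \<delta>0 \<delta> i) \<in> \<xi>" if "i < Suc n" for i
      using that T K by (cases i) auto
    then have "bounded_xi_exact \<C> \<xi> (Suc n) ?Y ?d M"
      unfolding bounded_xi_exact_def
      using K conf_Obj[OF c]
      by (intro conjI exI[of _ ?K] exI[of _ ?g] exI[of _ ?f] exI[of _ "case_nat \<delta>0 \<delta>"]) auto
    moreover have "\<forall>i\<le>Suc n. ?Y i \<in> S i" using Y0 Y by (auto split: nat.split)
    ultimately show "\<exists>Y d. bounded_xi_exact \<C> \<xi> (Suc n) Y d M \<and> (\<forall>i\<le>Suc n. Y i \<in> S i)" by blast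
  qed
qed

lemma has_resolution_mono:
  assumes "has_resolution n S M" "\<And>i. i \<le> n \<Longrightarrow> S i \<subseteq> S' i"
  shows "has_resolution n S' M"
  using assms
proof (induction n arbitrary: S S' M)
  case (Suc n)
  then obtain K Y where "conf K Y M" "Y \<in> S 0" "has_resolution n (\<lambda>i. S (Suc i)) K" by auto
  moreover have "has_resolution n (\<lambda>i. S' (Suc i)) K"
    using Suc.IH[OF calculation(3), of "\<lambda>i. S' (Suc i)"] Suc.prems(2) by simp
  ultimately show ?case using Suc.prems(2)[of 0] by auto
qed auto

abbreviation "has_res \<Y> n M \<equiv> has_resolution n (\<lambda>_. \<Y>) M"

lemma has_res_Suc:
  assumes "has_res \<Y> n M" "\<Y> \<subseteq> Obj \<C>" "\<And>Z. zero_object \<C> Z \<Longrightarrow> Z \<in> \<Y>"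
  shows "has_res \<Y> (Suc n) M"
  using assms(1)
proof (induction n arbitrary: M)
  case 0
  then show ?case using conf_zero_left[OF zero_ob, of M] assms(2) assms(3)[OF zero_ob] by auto
next
  case (Suc n)
  then obtain K Y where "conf K Y M" "Y \<in> \<Y>" "has_res \<Y> n K" by auto
  then show ?case unfolding has_resolution.simps(2)[of "Suc n"] using Suc.IH by blast
qed

lemma has_res_le:
  assumes "has_res \<Y> m M" "m \<le> n" "\<Y> \<subseteq> Obj \<C>" "\<And>Z. zero_object \<C> Z \<Longrightarrow> Z \<in> \<Y>"
  shows "has_res \<Y> n M"
  using assms(2,1) by (induction rule: dec_induct) (use has_res_Suc assms(3,4) in blast)+

lemma res_dim_le_iff:
  assumes "\<Y> \<subseteq> Obj \<C>" "\<And>Z. zero_object \<C> Z \<Longrightarrow> Z \<in> \<Y>"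
  shows "res_dim \<C> \<xi> \<Y> M \<le> enat n \<longleftrightarrow> has_res \<Y> n M"
proof -
  have "res_dim \<C> \<xi> \<Y> M = Inf {enat n | n. has_res \<Y> n M}"
    unfolding res_dim_def using bounded_xi_exact_iff_has_resolution[of "\<lambda>_. \<Y>"] assms(1) by simp
  then have "res_dim \<C> \<xi> \<Y> M \<le> enat n \<longleftrightarrow> (\<exists>k\<le>n. has_res \<Y> k M)"
    by (simp only: Inf_enat_le_iff) auto
  then show ?thesis using has_res_le[OF _ _ assms] by blast
qed

lemma res_dim_finite_iff:
  assumes "\<Y> \<subseteq> Obj \<C>" "\<And>Z. zero_object \<C> Z \<Longrightarrow> Z \<in> \<Y>"
  shows "res_dim \<C> \<xi> \<Y> M < \<infinity> \<longleftrightarrow> (\<exists>n. has_res \<Y> n M)"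
proof
  assume "res_dim \<C> \<xi> \<Y> M < \<infinity>"
  then obtain n where "res_dim \<C> \<xi> \<Y> M = enat n" by (rule less_infinityE)
  then show "\<exists>n. has_res \<Y> n M" using res_dim_le_iff[OF assms, where M = M and n = n] by auto
next
  assume "\<exists>n. has_res \<Y> n M"
  then obtain n where "res_dim \<C> \<xi> \<Y> M \<le> enat n" using res_dim_le_iff[OF assms] by blast
  then show "res_dim \<C> \<xi> \<Y> M < \<infinity>" by (rule order_le_less_trans) simp
qed

lemma has_res_Obj: "\<lbrakk>has_res \<Y> n M; \<Y> \<subseteq> Obj \<C>\<rbrakk> \<Longrightarrow> M \<in> Obj \<C>"
  using conf_Obj by (cases n) auto

end

context quasi_resolving_category
begin

lemma P_sub: "\<P> \<subseteq> Obj \<C>" using P_Obj by blast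
lemma G_sub: "\<G> \<subseteq> Obj \<C>" using G_Obj by blast
lemma X_sub: "\<X> \<subseteq> Obj \<C>" using X_Obj by blast

lemmas P_res_dim_le = res_dim_le_iff[OF P_sub zero_object_P]
lemmas G_res_dim_le = res_dim_le_iff[OF G_sub zero_object_G]
lemmas P_has_res_le = has_res_le[OF _ _ P_sub zero_object_P]
lemma P_res_imp_G_res: "has_res \<P> n M \<Longrightarrow> has_res \<G> n M"
  using has_resolution_mono P_subset_G by (metis subsetI)

lemma P_res_dim_le_pred_iff:
  "res_dim_le \<C> \<xi> \<P> K (int n - 1) \<longleftrightarrow> (case n of 0 \<Rightarrow> zero_object \<C> K | Suc m \<Rightarrow> has_res \<P> m K)"
  using P_res_dim_le by (cases n) (auto simp: res_dim_le_def)

text \<open>The two kinds of approximation.  For \<open>n = 0\<close> the kernel in a cover is zero, which is the meaning of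
  dimension at most \<open>-1\<close>.\<close>

definition G_embedding where
  "G_embedding n M \<longleftrightarrow> (\<exists>W G. conf M W G \<and> G \<in> \<G> \<and> has_res \<P> n W)"

definition G_cover where
  "G_cover n M \<longleftrightarrow> (\<exists>K G. conf K G M \<and> G \<in> \<G> \<and> (case n of 0 \<Rightarrow> zero_object \<C> K | Suc m \<Rightarrow> has_res \<P> m K))"

text \<open>A triangle with zero kernel splits, so that \<open>M\<close> is also a cocone of \<open>G \<rightarrow> 0\<close>.\<close>

lemma G_zero_kernel:
  assumes "conf Z G M" "zero_object \<C> Z" "G \<in> \<G>"
  shows "M \<in> \<G>"
proof -
  obtain x y \<delta> where T: "(Z, x, G, y, M, \<delta>) \<in> \<xi>" using assms(1) unfolding conf_def by blast
  have "\<delta> = \<zero>\<E>\<^bsub>M,Z\<^esub>" using ext_zero_object_right[OF assms(2)] xiD[OF T] by blast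
  then have "conf M G Z" using conf_split_swap xi_E[OF T] by blast
  then show ?thesis using G_cocone assms(3) zero_object_G[OF assms(2)] by blast
qed

lemma G_cover_imp_mixed:
  assumes "G_cover n M"
  shows "has_resolution n (\<lambda>i. if i = 0 then \<G> else \<P>) M"
proof (cases n)
  case 0
  then show ?thesis using assms G_zero_kernel unfolding G_cover_def by auto
next
  case (Suc m)
  then show ?thesis using assms unfolding G_cover_def by auto
qed

lemma mixed_imp_G_cover:
  assumes "has_resolution n (\<lambda>i. if i = 0 then \<G> else \<P>) M"
  shows "G_cover n M"
proof (cases n)
  case 0
  then have "M \<in> \<G>" using assms by simp
  then show ?thesis using 0 conf_zero_left[OF zero_ob G_Obj] zero_ob unfolding G_cover_def by auto
next
  case (Suc m)
  then show ?thesis using assms unfolding G_cover_def by auto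
qed

lemma mixed_imp_G_res:
  assumes "has_resolution n (\<lambda>i. if i = m then \<G> else \<P>) M"
  shows "has_res \<G> n M"
  by (rule has_resolution_mono[OF assms]) (use P_subset_G in auto)

text \<open>Let \<open>K\<close> be the first syzygy, with its embedding \<open>K \<rightarrow> W \<rightarrow> G\<close> given by induction.  The pushout \<open>Z\<close> of \<open>K \<rightarrow> G0\<close> and \<open>K \<rightarrow> W\<close> is
  an extension of \<open>G\<close> by \<open>G0\<close>, hence in \<open>\<G>\<close>, and covers \<open>M\<close> with kernel \<open>W\<close>.  Embedding \<open>Z\<close> into an object
  of \<open>\<P>\<close> and dividing by \<open>W\<close> embeds \<open>M\<close>.\<close>

lemma G_res_imp_approximations:
  "has_res \<G> n M \<Longrightarrow> G_cover n M \<and> G_embedding n M"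
proof (induction n arbitrary: M)
  case 0
  then have M: "M \<in> \<G>" by simp
  obtain P K where "P \<in> \<P>" "K \<in> \<G>" "conf M P K" using G_unfold[OF M] by metis
  then have "G_embedding 0 M" unfolding G_embedding_def by auto
  then show ?case using mixed_imp_G_cover[of 0 M] M by simp
next
  case (Suc n)
  then obtain K G0 where K: "conf K G0 M" "G0 \<in> \<G>" "has_res \<G> n K" by auto
  obtain W G where W: "conf K W G" "G \<in> \<G>" "has_res \<P> n W"
    using Suc.IH[OF K(3)] unfolding G_embedding_def by blast
  obtain Z where Z: "conf W Z M" "conf G0 Z G" using conf_pushout[OF K(1) W(1)] .
  have ZG: "Z \<in> \<G>" using G_extension[OF Z(2) K(2) W(2)] .
  obtain P G' where P: "P \<in> \<P>" "G' \<in> \<G>" "conf Z P G'" using G_unfold[OF ZG] by metis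
  obtain V where V: "conf W P V" "conf M V G'" using conf_compose_inflations[OF Z(1) P(3)] .
  have "has_res \<P> (Suc n) V" using V(1) P(1) W(3) by auto
  then show ?case using Z(1) ZG W(3) V(2) P(2) unfolding G_cover_def G_embedding_def by auto
qed

text \<open>Pull a cover of \<open>W\<close> by an object of \<open>\<P>\<close> back to \<open>M\<close>: the pullback is the cocone of \<open>P \<rightarrow> W \<rightarrow> G\<close>.\<close>

lemma G_embedding_imp_cover:
  assumes "G_embedding n M" shows "G_cover n M"
proof -
  obtain W G where W: "conf M W G" "G \<in> \<G>" "has_res \<P> n W" using assms unfolding G_embedding_def by blast
  show ?thesis
  proof (cases n)
    case 0
    then have "M \<in> \<G>" using G_cocone[OF W(1)] W P_subset_G by simp
    then show ?thesis using 0 mixed_imp_G_cover by simp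
  next
    case (Suc m)
    then obtain K P where K: "conf K P W" "P \<in> \<P>" "has_res \<P> m K" using W(3) by auto
    obtain Z where Z: "conf Z P G" "conf K Z M" using conf_compose_deflations[OF W(1) K(1)] .
    have "Z \<in> \<G>" using G_cocone[OF Z(1)] P_subset_G K(2) W(2) by blast
    then show ?thesis using Z K Suc unfolding G_cover_def by auto
  qed
qed

lemma G_cover_imp_res: "G_cover n M \<Longrightarrow> has_res \<G> n M"
  using G_cover_imp_mixed mixed_imp_G_res by blast

lemma G_res_iff_embedding: "has_res \<G> n M \<longleftrightarrow> G_embedding n M"
  using G_res_imp_approximations G_embedding_imp_cover G_cover_imp_res by blast

lemma G_res_iff_cover: "has_res \<G> n M \<longleftrightarrow> G_cover n M"
  using G_res_imp_approximations G_cover_imp_res by blast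

lemma G_by_P_res_extension:
  assumes "conf G M W" "G \<in> \<G>" "has_res \<P> n W"
  shows "has_res \<G> n M"
proof (cases n)
  case 0
  then show ?thesis using G_extension[OF assms(1,2)] P_subset_G assms(3) by simp
next
  case (Suc m)
  then obtain K P where K: "conf K P W" "P \<in> \<P>" "has_res \<P> m K" using assms(3) by auto
  obtain Z where Z: "conf G Z P" "conf K Z M" using conf_pullback[OF assms(1) K(1)] .
  have "Z \<in> \<G>" using G_extension[OF Z(1)] assms(2) P_subset_G K(2) by blast
  then show ?thesis using Z(2) P_res_imp_G_res[OF K(3)] Suc by auto
qed

text \<open>Compose a Gorenstein cover \<open>G \<rightarrow> M\<close> with a cover of \<open>G\<close> by an object of \<open>\<P>\<close>: the kernel of the composite is an
  extension of the kernel of \<open>G \<rightarrow> M\<close> by an object of \<open>\<G>\<close>.  Iterating moves the one Gorenstein term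
  to any position.\<close>

lemma G_res_projective_syzygy:
  assumes "has_res \<G> (Suc n) M"
  obtains K P where "conf K P M" "P \<in> \<P>" "has_res \<G> n K"
proof -
  obtain L G where L: "conf L G M" "G \<in> \<G>" "has_res \<P> n L"
    using assms unfolding G_res_iff_cover G_cover_def by auto
  obtain P H where P: "P \<in> \<P>" "H \<in> \<G>" "conf H P G" using G_unfold[OF L(2)] by metis
  obtain K where K: "conf K P M" "conf H K L" using conf_compose_deflations[OF L(1) P(3)] .
  show ?thesis using that[OF K(1) P(1) G_by_P_res_extension[OF K(2) P(2) L(3)]] .
qed

lemma G_res_imp_mixed:
  assumes "has_res \<G> n M" "m \<le> n"
  shows "has_resolution n (\<lambda>i. if i = m then \<G> else \<P>) M"
  using assms
proof (induction m arbitrary: n M)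
  case 0
  then show ?case using G_res_iff_cover G_cover_imp_mixed by simp
next
  case (Suc m)
  then obtain n' where n: "n = Suc n'" "m \<le> n'" by (cases n) auto
  obtain K P where K: "conf K P M" "P \<in> \<P>" "has_res \<G> n' K"
    using G_res_projective_syzygy Suc.prems(1) n(1) by blast
  have "has_resolution n' (\<lambda>i. if i = m then \<G> else \<P>) K" using Suc.IH[OF K(3) n(2)] .
  then show ?case unfolding n(1) using K by auto
qed

end

section \<open>Short exact sequences of complexes\<close>

text \<open>The index is shifted: this is exactness at \<open>X (Suc k)\<close>, the vanishing of cohomology in degree \<open>k + 1\<close>.
  Degree \<open>0\<close> is left out on purpose, because the zeroth cohomology is not the group of
  morphisms in general.\<close>

definition acyclic_at :: "(nat \<Rightarrow> 'm monoid) \<Rightarrow> (nat \<Rightarrow> 'm \<Rightarrow> 'm) \<Rightarrow> nat \<Rightarrow> bool" where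
  "acyclic_at X d k \<longleftrightarrow> (\<forall>h\<in>carrier (X (Suc k)). d (Suc k) h = \<one>\<^bsub>X (Suc (Suc k))\<^esub> \<longrightarrow> (\<exists>u\<in>carrier (X k). h = d k u))"

locale short_exact_complexes =
  fixes A B C :: "nat \<Rightarrow> 'm monoid" and i p dA dB dC :: "nat \<Rightarrow> 'm \<Rightarrow> 'm"
  assumes i: "group_hom (A k) (B k) (i k)" and p: "group_hom (B k) (C k) (p k)"
    and dA: "group_hom (A k) (A (Suc k)) (dA k)" and dB: "group_hom (B k) (B (Suc k)) (dB k)"
    and dC: "group_hom (C k) (C (Suc k)) (dC k)"
    and i_d: "a \<in> carrier (A k) \<Longrightarrow> dB k (i k a) = i (Suc k) (dA k a)"
    and p_d: "b \<in> carrier (B k) \<Longrightarrow> dC k (p k b) = p (Suc k) (dB k b)"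
    and dd: "b \<in> carrier (B k) \<Longrightarrow> dB (Suc k) (dB k b) = \<one>\<^bsub>B (Suc (Suc k))\<^esub>"
    and i_mono: "a \<in> carrier (A k) \<Longrightarrow> i k a = \<one>\<^bsub>B k\<^esub> \<Longrightarrow> a = \<one>\<^bsub>A k\<^esub>"
    and p_epi: "c \<in> carrier (C k) \<Longrightarrow> \<exists>b\<in>carrier (B k). p k b = c"
    and pi: "a \<in> carrier (A k) \<Longrightarrow> p k (i k a) = \<one>\<^bsub>C k\<^esub>"
    and exact: "b \<in> carrier (B k) \<Longrightarrow> p k b = \<one>\<^bsub>C k\<^esub> \<Longrightarrow> \<exists>a\<in>carrier (A k). b = i k a"
begin

sublocale i: group_hom "A k" "B k" "i k" for k by (rule i)
sublocale p: group_hom "B k" "C k" "p k" for k by (rule p)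
sublocale dA: group_hom "A k" "A (Suc k)" "dA k" for k by (rule dA)
sublocale dB: group_hom "B k" "B (Suc k)" "dB k" for k by (rule dB)
sublocale dC: group_hom "C k" "C (Suc k)" "dC k" for k by (rule dC)

lemma eq_times_inv:
  assumes "b \<in> carrier (B k)" "b' \<in> carrier (B k)"
  shows "b = (b \<otimes>\<^bsub>B k\<^esub> inv\<^bsub>B k\<^esub> b') \<otimes>\<^bsub>B k\<^esub> b'"
  using assms by (simp add: i.H.m_assoc)

text \<open>This lemma and the next two are the vanishing consequences of the long exact cohomology sequence.\<close>

lemma acyclic_middle:
  assumes "acyclic_at A dA k" "acyclic_at C dC k"
  shows "acyclic_at B dB k"
  unfolding acyclic_at_def
proof (intro ballI impI)
  fix b assume b: "b \<in> carrier (B (Suc k))" "dB (Suc k) b = \<one>\<^bsub>B (Suc (Suc k))\<^esub>"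
  have "dC (Suc k) (p (Suc k) b) = \<one>\<^bsub>C (Suc (Suc k))\<^esub>" using p_d[OF b(1)] b(2) by simp
  then obtain c where "c \<in> carrier (C k)" "p (Suc k) b = dC k c"
    using assms(2) b(1) unfolding acyclic_at_def by (meson p.hom_closed)
  then obtain b' where b': "b' \<in> carrier (B k)" "p (Suc k) b = p (Suc k) (dB k b')"
    using p_epi p_d by metis
  let ?t = "b \<otimes>\<^bsub>B (Suc k)\<^esub> inv\<^bsub>B (Suc k)\<^esub> dB k b'"
  have t: "?t \<in> carrier (B (Suc k))" using b b' by simp
  have "p (Suc k) ?t = \<one>\<^bsub>C (Suc k)\<^esub>" using b b' by simp
  then obtain a where a: "a \<in> carrier (A (Suc k))" "?t = i (Suc k) a" using exact t by blast
  have "dB (Suc k) ?t = \<one>\<^bsub>B (Suc (Suc k))\<^esub>" using b b' dd by simp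
  then have "dA (Suc k) a = \<one>\<^bsub>A (Suc (Suc k))\<^esub>" using a i_d i_mono by simp
  then obtain a' where a': "a' \<in> carrier (A k)" "a = dA k a'" using assms(1) a unfolding acyclic_at_def by blast
  have "b = ?t \<otimes>\<^bsub>B (Suc k)\<^esub> dB k b'" using eq_times_inv b b' by simp
  also have "\<dots> = dB k (i k a' \<otimes>\<^bsub>B k\<^esub> b')" using a a' b' i_d by simp
  finally have "b = dB k (i k a' \<otimes>\<^bsub>B k\<^esub> b')" .
  then show "\<exists>u\<in>carrier (B k). b = dB k u" using i.H.m_closed[OF i.hom_closed[OF a'(1)] b'(1)] by blast
qed

lemma acyclic_quotient:
  assumes "acyclic_at B dB k" "acyclic_at A dA (Suc k)"
  shows "acyclic_at C dC k"
  unfolding acyclic_at_def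
proof (intro ballI impI)
  fix c assume c: "c \<in> carrier (C (Suc k))" "dC (Suc k) c = \<one>\<^bsub>C (Suc (Suc k))\<^esub>"
  obtain b where b: "b \<in> carrier (B (Suc k))" "p (Suc k) b = c" using p_epi c by blast
  have "p (Suc (Suc k)) (dB (Suc k) b) = \<one>\<^bsub>C (Suc (Suc k))\<^esub>" using p_d b c by metis
  then obtain a where a: "a \<in> carrier (A (Suc (Suc k)))" "dB (Suc k) b = i (Suc (Suc k)) a"
    using exact b by (meson dB.hom_closed)
  have "i (Suc (Suc (Suc k))) (dA (Suc (Suc k)) a) = \<one>\<^bsub>B (Suc (Suc (Suc k)))\<^esub>"
    using i_d[OF a(1)] a(2) dd[OF b(1)] by simp
  then have "dA (Suc (Suc k)) a = \<one>\<^bsub>A (Suc (Suc (Suc k)))\<^esub>" using i_mono a by simp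
  then obtain a' where a': "a' \<in> carrier (A (Suc k))" "a = dA (Suc k) a'"
    using assms(2) a unfolding acyclic_at_def by blast
  let ?t = "b \<otimes>\<^bsub>B (Suc k)\<^esub> inv\<^bsub>B (Suc k)\<^esub> i (Suc k) a'"
  have t: "?t \<in> carrier (B (Suc k))" using b a' by simp
  have "dB (Suc k) ?t = \<one>\<^bsub>B (Suc (Suc k))\<^esub>" using b a a' i_d[OF a'(1)] by simp
  then obtain u where u: "u \<in> carrier (B k)" "?t = dB k u" using assms(1) t unfolding acyclic_at_def by blast
  have "c = p (Suc k) (?t \<otimes>\<^bsub>B (Suc k)\<^esub> i (Suc k) a')" using eq_times_inv[of b "Suc k"] b a' by simp
  also have "\<dots> = p (Suc k) (dB k u) \<otimes>\<^bsub>C (Suc k)\<^esub> p (Suc k) (i (Suc k) a')"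
    unfolding u(2) using u a' by simp
  also have "\<dots> = dC k (p k u)" using u a' pi p_d by simp
  finally have "c = dC k (p k u)" .
  then show "\<exists>u\<in>carrier (C k). c = dC k u" using p.hom_closed[OF u(1)] by blast
qed

lemma acyclic_sub:
  assumes "acyclic_at C dC k" "acyclic_at B dB (Suc k)"
  shows "acyclic_at A dA (Suc k)"
  unfolding acyclic_at_def
proof (intro ballI impI)
  fix a assume a: "a \<in> carrier (A (Suc (Suc k)))" "dA (Suc (Suc k)) a = \<one>\<^bsub>A (Suc (Suc (Suc k)))\<^esub>"
  have "dB (Suc (Suc k)) (i (Suc (Suc k)) a) = \<one>\<^bsub>B (Suc (Suc (Suc k)))\<^esub>" using i_d a by simp
  then obtain b where b: "b \<in> carrier (B (Suc k))" "i (Suc (Suc k)) a = dB (Suc k) b"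
    using assms(2) a unfolding acyclic_at_def by (meson i.hom_closed)
  have "dC (Suc k) (p (Suc k) b) = \<one>\<^bsub>C (Suc (Suc k))\<^esub>" using p_d[OF b(1)] pi[OF a(1)] b(2) by simp
  then obtain c where "c \<in> carrier (C k)" "p (Suc k) b = dC k c"
    using assms(1) b(1) unfolding acyclic_at_def by (meson p.hom_closed)
  then obtain b' where b': "b' \<in> carrier (B k)" "p (Suc k) b = p (Suc k) (dB k b')"
    using p_epi p_d by metis
  let ?t = "b \<otimes>\<^bsub>B (Suc k)\<^esub> inv\<^bsub>B (Suc k)\<^esub> dB k b'"
  have t: "?t \<in> carrier (B (Suc k))" using b b' by simp
  have "p (Suc k) ?t = \<one>\<^bsub>C (Suc k)\<^esub>" using b b' by simp
  then obtain a' where a': "a' \<in> carrier (A (Suc k))" "?t = i (Suc k) a'" using exact t by blast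
  have "i (Suc (Suc k)) (dA (Suc k) a') = dB (Suc k) ?t" using i_d a' by simp
  also have "\<dots> = i (Suc (Suc k)) a" using b b' dd by simp
  finally have "i (Suc (Suc k)) (a \<otimes>\<^bsub>A (Suc (Suc k))\<^esub> inv\<^bsub>A (Suc (Suc k))\<^esub> dA (Suc k) a') = \<one>\<^bsub>B (Suc (Suc k))\<^esub>"
    using a a' by simp
  then have "a \<otimes>\<^bsub>A (Suc (Suc k))\<^esub> inv\<^bsub>A (Suc (Suc k))\<^esub> dA (Suc k) a' = \<one>\<^bsub>A (Suc (Suc k))\<^esub>"
    using i_mono a a' by (meson dA.hom_closed i.G.inv_closed i.G.m_closed)
  moreover have "a = (a \<otimes>\<^bsub>A (Suc (Suc k))\<^esub> inv\<^bsub>A (Suc (Suc k))\<^esub> dA (Suc k) a') \<otimes>\<^bsub>A (Suc (Suc k))\<^esub> dA (Suc k) a'"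
    using a a' by (simp add: i.G.m_assoc)
  ultimately have "a = dA (Suc k) a'" using a' by simp
  then show "\<exists>u\<in>carrier (A (Suc k)). a = dA (Suc k) u" using a' by blast
qed

end

lemma trivial_factor_group_iff:
  assumes "comm_group G" "subgroup H G"
  shows "trivial_group (G Mod H) \<longleftrightarrow> carrier G \<subseteq> H"
proof -
  interpret G: comm_group G by fact
  interpret H: subgroup H G by fact
  interpret N: normal H G using G.subgroup_imp_normal assms by blast
  have "trivial_group (G Mod H) \<longleftrightarrow> (\<forall>a\<in>carrier G. H #>\<^bsub>G\<^esub> a = H)"
    unfolding trivial_group_def using N.factorgroup_is_group G.one_closed
    by (auto simp: carrier_FactGroup)
  also have "\<dots> \<longleftrightarrow> carrier G \<subseteq> H"
    using G.coset_join1[OF _ _ assms(2)] G.coset_join2[OF _ assms(2)] H.subset by blast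
  finally show ?thesis .
qed

section \<open>Derived functors\<close>

context enough_xi_category
begin

text \<open>Only the resolution triangles are kept; the differentials are the composites \<open>proj_diff\<close> and
  \<open>inj_diff\<close>.\<close>

definition proj_res where
  "proj_res K g P f A \<longleftrightarrow> K 0 = A \<and> (\<forall>i. P i \<in> Proj \<and> (\<exists>\<delta>. (K (Suc i), g i, P i, f i, K i, \<delta>) \<in> \<xi>))"

definition inj_cores where
  "inj_cores L e I p B \<longleftrightarrow> L 0 = B \<and> (\<forall>i. I i \<in> Inj \<and> (\<exists>\<delta>. (L i, e i, I i, p i, L (Suc i), \<delta>) \<in> \<xi>))"

abbreviation proj_diff where "proj_diff g f k \<equiv> g k \<cdot> f (Suc k)"
abbreviation inj_diff where "inj_diff e p k \<equiv> e (Suc k) \<cdot> p k"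

definition proj_acyclic where
  "proj_acyclic g P f B k \<longleftrightarrow> (\<forall>h. <<h : P (Suc k) -> B>> \<longrightarrow> h \<cdot> proj_diff g f (Suc k) = \<zero>\<^bsub>P (Suc (Suc k)),B\<^esub>
     \<longrightarrow> (\<exists>u. <<u : P k -> B>> \<and> h = u \<cdot> proj_diff g f k))"

definition inj_acyclic where
  "inj_acyclic e I p A k \<longleftrightarrow> (\<forall>h. <<h : A -> I (Suc k)>> \<longrightarrow> inj_diff e p (Suc k) \<cdot> h = \<zero>\<^bsub>A,I (Suc (Suc k))\<^esub>
     \<longrightarrow> (\<exists>u. <<u : A -> I k>> \<and> h = inj_diff e p k \<cdot> u))"

lemma proj_resD:
  assumes "proj_res K g P f A"
  shows "K 0 = A" "P i \<in> Proj" "\<exists>\<delta>. (K (Suc i), g i, P i, f i, K i, \<delta>) \<in> \<xi>"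
    "<<g i : K (Suc i) -> P i>>" "<<f i : P i -> K i>>" "f i \<cdot> g i = \<zero>\<^bsub>K (Suc i),K i\<^esub>"
    "<<proj_diff g f i : P (Suc i) -> P i>>" "P i \<in> Obj \<C>" "K i \<in> Obj \<C>" "A \<in> Obj \<C>"
    "proj_diff g f i \<cdot> proj_diff g f (Suc i) = \<zero>\<^bsub>P (Suc (Suc i)),P i\<^esub>"
proof -
  have *: "\<exists>\<delta>. (K (Suc i), g i, P i, f i, K i, \<delta>) \<in> \<xi>" for i using assms unfolding proj_res_def by blast
  show "K 0 = A" "P i \<in> Proj" using assms unfolding proj_res_def by blast+
  have a: "<<g i : K (Suc i) -> P i>>" (is ?A) "<<f i : P i -> K i>>" (is ?B)
    "f i \<cdot> g i = \<zero>\<^bsub>K (Suc i),K i\<^esub>" (is ?C) for i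
  proof -
    obtain \<delta> where T: "(K (Suc i), g i, P i, f i, K i, \<delta>) \<in> \<xi>" using * by blast
    show ?A ?B ?C using xiD(1,2)[OF T] triangle_comp_zero[OF xi_E[OF T]] by simp_all
  qed
  show "\<exists>\<delta>. (K (Suc i), g i, P i, f i, K i, \<delta>) \<in> \<xi>" "<<g i : K (Suc i) -> P i>>" "<<f i : P i -> K i>>"
    "f i \<cdot> g i = \<zero>\<^bsub>K (Suc i),K i\<^esub>" using * a by blast+
  show o: "P i \<in> Obj \<C>" "K i \<in> Obj \<C>" using arr_objD a by blast+
  show "A \<in> Obj \<C>" using arr_objD a[of 0] assms unfolding proj_res_def by blast
  show d: "<<proj_diff g f i : P (Suc i) -> P i>>" using comp_closed a by blast
  have "f (Suc i) \<cdot> proj_diff g f (Suc i) = \<zero>\<^bsub>P (Suc (Suc i)),K (Suc i)\<^esub>"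
    using comp_assoc[OF a(2)[of "Suc (Suc i)"] a(1,2)[of "Suc i"]] a(3)[of "Suc i"]
      comp_zero_left[OF a(2)[of "Suc (Suc i)"]] arr_objD[OF a(2)[of "Suc i"]] by simp
  then show "proj_diff g f i \<cdot> proj_diff g f (Suc i) = \<zero>\<^bsub>P (Suc (Suc i)),P i\<^esub>"
    using comp_assoc[OF comp_closed[OF a(2)[of "Suc (Suc i)"] a(1)[of "Suc i"]] a(2)[of "Suc i"] a(1)[of i]]
      comp_zero_right[OF a(1)[of i]] arr_objD[OF a(2)[of "Suc (Suc i)"]] by simp
qed

lemma inj_coresD:
  assumes "inj_cores L e I p B"
  shows "L 0 = B" "I i \<in> Inj" "\<exists>\<delta>. (L i, e i, I i, p i, L (Suc i), \<delta>) \<in> \<xi>"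
    "<<e i : L i -> I i>>" "<<p i : I i -> L (Suc i)>>" "p i \<cdot> e i = \<zero>\<^bsub>L i,L (Suc i)\<^esub>"
    "<<inj_diff e p i : I i -> I (Suc i)>>" "I i \<in> Obj \<C>" "L i \<in> Obj \<C>" "B \<in> Obj \<C>"
    "inj_diff e p (Suc i) \<cdot> inj_diff e p i = \<zero>\<^bsub>I i,I (Suc (Suc i))\<^esub>"
proof -
  have *: "\<exists>\<delta>. (L i, e i, I i, p i, L (Suc i), \<delta>) \<in> \<xi>" for i using assms unfolding inj_cores_def by blast
  show "L 0 = B" "I i \<in> Inj" using assms unfolding inj_cores_def by blast+
  have a: "<<e i : L i -> I i>>" (is ?A) "<<p i : I i -> L (Suc i)>>" (is ?B)
    "p i \<cdot> e i = \<zero>\<^bsub>L i,L (Suc i)\<^esub>" (is ?C) for i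
  proof -
    obtain \<delta> where T: "(L i, e i, I i, p i, L (Suc i), \<delta>) \<in> \<xi>" using * by blast
    show ?A ?B ?C using xiD(1,2)[OF T] triangle_comp_zero[OF xi_E[OF T]] by simp_all
  qed
  show "\<exists>\<delta>. (L i, e i, I i, p i, L (Suc i), \<delta>) \<in> \<xi>" "<<e i : L i -> I i>>" "<<p i : I i -> L (Suc i)>>"
    "p i \<cdot> e i = \<zero>\<^bsub>L i,L (Suc i)\<^esub>" using * a by blast+
  show o: "I i \<in> Obj \<C>" "L i \<in> Obj \<C>" using arr_objD a by blast+
  show "B \<in> Obj \<C>" using arr_objD a[of 0] assms unfolding inj_cores_def by blast
  show d: "<<inj_diff e p i : I i -> I (Suc i)>>" using comp_closed a by blast
  have "inj_diff e p (Suc i) \<cdot> e (Suc i) = \<zero>\<^bsub>L (Suc i),I (Suc (Suc i))\<^esub>"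
    using comp_assoc[OF a(1,2)[of "Suc i"] a(1)[of "Suc (Suc i)"]] a(3)[of "Suc i"]
      comp_zero_right[OF a(1)[of "Suc (Suc i)"]] arr_objD[OF a(1)[of "Suc i"]] by simp
  then show "inj_diff e p (Suc i) \<cdot> inj_diff e p i = \<zero>\<^bsub>I i,I (Suc (Suc i))\<^esub>"
    using comp_assoc[OF a(2)[of i] a(1)[of "Suc i"] comp_closed[OF a(2)[of "Suc i"] a(1)[of "Suc (Suc i)"]]]
      comp_zero_left[OF a(2)[of i]] arr_objD[OF a(1)[of "Suc (Suc i)"]] by simp
qed

lemma proj_res_complexes:
  assumes R: "proj_res K g P f Z" and T: "(A, x, B, y, C, \<delta>) \<in> \<xi>"
  shows "short_exact_complexes (\<lambda>k. Hom \<C> (P k) A) (\<lambda>k. Hom \<C> (P k) B) (\<lambda>k. Hom \<C> (P k) C)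
    (\<lambda>k h. x \<cdot> h) (\<lambda>k h. y \<cdot> h) (\<lambda>k h. h \<cdot> proj_diff g f k) (\<lambda>k h. h \<cdot> proj_diff g f k) (\<lambda>k h. h \<cdot> proj_diff g f k)"
proof -
  note D = xiD[OF T] and r = proj_resD[OF R]
  have arr: "<<h : P k -> M>>" if "h \<in> carrier (Hom \<C> (P k) M)" "M \<in> Obj \<C>" for h k M
    using that r(8) by (simp add: arr_def)
  have carr: "h \<in> carrier (Hom \<C> (P k) M)" if "<<h : P k -> M>>" for h k M
    using that by (simp add: arr_def)
  show ?thesis
  proof (rule short_exact_complexes.intro, goal_cases)
    case 1 show ?case using post_comp_hom[OF D(1) r(8)] .
  next
    case 2 show ?case using post_comp_hom[OF D(2) r(8)] .
  next
    case 3 show ?case using pre_comp_hom[OF r(7) D(4)] .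
  next
    case 4 show ?case using pre_comp_hom[OF r(7) D(5)] .
  next
    case 5 show ?case using pre_comp_hom[OF r(7) D(6)] .
  next
    case (6 h k) then show ?case using comp_assoc[OF r(7) arr[OF _ D(4)] D(1)] by blast
  next
    case (7 h k) then show ?case using comp_assoc[OF r(7) arr[OF _ D(5)] D(2)] by blast
  next
    case (8 h k)
    note h = arr[OF 8 D(5)]
    show ?case using comp_assoc[OF r(7)[of "Suc k"] r(7)[of k] h] r(11)[of k] comp_zero_right[OF h r(8)] by simp
  next
    case (9 h k) then show ?case using proj_mono[OF r(2) T arr[OF _ D(4)]] by blast
  next
    case (10 c k) then show ?case using proj_lift[OF r(2) T arr[OF _ D(6)]] carr by metis
  next
    case (11 h k)
    note h = arr[OF 11 D(4)]
    show ?case using comp_assoc[OF h D(1,2)] triangle_comp_zero[OF xi_E[OF T]] comp_zero_left[OF h D(6)] by simp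
  next
    case (12 h k) then show ?case using triangle_weak_kernel[OF xi_E[OF T] arr[OF _ D(5)]] carr by metis
  qed
qed

lemma inj_cores_complexes:
  assumes R: "inj_cores L e I p Z" and T: "(A, x, B, y, C, \<delta>) \<in> \<xi>"
  shows "short_exact_complexes (\<lambda>k. Hom \<C> C (I k)) (\<lambda>k. Hom \<C> B (I k)) (\<lambda>k. Hom \<C> A (I k))
    (\<lambda>k h. h \<cdot> y) (\<lambda>k h. h \<cdot> x) (\<lambda>k h. inj_diff e p k \<cdot> h) (\<lambda>k h. inj_diff e p k \<cdot> h) (\<lambda>k h. inj_diff e p k \<cdot> h)"
proof -
  note D = xiD[OF T] and r = inj_coresD[OF R]
  have arr: "<<h : M -> I k>>" if "h \<in> carrier (Hom \<C> M (I k))" "M \<in> Obj \<C>" for h k M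
    using that r(8) by (simp add: arr_def)
  have carr: "h \<in> carrier (Hom \<C> M (I k))" if "<<h : M -> I k>>" for h k M
    using that by (simp add: arr_def)
  show ?thesis
  proof (rule short_exact_complexes.intro, goal_cases)
    case 1 show ?case using pre_comp_hom[OF D(2) r(8)] .
  next
    case 2 show ?case using pre_comp_hom[OF D(1) r(8)] .
  next
    case 3 show ?case using post_comp_hom[OF r(7) D(6)] .
  next
    case 4 show ?case using post_comp_hom[OF r(7) D(5)] .
  next
    case 5 show ?case using post_comp_hom[OF r(7) D(4)] .
  next
    case (6 h k) then show ?case using comp_assoc[OF D(2) arr[OF _ D(6)] r(7)] by metis
  next
    case (7 h k) then show ?case using comp_assoc[OF D(1) arr[OF _ D(5)] r(7)] by metis
  next
    case (8 h k)
    note h = arr[OF 8 D(5)]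
    show ?case using comp_assoc[OF h r(7)[of k] r(7)[of "Suc k"]] r(11)[of k] comp_zero_left[OF h r(8)] by simp
  next
    case (9 h k) then show ?case using inj_epi[OF r(2) T arr[OF _ D(6)]] by blast
  next
    case (10 c k) then show ?case using inj_extend[OF r(2) T arr[OF _ D(4)]] carr by metis
  next
    case (11 h k)
    note h = arr[OF 11 D(6)]
    show ?case using comp_assoc[OF D(1,2) h] triangle_comp_zero[OF xi_E[OF T]] comp_zero_right[OF h D(4)] by simp
  next
    case (12 h k) then show ?case using triangle_weak_cokernel[OF xi_E[OF T] arr[OF _ D(5)]] carr by metis
  qed
qed

lemma proj_acyclic_iff:
  assumes R: "proj_res K g P f Z" and B: "B \<in> Obj \<C>"
  shows "acyclic_at (\<lambda>k. Hom \<C> (P k) B) (\<lambda>k h. h \<cdot> proj_diff g f k) k \<longleftrightarrow> proj_acyclic g P f B k"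
  using proj_resD(8)[OF R] B unfolding acyclic_at_def proj_acyclic_def arr_def by auto

lemma inj_acyclic_iff:
  assumes R: "inj_cores L e I p Z" and B: "B \<in> Obj \<C>"
  shows "acyclic_at (\<lambda>k. Hom \<C> B (I k)) (\<lambda>k h. inj_diff e p k \<cdot> h) k \<longleftrightarrow> inj_acyclic e I p B k"
  using inj_coresD(8)[OF R] B unfolding acyclic_at_def inj_acyclic_def arr_def by auto

context
  fixes K g P f Z A x B y C \<delta>
  assumes R: "proj_res K g P f Z" and T: "(A, x, B, y, C, \<delta>) \<in> \<xi>"
begin

lemma proj_acyclic_quotient: "proj_acyclic g P f B k \<Longrightarrow> proj_acyclic g P f A (Suc k) \<Longrightarrow> proj_acyclic g P f C k"
  using short_exact_complexes.acyclic_quotient[OF proj_res_complexes[OF R T], of k] xiD[OF T] by (simp add: proj_acyclic_iff[OF R])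

lemma proj_acyclic_sub: "proj_acyclic g P f C k \<Longrightarrow> proj_acyclic g P f B (Suc k) \<Longrightarrow> proj_acyclic g P f A (Suc k)"
  using short_exact_complexes.acyclic_sub[OF proj_res_complexes[OF R T], of k] xiD[OF T] by (simp add: proj_acyclic_iff[OF R])

end

context
  fixes L e I p Z A x B y C \<delta>
  assumes R: "inj_cores L e I p Z" and T: "(A, x, B, y, C, \<delta>) \<in> \<xi>"
begin

lemma inj_acyclic_middle: "inj_acyclic e I p A k \<Longrightarrow> inj_acyclic e I p C k \<Longrightarrow> inj_acyclic e I p B k"
  using short_exact_complexes.acyclic_middle[OF inj_cores_complexes[OF R T], of k] xiD[OF T] by (simp add: inj_acyclic_iff[OF R])

lemma inj_acyclic_cone: "inj_acyclic e I p A k \<Longrightarrow> inj_acyclic e I p B (Suc k) \<Longrightarrow> inj_acyclic e I p C (Suc k)"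
  using short_exact_complexes.acyclic_sub[OF inj_cores_complexes[OF R T], of k] xiD[OF T] by (simp add: inj_acyclic_iff[OF R])

lemma inj_acyclic_cocone: "inj_acyclic e I p B k \<Longrightarrow> inj_acyclic e I p C (Suc k) \<Longrightarrow> inj_acyclic e I p A k"
  using short_exact_complexes.acyclic_quotient[OF inj_cores_complexes[OF R T], of k] xiD[OF T] by (simp add: inj_acyclic_iff[OF R])

end

text \<open>Applies to injective \<open>B\<close> and arbitrary resolutions, and to \<open>B\<close> in \<open>\<X>\<close> and the left half of a
  complete resolution.\<close>

lemma proj_acyclic_if_hom_exact:
  assumes R: "proj_res K g P f A"
    and mono: "\<And>i h. <<h : K i -> B>> \<Longrightarrow> h \<cdot> f i = \<zero>\<^bsub>P i,B\<^esub> \<Longrightarrow> h = \<zero>\<^bsub>K i,B\<^esub>"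
    and ext: "\<And>i a. <<a : K (Suc i) -> B>> \<Longrightarrow> \<exists>b. <<b : P i -> B>> \<and> b \<cdot> g i = a"
  shows "proj_acyclic g P f B k"
  unfolding proj_acyclic_def
proof (intro allI impI)
  note r = proj_resD[OF R]
  fix h assume h: "<<h : P (Suc k) -> B>>" and z: "h \<cdot> proj_diff g f (Suc k) = \<zero>\<^bsub>P (Suc (Suc k)),B\<^esub>"
  obtain \<delta> where T: "(K (Suc (Suc k)), g (Suc k), P (Suc k), f (Suc k), K (Suc k), \<delta>) \<in> \<xi>" using r(3) by blast
  have "(h \<cdot> g (Suc k)) \<cdot> f (Suc (Suc k)) = \<zero>\<^bsub>P (Suc (Suc k)),B\<^esub>"
    using comp_assoc[OF r(5) r(4) h] z by simp
  then have "h \<cdot> g (Suc k) = \<zero>\<^bsub>K (Suc (Suc k)),B\<^esub>" using mono[OF comp_closed[OF r(4) h]] by blast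
  then obtain h' where h': "<<h' : K (Suc k) -> B>>" "h = h' \<cdot> f (Suc k)"
    using triangle_weak_cokernel[OF xi_E[OF T] h] by blast
  obtain u where u: "<<u : P k -> B>>" "u \<cdot> g k = h'" using ext[OF h'(1)] by blast
  have "h = u \<cdot> proj_diff g f k" using comp_assoc[OF r(5) r(4) u(1)] u(2) h'(2) by simp
  then show "\<exists>u. <<u : P k -> B>> \<and> h = u \<cdot> proj_diff g f k" using u by blast
qed

lemma proj_acyclic_injective:
  assumes R: "proj_res K g P f A" and J: "J \<in> Inj"
  shows "proj_acyclic g P f J k"
proof (rule proj_acyclic_if_hom_exact[OF R])
  note r = proj_resD[OF R]
  fix i
  obtain \<delta> where T: "(K (Suc i), g i, P i, f i, K i, \<delta>) \<in> \<xi>" using r(3) by blast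
  show "h = \<zero>\<^bsub>K i,J\<^esub>" if "<<h : K i -> J>>" "h \<cdot> f i = \<zero>\<^bsub>P i,J\<^esub>" for h
    using inj_epi[OF J T that] .
  show "\<exists>b. <<b : P i -> J>> \<and> b \<cdot> g i = a" if "<<a : K (Suc i) -> J>>" for a
    using inj_extend[OF J T that] by blast
qed

lemma inj_acyclic_projective:
  assumes R: "inj_cores L e I p B" and Q: "Q \<in> Proj"
  shows "inj_acyclic e I p Q k"
  unfolding inj_acyclic_def
proof (intro allI impI)
  note r = inj_coresD[OF R]
  fix h assume h: "<<h : Q -> I (Suc k)>>" and z: "inj_diff e p (Suc k) \<cdot> h = \<zero>\<^bsub>Q,I (Suc (Suc k))\<^esub>"
  obtain \<delta> where T: "(L k, e k, I k, p k, L (Suc k), \<delta>) \<in> \<xi>" using r(3) by blast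
  obtain \<delta>' where T': "(L (Suc k), e (Suc k), I (Suc k), p (Suc k), L (Suc (Suc k)), \<delta>') \<in> \<xi>" using r(3) by blast
  obtain \<delta>'' where T'': "(L (Suc (Suc k)), e (Suc (Suc k)), I (Suc (Suc k)), p (Suc (Suc k)), L (Suc (Suc (Suc k))), \<delta>'') \<in> \<xi>"
    using r(3) by blast
  have "e (Suc (Suc k)) \<cdot> (p (Suc k) \<cdot> h) = \<zero>\<^bsub>Q,I (Suc (Suc k))\<^esub>"
    using comp_assoc[OF h r(5) r(4)] z by simp
  then have "p (Suc k) \<cdot> h = \<zero>\<^bsub>Q,L (Suc (Suc k))\<^esub>" using proj_mono[OF Q T'' comp_closed[OF h r(5)]] by blast
  then obtain c where c: "<<c : Q -> L (Suc k)>>" "h = e (Suc k) \<cdot> c"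
    using triangle_weak_kernel[OF xi_E[OF T'] h] by blast
  obtain u where u: "<<u : Q -> I k>>" "p k \<cdot> u = c" using proj_lift[OF Q T c(1)] .
  have "h = inj_diff e p k \<cdot> u" using comp_assoc[OF u(1) r(5) r(4)] u(2) c(2) by simp
  then show "\<exists>u. <<u : Q -> I k>> \<and> h = inj_diff e p k \<cdot> u" using u by blast
qed


subsection \<open>Balance\<close>

context
  fixes K g P f A L e I p B
  assumes R: "proj_res K g P f A" and S: "inj_cores L e I p B"
begin

text \<open>In degree one both sides are compared with the surjectivity of \<open>H\<^sup>0(Hom(P, I\<^sub>0)) \<rightarrow> H\<^sup>0(Hom(P, L\<^sub>1))\<close>, where \<open>L\<^sub>1\<close>
  is the first cosyzygy of \<open>B\<close>.  Its cokernel is \<open>H\<^sup>1(Hom(P, B))\<close>, because \<open>H\<^sup>1(Hom(P, I\<^sub>0)) = 0\<close>.  It is also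
  \<open>H\<^sup>1(Hom(A, I))\<close>, because \<open>Hom(A, I\<^sub>j) = H\<^sup>0(Hom(P, I\<^sub>j))\<close> and \<open>L\<^sub>1\<close> has the same maps from projectives as the
  kernel of \<open>I\<^sub>1 \<rightarrow> I\<^sub>2\<close>.\<close>

definition mixed_lifting where
  "mixed_lifting \<longleftrightarrow> (\<forall>c. <<c : P 0 -> L 1>> \<longrightarrow> c \<cdot> proj_diff g f 0 = \<zero>\<^bsub>P 1,L 1\<^esub> \<longrightarrow>
     (\<exists>w. <<w : P 0 -> I 0>> \<and> w \<cdot> proj_diff g f 0 = \<zero>\<^bsub>P 1,I 0\<^esub> \<and> c = p 0 \<cdot> w))"

lemma first_cosyzygy: obtains \<delta> where "(B, e 0, I 0, p 0, L 1, \<delta>) \<in> \<xi>"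
  using inj_coresD(1,3)[OF S] by (metis One_nat_def)

lemma proj_acyclic_imp_mixed_lifting:
  assumes a: "proj_acyclic g P f B 0" shows mixed_lifting
  unfolding mixed_lifting_def
proof (intro allI impI)
  note r = proj_resD[OF R] and s = inj_coresD[OF S]
  let ?d = "proj_diff g f 0" and ?d' = "proj_diff g f 1"
  have d: "<<?d : P 1 -> P 0>>" "<<?d' : P (Suc 1) -> P 1>>" using r(7)[of 0] r(7)[of 1] by simp_all
  obtain \<delta> where T: "(B, e 0, I 0, p 0, L 1, \<delta>) \<in> \<xi>" by (rule first_cosyzygy)
  note D = xiD[OF T]
  fix c assume c: "<<c : P 0 -> L 1>>" "c \<cdot> ?d = \<zero>\<^bsub>P 1,L 1\<^esub>"
  obtain c' where c': "<<c' : P 0 -> I 0>>" "p 0 \<cdot> c' = c" using proj_lift[OF r(2) T c(1)] .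
  have c'd: "<<c' \<cdot> ?d : P 1 -> I 0>>" using comp_closed[OF d(1) c'(1)] .
  have "p 0 \<cdot> (c' \<cdot> ?d) = \<zero>\<^bsub>P 1,L 1\<^esub>" using comp_assoc[OF d(1) c'(1) D(2)] c' c by simp
  then obtain h where h: "<<h : P 1 -> B>>" "c' \<cdot> ?d = e 0 \<cdot> h"
    using triangle_weak_kernel[OF xi_E[OF T] c'd] by blast
  have "e 0 \<cdot> (h \<cdot> ?d') = \<zero>\<^bsub>P (Suc 1),I 0\<^esub>"
    using comp_assoc[OF d(2) h(1) D(1)] h(2) comp_assoc[OF d(2,1) c'(1)] r(11)[of 0]
      comp_zero_right[OF c'(1) r(8)] by simp
  then have "h \<cdot> ?d' = \<zero>\<^bsub>P (Suc 1),B\<^esub>" using proj_mono[OF r(2) T comp_closed[OF d(2) h(1)]] by blast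
  then obtain u where u: "<<u : P 0 -> B>>" "h = u \<cdot> ?d"
    using a h(1) unfolding proj_acyclic_def One_nat_def by blast
  have eu: "<<e 0 \<cdot> u : P 0 -> I 0>>" using comp_closed[OF u(1) D(1)] .
  let ?w = "diff (P 0) (I 0) c' (e 0 \<cdot> u)"
  have "?w \<cdot> ?d = \<zero>\<^bsub>P 1,I 0\<^esub>"
    unfolding diff_comp[OF d(1) c'(1) eu] using comp_assoc[OF d(1) u(1) D(1)] u(2) h(2)
      diff_eq_zero_iff[OF c'd c'd] by simp
  moreover have "p 0 \<cdot> (e 0 \<cdot> u) = \<zero>\<^bsub>P 0,L 1\<^esub>"
    using comp_assoc[OF u(1) D(1,2)] triangle_comp_zero[OF xi_E[OF T]] comp_zero_left[OF u(1) D(6)] by simp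
  then have "c = p 0 \<cdot> ?w" unfolding comp_diff[OF c'(1) eu D(2)] using c'(2) diff_zero[OF c(1)] by simp
  ultimately show "\<exists>w. <<w : P 0 -> I 0>> \<and> w \<cdot> ?d = \<zero>\<^bsub>P 1,I 0\<^esub> \<and> c = p 0 \<cdot> w"
    using diff_arr[OF c'(1) eu] by blast
qed

lemma mixed_lifting_imp_proj_acyclic:
  assumes m: mixed_lifting shows "proj_acyclic g P f B 0"
  unfolding proj_acyclic_def
proof (intro allI impI)
  note r = proj_resD[OF R] and s = inj_coresD[OF S]
  let ?d = "proj_diff g f 0" and ?d' = "proj_diff g f (Suc 0)"
  have d: "<<?d : P 1 -> P 0>>" "<<?d' : P (Suc 1) -> P 1>>" using r(7)[of 0] r(7)[of 1] by simp_all
  obtain \<delta> where T: "(B, e 0, I 0, p 0, L 1, \<delta>) \<in> \<xi>" by (rule first_cosyzygy)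
  note D = xiD[OF T]
  fix h assume "<<h : P (Suc 0) -> B>>" and z: "h \<cdot> ?d' = \<zero>\<^bsub>P (Suc (Suc 0)),B\<^esub>"
  then have h: "<<h : P 1 -> B>>" by simp
  have eh: "<<e 0 \<cdot> h : P 1 -> I 0>>" using comp_closed[OF h D(1)] .
  have "(e 0 \<cdot> h) \<cdot> ?d' = \<zero>\<^bsub>P (Suc (Suc 0)),I 0\<^esub>"
    using comp_assoc[OF d(2) h D(1)] z comp_zero_right[OF D(1) r(8)[of "Suc (Suc 0)"]] by simp
  then obtain w where w: "<<w : P 0 -> I 0>>" "e 0 \<cdot> h = w \<cdot> ?d"
    using proj_acyclic_injective[OF R s(2)[of 0], of 0] eh unfolding proj_acyclic_def One_nat_def by blast
  have pw: "<<p 0 \<cdot> w : P 0 -> L 1>>" using comp_closed[OF w(1) D(2)] .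
  have "(p 0 \<cdot> w) \<cdot> ?d = \<zero>\<^bsub>P 1,L 1\<^esub>"
    using comp_assoc[OF d(1) w(1) D(2)] w(2) comp_assoc[OF h D(1,2)] triangle_comp_zero[OF xi_E[OF T]]
      comp_zero_left[OF h D(6)] by simp
  then obtain w' where w': "<<w' : P 0 -> I 0>>" "w' \<cdot> ?d = \<zero>\<^bsub>P 1,I 0\<^esub>" "p 0 \<cdot> w = p 0 \<cdot> w'"
    using m pw unfolding mixed_lifting_def by blast
  let ?t = "diff (P 0) (I 0) w w'"
  have t: "<<?t : P 0 -> I 0>>" using diff_arr[OF w(1) w'(1)] .
  have "p 0 \<cdot> ?t = \<zero>\<^bsub>P 0,L 1\<^esub>" unfolding comp_diff[OF w(1) w'(1) D(2)] w'(3)[symmetric]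
    using diff_eq_zero_iff[OF pw pw] by simp
  then obtain u where u: "<<u : P 0 -> B>>" "?t = e 0 \<cdot> u" using triangle_weak_kernel[OF xi_E[OF T] t] by blast
  have "e 0 \<cdot> (u \<cdot> ?d) = e 0 \<cdot> h"
    unfolding comp_assoc[OF d(1) u(1) D(1), symmetric] u(2)[symmetric] diff_comp[OF d(1) w(1) w'(1)] w'(2)
    using diff_zero[OF comp_closed[OF d(1) w(1)]] w(2) by simp
  then have "h = u \<cdot> ?d" using proj_mono_eq[OF r(2) T h comp_closed[OF d(1) u(1)]] by simp
  then show "\<exists>u. <<u : P 0 -> B>> \<and> h = u \<cdot> ?d" using u by blast
qed

lemma initial_triangles:
  obtains \<delta>0 \<delta>1 \<epsilon>1 \<epsilon>2 where "(K 1, g 0, P 0, f 0, A, \<delta>0) \<in> \<xi>" "(K 2, g 1, P 1, f 1, K 1, \<delta>1) \<in> \<xi>"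
    "(L 1, e 1, I 1, p 1, L 2, \<epsilon>1) \<in> \<xi>" "(L 2, e 2, I 2, p 2, L (Suc 2), \<epsilon>2) \<in> \<xi>"
  using proj_resD(3)[OF R, of 0] proj_resD(3)[OF R, of 1] proj_resD(1)[OF R]
    inj_coresD(3)[OF S, of 1] inj_coresD(3)[OF S, of 2]
  by (auto simp: numeral_2_eq_2)

lemma augmentation_comp_diff: "f 0 \<cdot> proj_diff g f 0 = \<zero>\<^bsub>P 1,A\<^esub>"
proof -
  note r = proj_resD[OF R]
  show ?thesis
    using comp_assoc[OF r(5)[of "Suc 0"] r(4)[of 0] r(5)[of 0]] r(6)[of 0] r(1)
      comp_zero_left[OF r(5)[of "Suc 0"] r(10)] by simp
qed

lemma mixed_lifting_imp_inj_acyclic: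
  assumes m: mixed_lifting shows "inj_acyclic e I p A 0"
  unfolding inj_acyclic_def
proof (intro allI impI)
  note r = proj_resD[OF R] and s = inj_coresD[OF S]
  let ?d = "proj_diff g f 0"
  have d: "<<?d : P 1 -> P 0>>" using r(7)[of 0] by simp
  have f0: "<<f 0 : P 0 -> A>>" using r(5)[of 0] r(1) by simp
  obtain \<delta>0 \<delta>1 \<epsilon>1 \<epsilon>2 where R0: "(K 1, g 0, P 0, f 0, A, \<delta>0) \<in> \<xi>" and R1: "(K 2, g 1, P 1, f 1, K 1, \<delta>1) \<in> \<xi>"
    and S1: "(L 1, e 1, I 1, p 1, L 2, \<epsilon>1) \<in> \<xi>" and S2: "(L 2, e 2, I 2, p 2, L (Suc 2), \<epsilon>2) \<in> \<xi>"
    by (rule initial_triangles)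
  note D0 = xiD[OF R0] and D1 = xiD[OF R1] and E1 = xiD[OF S1] and E2 = xiD[OF S2]
  have p0: "<<p 0 : I 0 -> L 1>>" using s(5)[of 0] by simp
  fix h assume "<<h : A -> I (Suc 0)>>" "inj_diff e p (Suc 0) \<cdot> h = \<zero>\<^bsub>A,I (Suc (Suc 0))\<^esub>"
  then have h: "<<h : A -> I 1>>" and z: "(e 2 \<cdot> p 1) \<cdot> h = \<zero>\<^bsub>A,I 2\<^esub>" by (simp_all add: numeral_2_eq_2)
  have hf: "<<h \<cdot> f 0 : P 0 -> I 1>>" using comp_closed[OF f0 h] .
  have "e 2 \<cdot> (p 1 \<cdot> (h \<cdot> f 0)) = \<zero>\<^bsub>P 0,I 2\<^esub>"
    using comp_assoc[OF hf E1(2) E2(1)] comp_assoc[OF f0 h comp_closed[OF E1(2) E2(1)]] z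
      comp_zero_left[OF f0 E2(5)] by simp
  then have "p 1 \<cdot> (h \<cdot> f 0) = \<zero>\<^bsub>P 0,L 2\<^esub>" using proj_mono[OF r(2) S2 comp_closed[OF hf E1(2)]] by blast
  then obtain c where c: "<<c : P 0 -> L 1>>" "h \<cdot> f 0 = e 1 \<cdot> c" using triangle_weak_kernel[OF xi_E[OF S1] hf] by blast
  have "e 1 \<cdot> (c \<cdot> ?d) = \<zero>\<^bsub>P 1,I 1\<^esub>"
    using comp_assoc[OF d c(1) E1(1)] c(2) comp_assoc[OF d f0 h] augmentation_comp_diff comp_zero_right[OF h r(8)[of 1]] by simp
  then have "c \<cdot> ?d = \<zero>\<^bsub>P 1,L 1\<^esub>" using proj_mono[OF r(2) S1 comp_closed[OF d c(1)]] by blast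
  then obtain w where w: "<<w : P 0 -> I 0>>" "w \<cdot> ?d = \<zero>\<^bsub>P 1,I 0\<^esub>" "c = p 0 \<cdot> w"
    using m c(1) unfolding mixed_lifting_def by blast
  have "(w \<cdot> g 0) \<cdot> f 1 = \<zero>\<^bsub>P 1,I 0\<^esub>" using comp_assoc[OF D1(2) D0(1) w(1)] w(2) by simp
  then have "w \<cdot> g 0 = \<zero>\<^bsub>K 1,I 0\<^esub>" using inj_epi[OF s(2) R1 comp_closed[OF D0(1) w(1)]] by blast
  then obtain u where u: "<<u : A -> I 0>>" "w = u \<cdot> f 0" using triangle_weak_cokernel[OF xi_E[OF R0] w(1)] by blast
  have Du: "<<e 1 \<cdot> p 0 : I 0 -> I 1>>" using comp_closed[OF p0 E1(1)] .
  have "h \<cdot> f 0 = ((e 1 \<cdot> p 0) \<cdot> u) \<cdot> f 0"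
    unfolding c(2) w(3) comp_assoc[OF f0 u(1) Du] u(2)[symmetric] comp_assoc[OF w(1) p0 E1(1)] ..
  then have "h = (e 1 \<cdot> p 0) \<cdot> u" using inj_epi_eq[OF s(2) R0 h comp_closed[OF u(1) Du]] by blast
  then show "\<exists>u. <<u : A -> I 0>> \<and> h = inj_diff e p 0 \<cdot> u" using u by auto
qed

lemma inj_acyclic_imp_mixed_lifting:
  assumes a: "inj_acyclic e I p A 0" shows mixed_lifting
  unfolding mixed_lifting_def
proof (intro allI impI)
  note r = proj_resD[OF R] and s = inj_coresD[OF S]
  let ?d = "proj_diff g f 0"
  have d: "<<?d : P 1 -> P 0>>" using r(7)[of 0] by simp
  have f0: "<<f 0 : P 0 -> A>>" using r(5)[of 0] r(1) by simp
  obtain \<delta>0 \<delta>1 \<epsilon>1 \<epsilon>2 where R0: "(K 1, g 0, P 0, f 0, A, \<delta>0) \<in> \<xi>" and R1: "(K 2, g 1, P 1, f 1, K 1, \<delta>1) \<in> \<xi>"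
    and S1: "(L 1, e 1, I 1, p 1, L 2, \<epsilon>1) \<in> \<xi>" and S2: "(L 2, e 2, I 2, p 2, L (Suc 2), \<epsilon>2) \<in> \<xi>"
    by (rule initial_triangles)
  note D0 = xiD[OF R0] and D1 = xiD[OF R1] and E1 = xiD[OF S1] and E2 = xiD[OF S2]
  have p0: "<<p 0 : I 0 -> L 1>>" using s(5)[of 0] by simp
  fix c assume c: "<<c : P 0 -> L 1>>" "c \<cdot> ?d = \<zero>\<^bsub>P 1,L 1\<^esub>"
  have ec: "<<e 1 \<cdot> c : P 0 -> I 1>>" using comp_closed[OF c(1) E1(1)] .
  have D1': "<<e 2 \<cdot> p 1 : I 1 -> I 2>>" using comp_closed[OF E1(2) E2(1)] .
  have "(e 1 \<cdot> c) \<cdot> ?d = \<zero>\<^bsub>P 1,I 1\<^esub>"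
    using comp_assoc[OF d c(1) E1(1)] c(2) comp_zero_right[OF E1(1) r(8)[of 1]] by simp
  then have "((e 1 \<cdot> c) \<cdot> g 0) \<cdot> f 1 = \<zero>\<^bsub>P 1,I 1\<^esub>" using comp_assoc[OF D1(2) D0(1) ec] by simp
  then have "(e 1 \<cdot> c) \<cdot> g 0 = \<zero>\<^bsub>K 1,I 1\<^esub>" using inj_epi[OF s(2) R1 comp_closed[OF D0(1) ec]] by blast
  then obtain h where h: "<<h : A -> I 1>>" "e 1 \<cdot> c = h \<cdot> f 0" using triangle_weak_cokernel[OF xi_E[OF R0] ec] by blast
  have "p 1 \<cdot> (e 1 \<cdot> c) = \<zero>\<^bsub>P 0,L 2\<^esub>"
    using comp_assoc[OF c(1) E1(1,2)] triangle_comp_zero[OF xi_E[OF S1]] comp_zero_left[OF c(1) E1(6)] by simp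
  then have "((e 2 \<cdot> p 1) \<cdot> h) \<cdot> f 0 = \<zero>\<^bsub>P 0,I 2\<^esub>"
    using comp_assoc[OF f0 h(1) D1'] comp_assoc[OF ec E1(2) E2(1)] h(2) comp_zero_right[OF E2(1) r(8)[of 0]] by simp
  then have "(e 2 \<cdot> p 1) \<cdot> h = \<zero>\<^bsub>A,I 2\<^esub>" using inj_epi[OF s(2) R0 comp_closed[OF h(1) D1']] by blast
  then obtain u where u: "<<u : A -> I 0>>" "h = (e 1 \<cdot> p 0) \<cdot> u"
    using a h(1) unfolding inj_acyclic_def by (auto simp: numeral_2_eq_2)
  have uf: "<<u \<cdot> f 0 : P 0 -> I 0>>" using comp_closed[OF f0 u(1)] .
  have "e 1 \<cdot> c = e 1 \<cdot> (p 0 \<cdot> (u \<cdot> f 0))"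
    using h(2) u(2) comp_assoc[OF f0 u(1) comp_closed[OF p0 E1(1)]] comp_assoc[OF uf p0 E1(1)] by simp
  then have "c = p 0 \<cdot> (u \<cdot> f 0)" using proj_mono_eq[OF r(2) S1 c(1) comp_closed[OF uf p0]] by blast
  moreover have "(u \<cdot> f 0) \<cdot> ?d = \<zero>\<^bsub>P 1,I 0\<^esub>"
    using comp_assoc[OF d f0 u(1)] augmentation_comp_diff comp_zero_right[OF u(1) r(8)[of 1]] by simp
  ultimately show "\<exists>w. <<w : P 0 -> I 0>> \<and> w \<cdot> ?d = \<zero>\<^bsub>P 1,I 0\<^esub> \<and> c = p 0 \<cdot> w" using uf by blast
qed

lemma balance_0: "proj_acyclic g P f B 0 \<longleftrightarrow> inj_acyclic e I p A 0"
  using proj_acyclic_imp_mixed_lifting mixed_lifting_imp_proj_acyclic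
    mixed_lifting_imp_inj_acyclic inj_acyclic_imp_mixed_lifting by blast

end

text \<open>Replacing \<open>B\<close> by its first cosyzygy lowers the degree on both sides: by the long exact sequence for
  \<open>Hom(P, -)\<close>, and by dropping the first term of the coresolution.\<close>

lemma balance:
  assumes R: "proj_res K g P f A" and S: "inj_cores L e I p B"
  shows "proj_acyclic g P f B k \<longleftrightarrow> inj_acyclic e I p A k"
  using S
proof (induction k arbitrary: B L e I p)
  case 0
  then show ?case using balance_0[OF R] by blast
next
  case (Suc k)
  note s = inj_coresD[OF Suc.prems]
  obtain \<delta> where T: "(B, e 0, I 0, p 0, L 1, \<delta>) \<in> \<xi>" using s(3)[of 0] s(1) by auto
  have S': "inj_cores (\<lambda>i. L (Suc i)) (\<lambda>i. e (Suc i)) (\<lambda>i. I (Suc i)) (\<lambda>i. p (Suc i)) (L 1)"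
    using Suc.prems unfolding inj_cores_def by auto
  have "proj_acyclic g P f B (Suc k) \<longleftrightarrow> proj_acyclic g P f (L 1) k"
    using proj_acyclic_quotient[OF R T] proj_acyclic_sub[OF R T] proj_acyclic_injective[OF R s(2)[of 0]] by blast
  also have "\<dots> \<longleftrightarrow> inj_acyclic (\<lambda>i. e (Suc i)) (\<lambda>i. I (Suc i)) (\<lambda>i. p (Suc i)) A k"
    using Suc.IH[OF S'] .
  also have "\<dots> \<longleftrightarrow> inj_acyclic e I p A (Suc k)" unfolding inj_acyclic_def ..
  finally show ?case .
qed

lemma proj_res_exists:
  assumes "A \<in> Obj \<C>"
  obtains K g P f where "proj_res K g P f A"
proof -
  have "\<forall>A\<in>Obj \<C>. \<exists>K P. P \<in> Proj \<and> conf K P A"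
    using enough_projectives unfolding enough_xi_projectives_def conf_def by blast
  then obtain s where s: "\<And>A. A \<in> Obj \<C> \<Longrightarrow> \<exists>P. P \<in> Proj \<and> conf (s A) P A" by metis
  define K where "K i = (s ^^ i) A" for i
  have KO: "K i \<in> Obj \<C>" for i
    unfolding K_def using assms s conf_Obj by (induction i) (simp, fastforce)
  have "\<forall>i. \<exists>P g f. P \<in> Proj \<and> (\<exists>\<delta>. (K (Suc i), g, P, f, K i, \<delta>) \<in> \<xi>)"
    using s[OF KO] unfolding conf_def K_def by auto
  then obtain P g f where "\<And>i. P i \<in> Proj \<and> (\<exists>\<delta>. (K (Suc i), g i, P i, f i, K i, \<delta>) \<in> \<xi>)" by metis
  then show ?thesis using that[of K g P f] unfolding proj_res_def by (simp add: K_def)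
qed

lemma inj_cores_exists:
  assumes "B \<in> Obj \<C>"
  obtains L e I p where "inj_cores L e I p B"
proof -
  have "\<forall>B\<in>Obj \<C>. \<exists>L I. I \<in> Inj \<and> conf B I L"
    using enough_injectives unfolding enough_xi_injectives_def conf_def by blast
  then obtain s where s: "\<And>B. B \<in> Obj \<C> \<Longrightarrow> \<exists>I. I \<in> Inj \<and> conf B I (s B)" by metis
  define L where "L i = (s ^^ i) B" for i
  have LO: "L i \<in> Obj \<C>" for i
    unfolding L_def using assms s conf_Obj by (induction i) (simp, fastforce)
  have "\<forall>i. \<exists>I e p. I \<in> Inj \<and> (\<exists>\<delta>. (L i, e, I, p, L (Suc i), \<delta>) \<in> \<xi>)"
    using s[OF LO] unfolding conf_def L_def by auto
  then obtain I e p where "\<And>i. I i \<in> Inj \<and> (\<exists>\<delta>. (L i, e i, I i, p i, L (Suc i), \<delta>) \<in> \<xi>)" by metis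
  then show ?thesis using that[of L e I p] unfolding inj_cores_def by (simp add: L_def)
qed

text \<open>Vanishing of the derived functor in degree \<open>k + 1\<close>, on the injective side: there the coresolution does
  not depend on \<open>A\<close>, which makes the long exact sequence in the first argument immediate.\<close>

definition ext_vanish where
  "ext_vanish k A B \<longleftrightarrow> (\<forall>L e I p. inj_cores L e I p B \<longrightarrow> inj_acyclic e I p A k)"

lemma ext_vanish_iff_proj_acyclic:
  assumes "proj_res K g P f A" "B \<in> Obj \<C>"
  shows "ext_vanish k A B \<longleftrightarrow> proj_acyclic g P f B k"
proof
  obtain L e I p where "inj_cores L e I p B" using inj_cores_exists[OF assms(2)] .
  then show "proj_acyclic g P f B k" if "ext_vanish k A B"
    using that balance[OF assms(1)] unfolding ext_vanish_def by blast
  show "ext_vanish k A B" if "proj_acyclic g P f B k"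
    unfolding ext_vanish_def using that balance[OF assms(1)] by blast
qed

lemma trivial_hom_cohomology_iff:
  assumes R: "proj_res K g P f A" and B: "B \<in> Obj \<C>" and d: "\<And>i. d (Suc i) = proj_diff g f i"
  shows "trivial_group (hom_cohomology \<C> P d (Suc k) B) \<longleftrightarrow> proj_acyclic g P f B k"
proof -
  note r = proj_resD[OF R]
  let ?G = "Hom \<C> (P (Suc k)) B"
  let ?N = "kernel ?G (Hom \<C> (P (Suc (Suc k))) B) (\<lambda>h. h \<cdot> d (Suc (Suc k)))"
  let ?H = "(\<lambda>h. h \<cdot> d (Suc k)) ` carrier (Hom \<C> (P k) B)"
  interpret G: comm_group ?G using hom_group r(8) B by blast
  interpret f: group_hom "Hom \<C> (P k) B" ?G "\<lambda>h. h \<cdot> d (Suc k)"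
    unfolding d by (rule pre_comp_hom[OF r(7) B])
  interpret h: group_hom ?G "Hom \<C> (P (Suc (Suc k))) B" "\<lambda>h. h \<cdot> d (Suc (Suc k))"
    unfolding d by (rule pre_comp_hom[OF r(7) B])
  have arr: "u \<in> carrier (Hom \<C> (P j) B) \<longleftrightarrow> <<u : P j -> B>>" for u j
    using r(8) B by (simp add: arr_def)
  have "?H \<subseteq> ?N"
  proof
    fix v assume "v \<in> ?H"
    then obtain u where u: "<<u : P k -> B>>" "v = u \<cdot> proj_diff g f k" using arr d by auto
    have "v \<cdot> proj_diff g f (Suc k) = \<zero>\<^bsub>P (Suc (Suc k)),B\<^esub>"
      using comp_assoc[OF r(7)[of "Suc k"] r(7)[of k] u(1)] u(2) r(11)[of k] comp_zero_right[OF u(1) r(8)] by simp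
    then show "v \<in> ?N" using comp_closed[OF r(7) u(1)] u(2) arr d by (simp add: kernel_def)
  qed
  then have sub: "subgroup ?H (?G\<lparr>carrier := ?N\<rparr>)"
    using G.subgroup_incl[OF f.img_is_subgroup h.subgroup_kernel] by blast
  have "comm_group (?G\<lparr>carrier := ?N\<rparr>)"
    using G.subgroup_imp_group[OF h.subgroup_kernel] h.subgroup_kernel
    by (intro group.group_comm_groupI) (auto simp: kernel_def G.m_comm)
  from trivial_factor_group_iff[OF this sub]
  have "trivial_group (hom_cohomology \<C> P d (Suc k) B) \<longleftrightarrow> ?N \<subseteq> ?H"
    unfolding hom_cohomology_def by simp
  also have "\<dots> \<longleftrightarrow> proj_acyclic g P f B k"
    unfolding proj_acyclic_def kernel_def subset_iff mem_Collect_eq image_iff arr d Bex_def by blast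
  finally show ?thesis .
qed

lemma trivial_xixt_iff:
  assumes A: "A \<in> Obj \<C>" and B: "B \<in> Obj \<C>"
  shows "trivial_group (xixt \<C> \<xi> (Suc k) A B) \<longleftrightarrow> ext_vanish k A B"
proof -
  obtain K g P f where R: "proj_res K g P f A" using proj_res_exists[OF A] .
  obtain \<delta> where T: "\<forall>i. (K (Suc i), g i, P i, f i, K i, \<delta> i) \<in> \<xi>" using proj_resD(3)[OF R] by metis
  have "xi_projective_resolution \<C> \<xi> P (case_nat (f 0) (proj_diff g f)) A"
    unfolding xi_projective_resolution_def xi_resolution_def
    by (intro conjI exI[of _ K] exI[of _ g] exI[of _ f] exI[of _ \<delta>])
      (use proj_resD(1,2)[OF R] T in simp_all)
  then have ex: "\<exists>x. case x of (P, d) \<Rightarrow> xi_projective_resolution \<C> \<xi> P d A" by blast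
  obtain Q d where Qd: "(SOME (P, d). xi_projective_resolution \<C> \<xi> P d A) = (Q, d)" by fastforce
  then have res: "xi_projective_resolution \<C> \<xi> Q d A" using someI_ex[OF ex] by simp
  then obtain K' g' f' \<delta> where
      "K' 0 = A" "\<And>i. (K' (Suc i), g' i, Q i, f' i, K' i, \<delta> i) \<in> \<xi>" "\<And>i. d (Suc i) = g' i \<cdot> f' (Suc i)"
    unfolding xi_projective_resolution_def xi_resolution_def by blast
  moreover from this(1,2) have R': "proj_res K' g' Q f' A"
    using res unfolding proj_res_def xi_projective_resolution_def by blast
  ultimately show ?thesis
    using trivial_hom_cohomology_iff[OF R' B] ext_vanish_iff_proj_acyclic[OF R' B]
    unfolding xixt_def Qd by simp
qed

lemma ext_vanish_middle: "\<lbrakk>conf A B C; ext_vanish k A Z; ext_vanish k C Z\<rbrakk> \<Longrightarrow> ext_vanish k B Z"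
  unfolding ext_vanish_def conf_def by (meson inj_acyclic_middle)

lemma ext_vanish_cone: "\<lbrakk>conf A B C; ext_vanish k A Z; ext_vanish (Suc k) B Z\<rbrakk> \<Longrightarrow> ext_vanish (Suc k) C Z"
  unfolding ext_vanish_def conf_def by (meson inj_acyclic_cone)

lemma ext_vanish_cocone: "\<lbrakk>conf A B C; ext_vanish k B Z; ext_vanish (Suc k) C Z\<rbrakk> \<Longrightarrow> ext_vanish k A Z"
  unfolding ext_vanish_def conf_def by (meson inj_acyclic_cocone)

lemma ext_vanish_projective: "Q \<in> Proj \<Longrightarrow> ext_vanish k Q Z"
  unfolding ext_vanish_def using inj_acyclic_projective by blast

lemma ext_vanish_quotient:
  assumes c: "conf A B C" and M: "M \<in> Obj \<C>" and v: "ext_vanish k M B" "ext_vanish (Suc k) M A"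
  shows "ext_vanish k M C"
proof -
  obtain K g P f where R: "proj_res K g P f M" using proj_res_exists[OF M] .
  obtain x y \<delta> where T: "(A, x, B, y, C, \<delta>) \<in> \<xi>" using c unfolding conf_def by blast
  show ?thesis
    using v proj_acyclic_quotient[OF R T] conf_Obj[OF c] by (simp add: ext_vanish_iff_proj_acyclic[OF R])
qed

lemma ext_vanish_has_res:
  assumes M: "M \<in> Obj \<C>" and v: "\<And>Y j. Y \<in> \<Y> \<Longrightarrow> n \<le> j \<Longrightarrow> ext_vanish j M Y"
  shows "has_res \<Y> m N \<Longrightarrow> n \<le> j \<Longrightarrow> ext_vanish j M N"
proof (induction m arbitrary: N j)
  case 0
  then show ?case using v by simp
next
  case (Suc m)
  then obtain K Y where K: "conf K Y N" "Y \<in> \<Y>" "has_res \<Y> m K" by auto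
  show ?case using ext_vanish_quotient[OF K(1) M v[OF K(2) Suc.prems(2)]] Suc.IH[OF K(3)] Suc.prems(2) by simp
qed

text \<open>The identity of \<open>K\<close> extends to \<open>Q\<close>.  An extension \<open>t\<close> of \<open>e\<^sub>0 : K \<rightarrow> I\<^sub>0\<close> to \<open>Q\<close> exists by injectivity; its obstruction to
  landing in \<open>K\<close> is a cocycle on \<open>W\<close>, which vanishing allows to be corrected by a map \<open>u : W \<rightarrow> I\<^sub>0\<close>.\<close>

lemma ext_vanish_splits:
  assumes c: "conf K Q W" and K: "K \<in> Proj" and Q: "Q \<in> Proj" and v: "ext_vanish 0 W K"
  shows "conf W Q K"
proof -
  obtain x y \<delta> where T: "(K, x, Q, y, W, \<delta>) \<in> \<xi>" using c unfolding conf_def by blast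
  note D = xiD[OF T]
  obtain L e I p where S: "inj_cores L e I p K" using inj_cores_exists[OF proj_Obj[OF K]] .
  note s = inj_coresD[OF S]
  obtain \<epsilon>0 where S0: "(K, e 0, I 0, p 0, L 1, \<epsilon>0) \<in> \<xi>" using s(3)[of 0] s(1) by auto
  obtain \<epsilon>1 where S1: "(L 1, e 1, I 1, p 1, L 2, \<epsilon>1) \<in> \<xi>" using s(3)[of 1] by (auto simp: numeral_2_eq_2)
  note E0 = xiD[OF S0] and E1 = xiD[OF S1]
  have e2: "<<e 2 : L 2 -> I 2>>" using s(4)[of 2] .
  have D0: "<<e 1 \<cdot> p 0 : I 0 -> I 1>>" using comp_closed[OF E0(2) E1(1)] .
  obtain t where t: "<<t : Q -> I 0>>" "t \<cdot> x = e 0" using inj_extend[OF s(2) T E0(1)] .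
  have pt: "<<p 0 \<cdot> t : Q -> L 1>>" using comp_closed[OF t(1) E0(2)] .
  have "(p 0 \<cdot> t) \<cdot> x = \<zero>\<^bsub>K,L 1\<^esub>" using comp_assoc[OF D(1) t(1) E0(2)] t(2) triangle_comp_zero[OF xi_E[OF S0]] by simp
  then obtain c where c: "<<c : W -> L 1>>" "p 0 \<cdot> t = c \<cdot> y" using triangle_weak_cokernel[OF xi_E[OF T] pt] by blast
  have ec: "<<e 1 \<cdot> c : W -> I 1>>" using comp_closed[OF c(1) E1(1)] .
  have "p 1 \<cdot> (e 1 \<cdot> c) = \<zero>\<^bsub>W,L 2\<^esub>"
    using comp_assoc[OF c(1) E1(1,2)] triangle_comp_zero[OF xi_E[OF S1]] comp_zero_left[OF c(1) E1(6)] by simp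
  then have "(e 2 \<cdot> p 1) \<cdot> (e 1 \<cdot> c) = \<zero>\<^bsub>W,I 2\<^esub>"
    using comp_assoc[OF ec E1(2) e2] comp_zero_right[OF e2 D(6)] by simp
  moreover have "inj_acyclic e I p W 0" using v S unfolding ext_vanish_def by blast
  ultimately obtain u where u: "<<u : W -> I 0>>" "e 1 \<cdot> c = (e 1 \<cdot> p 0) \<cdot> u"
    using ec unfolding inj_acyclic_def by (auto simp: numeral_2_eq_2)
  have pu: "<<p 0 \<cdot> u : W -> L 1>>" and uy: "<<u \<cdot> y : Q -> I 0>>"
    using comp_closed[OF u(1) E0(2)] comp_closed[OF D(2) u(1)] .
  have "e 1 \<cdot> (p 0 \<cdot> t) = (e 1 \<cdot> c) \<cdot> y" using c(2) comp_assoc[OF D(2) c(1) E1(1)] by simp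
  also have "\<dots> = e 1 \<cdot> (p 0 \<cdot> (u \<cdot> y))"
    using u(2) comp_assoc[OF D(2) u(1) D0] comp_assoc[OF uy E0(2) E1(1)] by simp
  finally have eq: "p 0 \<cdot> t = p 0 \<cdot> (u \<cdot> y)"
    using proj_mono_eq[OF Q S1 pt comp_closed[OF uy E0(2)]] by blast
  let ?s = "diff Q (I 0) t (u \<cdot> y)"
  have sa: "<<?s : Q -> I 0>>" using diff_arr[OF t(1) uy] .
  have "p 0 \<cdot> ?s = \<zero>\<^bsub>Q,L 1\<^esub>"
    unfolding comp_diff[OF t(1) uy E0(2)] eq[symmetric] using diff_eq_zero_iff[OF pt pt] by simp
  then obtain r where r: "<<r : Q -> K>>" "?s = e 0 \<cdot> r" using triangle_weak_kernel[OF xi_E[OF S0] sa] by blast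
  have uyx: "(u \<cdot> y) \<cdot> x = \<zero>\<^bsub>K,I 0\<^esub>"
    using comp_assoc[OF D(1,2) u(1)] triangle_comp_zero[OF xi_E[OF T]] comp_zero_right[OF u(1) D(4)] by simp
  have "e 0 \<cdot> (r \<cdot> x) = ?s \<cdot> x" using comp_assoc[OF D(1) r(1) E0(1)] r(2) by simp
  also have "\<dots> = e 0 \<cdot> Ident \<C> K"
    unfolding diff_comp[OF D(1) t(1) uy] uyx t(2) using diff_zero[OF E0(1)] comp_ident_right[OF E0(1)] by simp
  finally have "r \<cdot> x = Ident \<C> K"
    using proj_mono_eq[OF K S0 comp_closed[OF D(1) r(1)] ident_closed[OF D(4)]] by blast
  then have "\<delta> = \<zero>\<E>\<^bsub>W,K\<^esub>" using retraction_imp_split[OF xi_E[OF T] r(1)] by blast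
  then show ?thesis using conf_split_swap xi_E[OF T] by blast
qed

end

section \<open>Vanishing of derived functors and Gorenstein dimension\<close>

context quasi_resolving_category
begin

text \<open>The left half of a complete resolution is a projective resolution on which \<open>Hom(-, X)\<close> is exact.\<close>

lemma ext_vanish_G:
  assumes "G \<in> \<G>" "X \<in> \<X>"
  shows "ext_vanish k G X"
proof -
  obtain P d K g f \<delta> n where c: "complete_resolution \<C> \<xi> \<X> P d K g f \<delta>" and G: "G = K n"
    using assms(1) unfolding GQP_def by blast
  have T: "(K (n + int (Suc i)), g (n + int i), P (n + int i), f (n + int i), K (n + int i), \<delta> (n + int i)) \<in> hom_exact_triangles \<C> \<xi> \<X>"
    and P: "P (n + int i) \<in> Proj" for i
    using c[unfolded complete_resolution_def, rule_format, of "n + int i"] P_iff by (auto simp: algebra_simps)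
  note T' = hom_exact_triangle_xi[OF T]
  have R: "proj_res (\<lambda>i. K (n + int i)) (\<lambda>i. g (n + int i)) (\<lambda>i. P (n + int i)) (\<lambda>i. f (n + int i)) G"
    unfolding proj_res_def using G T' P by auto
  show ?thesis
    unfolding ext_vanish_iff_proj_acyclic[OF R X_Obj[OF assms(2)]]
    by (rule proj_acyclic_if_hom_exact[OF R])
      (use T[unfolded hom_exact_triangle_iff[OF T']] assms(2) in blast)+
qed

lemma G_res_imp_ext_vanish:
  "\<lbrakk>has_res \<G> n M; X \<in> \<X>; n \<le> j\<rbrakk> \<Longrightarrow> ext_vanish j M X"
proof (induction n arbitrary: M j)
  case 0
  then show ?case using ext_vanish_G by simp
next
  case (Suc n)
  then obtain K G where K: "conf K G M" "G \<in> \<G>" "has_res \<G> n K" by auto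
  obtain i where i: "j = Suc i" "n \<le> i" using Suc.prems(3) by (cases j) auto
  show ?case
    unfolding i(1) using ext_vanish_cone[OF K(1) Suc.IH[OF K(3) Suc.prems(2) i(2)] ext_vanish_G[OF K(2) Suc.prems(2)]] .
qed

text \<open>Dimension shifting along the resolution reduces to \<open>n = 0\<close>; there the syzygy is in \<open>\<P>\<close> by induction
  and its inclusion splits.\<close>

lemma P_res_dim_detected:
  "\<lbrakk>has_res \<P> m W; \<And>P j. P \<in> \<P> \<Longrightarrow> n \<le> j \<Longrightarrow> ext_vanish j W P\<rbrakk> \<Longrightarrow> has_res \<P> n W"
proof (induction m arbitrary: n W)
  case 0
  then show ?case using P_has_res_le[of 0 W n] by simp
next
  case (Suc m)
  then obtain K Q where K: "conf K Q W" "Q \<in> \<P>" "has_res \<P> m K" by auto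
  have shift: "ext_vanish j K P" if "P \<in> \<P>" "n \<le> Suc j" for P j
    using ext_vanish_cocone[OF K(1)] ext_vanish_projective[of Q] K(2) P_iff Suc.prems(2)[OF that] by blast
  show ?case
  proof (cases n)
    case 0
    have KP: "K \<in> \<P>" using Suc.IH[OF K(3), of 0] shift 0 by simp
    have "conf W Q K" using ext_vanish_splits[OF K(1)] KP K(2) P_iff Suc.prems(2)[OF KP] 0 by simp
    then show ?thesis using P_cocone K(2) KP 0 by simp
  next
    case (Suc n')
    have "has_res \<P> n' K" using Suc.IH[OF K(3), of n'] shift Suc by simp
    then show ?thesis using K Suc by auto
  qed
qed

lemma G_res_dim_detected:
  assumes "has_res \<G> m M" "\<And>P j. P \<in> \<P> \<Longrightarrow> n \<le> j \<Longrightarrow> ext_vanish j M P"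
  shows "has_res \<G> n M"
proof -
  obtain W G where W: "conf M W G" "G \<in> \<G>" "has_res \<P> m W"
    using assms(1) unfolding G_res_iff_embedding G_embedding_def by blast
  have "has_res \<P> n W"
    using P_res_dim_detected[OF W(3)] ext_vanish_middle[OF W(1) assms(2) ext_vanish_G[OF W(2)]] P_iff by blast
  then show ?thesis unfolding G_res_iff_embedding G_embedding_def using W by blast
qed

text \<open>For objects of finite \<open>\<P>\<close>-dimension the vanishing against \<open>\<P>\<close> detects both dimensions.\<close>

lemma P_res_dim_eq_G_res_dim:
  assumes "has_res \<P> m W"
  shows "res_dim \<C> \<xi> \<P> W = res_dim \<C> \<xi> \<G> W"
proof -
  have "has_res \<P> j W \<longleftrightarrow> has_res \<G> j W" for j
  proof
    show "has_res \<G> j W" if "has_res \<P> j W" using P_res_imp_G_res[OF that] .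
    show "has_res \<P> j W" if "has_res \<G> j W"
      using P_res_dim_detected[OF assms] G_res_imp_ext_vanish[OF that] P_iff by blast
  qed
  then have le: "res_dim \<C> \<xi> \<P> W \<le> enat j \<longleftrightarrow> res_dim \<C> \<xi> \<G> W \<le> enat j" for j
    by (simp only: P_res_dim_le G_res_dim_le)
  show ?thesis
  proof (rule antisym)
    show "res_dim \<C> \<xi> \<P> W \<le> res_dim \<C> \<xi> \<G> W"
      using le by (cases "res_dim \<C> \<xi> \<G> W") auto
    show "res_dim \<C> \<xi> \<G> W \<le> res_dim \<C> \<xi> \<P> W"
      using le by (cases "res_dim \<C> \<xi> \<P> W") auto
  qed
qed

lemma bounded_mixed_iff:
  "(\<exists>Y d. bounded_xi_exact \<C> \<xi> n Y d M \<and> (\<forall>i\<le>n. Y i \<in> (if i = m then \<G> else \<P>))) \<longleftrightarrow>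
    has_resolution n (\<lambda>i. if i = m then \<G> else \<P>) M"
  by (rule bounded_xi_exact_iff_has_resolution) (use G_sub P_sub in auto)

lemma ext_family_iff:
  assumes "M \<in> Obj \<C>" "\<Y> \<subseteq> Obj \<C>"
  shows "(\<forall>Y\<in>\<Y>. \<forall>i\<ge>1. trivial_group (xixt \<C> \<xi> (n + i) M Y)) \<longleftrightarrow> (\<forall>Y\<in>\<Y>. \<forall>j\<ge>n. ext_vanish j M Y)"
proof -
  have "(\<forall>i\<ge>1. trivial_group (xixt \<C> \<xi> (n + i) M Y)) \<longleftrightarrow> (\<forall>j\<ge>n. ext_vanish j M Y)" if "Y \<in> \<Y>" for Y
  proof -
    have "trivial_group (xixt \<C> \<xi> (n + Suc i) M Y) \<longleftrightarrow> ext_vanish (n + i) M Y" for i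
      using trivial_xixt_iff[OF assms(1), of Y "n + i"] assms(2) that by auto
    then show ?thesis by (metis One_nat_def Suc_le_D Suc_le_mono le_Suc_ex le_add1 zero_le)
  qed
  then show ?thesis by blast
qed

lemma res_hat_iff:
  assumes "\<Y> \<subseteq> Obj \<C>" "\<And>Z. zero_object \<C> Z \<Longrightarrow> Z \<in> \<Y>"
  shows "N \<in> res_hat \<C> \<xi> \<Y> \<longleftrightarrow> (\<exists>m. has_res \<Y> m N)"
  unfolding res_hat_def using res_dim_finite_iff[OF assms] has_res_Obj[OF _ assms(1)] by blast

end

theorem theorem5p19:
  fixes \<C> :: "('o, 'm, 'e) extri_data"
    and \<xi> :: "('o, 'm, 'e) triangle set"
    and \<X> :: "'o set" and M :: 'o and n :: nat
  assumes "extriangulated_category \<C>" and "WIC \<C>"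
    and "proper_class \<C> \<xi>"
    and "enough_xi_projectives \<C> \<xi>" and "enough_xi_injectives \<C> \<xi>"
    and "quasi_resolving \<C> \<xi> \<X>"
    and "M \<in> Obj \<C>" and "res_dim \<C> \<xi> (GQP \<C> \<xi> \<X>) M < \<infinity>"
  shows
   "let \<G> = GQP \<C> \<xi> \<X>; \<P> = proj_in \<C> \<xi> \<X>;
        c1 = res_dim_le \<C> \<xi> \<G> M (int n);
        c2 = (\<exists>W G x y \<delta>. (M, x, W, y, G, \<delta>) \<in> \<xi> \<and> G \<in> \<G> \<and> res_dim_le \<C> \<xi> \<P> W (int n));
        c3 = (\<exists>K G' x y \<delta>. (K, x, G', y, M, \<delta>) \<in> \<xi> \<and> G' \<in> \<G> \<and> res_dim_le \<C> \<xi> \<P> K (int n - 1));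
        c4 = (\<exists>W\<^sub>M G\<^sub>M x y \<delta> W' G' x' y' \<delta>'.
                (W\<^sub>M, x, G\<^sub>M, y, M, \<delta>) \<in> \<xi> \<and> (M, x', W', y', G', \<delta>') \<in> \<xi> \<and>
                G\<^sub>M \<in> \<G> \<and> G' \<in> \<G> \<and> res_dim_le \<C> \<xi> \<P> W\<^sub>M (int n - 1) \<and>
                res_dim \<C> \<xi> \<P> W' = res_dim \<C> \<xi> \<G> W' \<and> res_dim_le \<C> \<xi> \<G> W' (int n));
        c5 = (\<exists>Y d. bounded_xi_exact \<C> \<xi> n Y d M \<and> Y 0 \<in> \<G> \<and> (\<forall>i. 1 \<le> i \<and> i \<le> n \<longrightarrow> Y i \<in> \<P>));
        c6 = (\<forall>m\<le>n. \<exists>Y d. bounded_xi_exact \<C> \<xi> n Y d M \<and> Y m \<in> \<G> \<and>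
                (\<forall>i\<le>n. i \<noteq> m \<longrightarrow> Y i \<in> \<P>));
        c7 = (\<forall>P\<in>\<P>. \<forall>i\<ge>1. trivial_group (xixt \<C> \<xi> (n + i) M P));
        c8 = (\<forall>Q\<in>res_hat \<C> \<xi> \<P>. \<forall>i\<ge>1. trivial_group (xixt \<C> \<xi> (n + i) M Q));
        c9 = (\<forall>X\<in>\<X>. \<forall>i\<ge>1. trivial_group (xixt \<C> \<xi> (n + i) M X));
        c10 = (\<forall>N\<in>res_hat \<C> \<xi> \<X>. \<forall>i\<ge>1. trivial_group (xixt \<C> \<xi> (n + i) M N))
    in (c1 \<longleftrightarrow> c2) \<and> (c1 \<longleftrightarrow> c3) \<and> (c1 \<longleftrightarrow> c4) \<and> (c1 \<longleftrightarrow> c5) \<and> (c1 \<longleftrightarrow> c6) \<and>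
       (c1 \<longleftrightarrow> c7) \<and> (c1 \<longleftrightarrow> c8) \<and> (c1 \<longleftrightarrow> c9) \<and> (c1 \<longleftrightarrow> c10)"
proof -
  interpret quasi_resolving_category \<C> \<xi> \<X>
    using assms(1,3-6)
    by (simp add: quasi_resolving_category_def quasi_resolving_category_axioms_def
        enough_xi_category_def enough_xi_category_axioms_def)
  note M = assms(7)
  obtain m where m: "has_res \<G> m M"
    using assms(8) res_dim_finite_iff[OF G_sub zero_object_G] by blast
  let ?c1 = "has_res \<G> n M"
  have dim_G: "res_dim_le \<C> \<xi> \<G> W (int n) \<longleftrightarrow> has_res \<G> n W" for W
    by (simp add: res_dim_le_def G_res_dim_le)
  have dim_P: "res_dim_le \<C> \<xi> \<P> W (int n) \<longleftrightarrow> has_res \<P> n W" for W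
    by (simp add: res_dim_le_def P_res_dim_le)
  have c2: "?c1 \<longleftrightarrow> (\<exists>W G x y \<delta>. (M, x, W, y, G, \<delta>) \<in> \<xi> \<and> G \<in> \<G> \<and> res_dim_le \<C> \<xi> \<P> W (int n))"
    unfolding G_res_iff_embedding G_embedding_def conf_def dim_P by blast
  have c3: "?c1 \<longleftrightarrow> (\<exists>K G' x y \<delta>. (K, x, G', y, M, \<delta>) \<in> \<xi> \<and> G' \<in> \<G> \<and> res_dim_le \<C> \<xi> \<P> K (int n - 1))"
    unfolding G_res_iff_cover G_cover_def conf_def P_res_dim_le_pred_iff by blast
  have c4: "?c1 \<longleftrightarrow> (\<exists>W\<^sub>M G\<^sub>M x y \<delta> W' G' x' y' \<delta>'.
                (W\<^sub>M, x, G\<^sub>M, y, M, \<delta>) \<in> \<xi> \<and> (M, x', W', y', G', \<delta>') \<in> \<xi> \<and>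
                G\<^sub>M \<in> \<G> \<and> G' \<in> \<G> \<and> res_dim_le \<C> \<xi> \<P> W\<^sub>M (int n - 1) \<and>
                res_dim \<C> \<xi> \<P> W' = res_dim \<C> \<xi> \<G> W' \<and> res_dim_le \<C> \<xi> \<G> W' (int n))" (is "_ \<longleftrightarrow> ?c4")
  proof
    assume 1: ?c1
    obtain W G x y \<delta> where W: "(M, x, W, y, G, \<delta>) \<in> \<xi>" "G \<in> \<G>" "has_res \<P> n W"
      using 1 c2 unfolding dim_P by blast
    have "res_dim \<C> \<xi> \<P> W = res_dim \<C> \<xi> \<G> W" "res_dim_le \<C> \<xi> \<G> W (int n)"
      using P_res_dim_eq_G_res_dim[OF W(3)] dim_G P_res_imp_G_res[OF W(3)] by blast+
    then show ?c4 using W 1 c3 by blast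
  next
    assume ?c4 then show ?c1 using c3 by blast
  qed
  have c5: "?c1 \<longleftrightarrow> (\<exists>Y d. bounded_xi_exact \<C> \<xi> n Y d M \<and> Y 0 \<in> \<G> \<and> (\<forall>i. 1 \<le> i \<and> i \<le> n \<longrightarrow> Y i \<in> \<P>))"
  proof -
    have "(\<forall>i\<le>n. Y i \<in> (if i = 0 then \<G> else \<P>)) \<longleftrightarrow> Y 0 \<in> \<G> \<and> (\<forall>i. 1 \<le> i \<and> i \<le> n \<longrightarrow> Y i \<in> \<P>)" for Y :: "nat \<Rightarrow> 'o"
      by auto
    then show ?thesis using bounded_mixed_iff[of n M 0] G_res_imp_mixed[of n M 0] mixed_imp_G_res by auto
  qed
  have c6: "?c1 \<longleftrightarrow> (\<forall>m\<le>n. \<exists>Y d. bounded_xi_exact \<C> \<xi> n Y d M \<and> Y m \<in> \<G> \<and> (\<forall>i\<le>n. i \<noteq> m \<longrightarrow> Y i \<in> \<P>))"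
  proof -
    have "(\<forall>i\<le>n. Y i \<in> (if i = m then \<G> else \<P>)) \<longleftrightarrow> Y m \<in> \<G> \<and> (\<forall>i\<le>n. i \<noteq> m \<longrightarrow> Y i \<in> \<P>)"
      if "m \<le> n" for m and Y :: "nat \<Rightarrow> 'o"
      using that by auto
    then have "(\<forall>m\<le>n. \<exists>Y d. bounded_xi_exact \<C> \<xi> n Y d M \<and> Y m \<in> \<G> \<and> (\<forall>i\<le>n. i \<noteq> m \<longrightarrow> Y i \<in> \<P>)) \<longleftrightarrow>
        (\<forall>m\<le>n. has_resolution n (\<lambda>i. if i = m then \<G> else \<P>) M)"
      unfolding bounded_mixed_iff[symmetric] by simp
    moreover have "\<dots> \<longleftrightarrow> ?c1" using G_res_imp_mixed[of n M] mixed_imp_G_res[of n 0 M] by blast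
    ultimately show ?thesis by simp
  qed
  have hat_P: "res_hat \<C> \<xi> \<P> \<subseteq> Obj \<C>" and hat_X: "res_hat \<C> \<xi> \<X> \<subseteq> Obj \<C>"
    unfolding res_hat_def by blast+
  have hat_P_iff: "N \<in> res_hat \<C> \<xi> \<P> \<longleftrightarrow> (\<exists>m. has_res \<P> m N)" for N
    by (rule res_hat_iff[OF P_sub zero_object_P])
  have hat_X_iff: "N \<in> res_hat \<C> \<xi> \<X> \<longleftrightarrow> (\<exists>m. has_res \<X> m N)" for N
    by (rule res_hat_iff[OF X_sub zero_object_X])
  \<comment> \<open>The vanishing conditions are linked by the cycle \<open>\<G>\<close>-dimension at most \<open>n\<close>, then \<open>\<X>\<close>, then \<open>\<P>\<close>, then \<open>\<G>\<close>-dimension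
    at most \<open>n\<close>, and dimension shifting passes from \<open>\<X>\<close> and \<open>\<P>\<close> to the objects of finite dimension.\<close>
  define v where "v \<Y> \<longleftrightarrow> (\<forall>Y\<in>\<Y>. \<forall>j\<ge>n. ext_vanish j M Y)" for \<Y>
  have "P \<in> res_hat \<C> \<xi> \<P>" if "P \<in> \<P>" for P
    unfolding hat_P_iff using that by (intro exI[of _ 0]) simp
  then have "v (res_hat \<C> \<xi> \<P>) \<Longrightarrow> v \<P>" unfolding v_def by blast
  moreover have "X \<in> res_hat \<C> \<xi> \<X>" if "X \<in> \<X>" for X
    unfolding hat_X_iff using that by (intro exI[of _ 0]) simp
  then have "v (res_hat \<C> \<xi> \<X>) \<Longrightarrow> v \<X>" unfolding v_def by blast
  moreover have "v \<P> \<Longrightarrow> v (res_hat \<C> \<xi> \<P>)" "v \<X> \<Longrightarrow> v (res_hat \<C> \<xi> \<X>)"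
    unfolding v_def hat_P_iff Ball_def hat_X_iff using ext_vanish_has_res[OF M] by blast+
  moreover have "v \<X> \<Longrightarrow> v \<P>" unfolding v_def using P_iff by blast
  moreover have "?c1 \<Longrightarrow> v \<X>" unfolding v_def using G_res_imp_ext_vanish by blast
  moreover have "v \<P> \<Longrightarrow> ?c1" unfolding v_def using G_res_dim_detected[OF m] by blast
  ultimately have v: "?c1 \<longleftrightarrow> v \<P>" "?c1 \<longleftrightarrow> v (res_hat \<C> \<xi> \<P>)" "?c1 \<longleftrightarrow> v \<X>" "?c1 \<longleftrightarrow> v (res_hat \<C> \<xi> \<X>)"
    by blast+
  show ?thesis
    unfolding Let_def dim_G
      ext_family_iff[OF M P_sub] ext_family_iff[OF M hat_P] ext_family_iff[OF M X_sub] ext_family_iff[OF M hat_X]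
      v_def[symmetric]
    by (intro conjI c2 c3 c4[unfolded dim_G] c5 c6 v)
qed

end
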